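(* Let $m\ge1$ and let $n\ge2$ be even, and consider the dimer model on a positively weighted Fisher graph embedded in a cylinder of height $m$ and circumference $ln$; let $l\to\infty$ with $m$ and $n$ fixed. Let $P(z)$ be the characteristic polynomial of the cylinder of height $m$ and circumference $n$. Consider two edges $e_1$ and $e_2$, and their correlation $\Pr(e_1\,\&\,e_2)-\Pr(e_1)\Pr(e_2)$ in the limit $l\to\infty$, where the distance $|e_1-e_2|\to\infty$ as $e_2$ is moved along the band by translations of the fundamental domain. Then, as $|e_1-e_2|\to\infty$: (i) if $P(z)=0$ does not intersect the unit circle $\mathbb{T}=\{z:|z|=1\}$, the edge-edge correlation decays exponentially; (ii) if $P(z)=0$ has a node at $1$ (a real zero of multiplicity $2$ at $z=1$), the edge-edge correlation tends to a constant.
   Context: The Fisher graph is the honeycomb lattice with every vertex replaced by a triangle. The infinite band graph of height $m$ has vertices $\beta_s(x,y),\omega_s(x,y)$, $s\in\{a,b,c\}$, $x\in\mathbb{Z}$, $y\in\{0,\dots,m-1\}$, and oriented edges: $\beta_a\to\beta_b\to\beta_c\to\beta_a$ and $\omega_a\to\omega_b\to\omega_c\to\omega_a$ at each $(x,y)$; $\beta_a(x,y)\to\omega_a(x,y)$; $\beta_b(x,y)\to\omega_b(x+1,y)$; $\beta_c(x,y)\to\omega_c(x,y+1)$ for $0\le y\le m-2$. Edge weights $W(e)>0$ are invariant under $x\mapsto x+n$. The cylinder of height $m$ and circumference $N$ (a multiple of $n$) is obtained by taking $x$ modulo $N$. For the cylinder of circumference $n$, the $z$-edges are the $m$ edges $\beta_b(n-1,y)\to\omega_b(0,y)$.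 $K(z)$ is the $6mn\times6mn$ matrix on the vertices of the cylinder of circumference $n$ such that for each oriented edge $u\to v$, the $(u,v)$ entry is $W(uv)$ and the $(v,u)$ entry is $-W(uv)$ for non-$z$-edges, and these entries are $zW(uv)$ and $-z^{-1}W(uv)$ respectively for $z$-edges; all other entries are $0$. $P(z)=\det K(z)$. The dimer model on a finite weighted graph is the Boltzmann probability measure on perfect matchings $D$, proportional to $\prod_{e\in D}W(e)$. $\Pr(e_1\,\&\,e_2)$ is the limit as $l\to\infty$ of the probability that $e_1$ and $e_2$ both belong to the matching, and similarly for $\Pr(e_i)$. Translations of the fundamental domain are $x\mapsto x+kn$, $k\in\mathbb{Z}$. *)

theory Defs
  imports
    "HOL-Complex_Analysis.Complex_Analysis"
    "Jordan_Normal_Form.Determinant"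
    "Graph_Theory.Digraph"
begin

section \<open>The dimer model on a finite weighted graph\<close>

text \<open>
  A graph is given by a reference orientation, that is, as a \<^typ>\<open>('v, 'e) pre_digraph\<close>; the
  orientation plays no role for matchings.
\<close>

definition incident :: "('v, 'e) pre_digraph \<Rightarrow> 'e \<Rightarrow> 'v \<Rightarrow> bool" where
  "incident G e v \<longleftrightarrow> v = tail G e \<or> v = head G e"

definition perfect_matchings :: "('v, 'e) pre_digraph \<Rightarrow> 'e set set" where
  "perfect_matchings G = {D. D \<subseteq> arcs G \<and> (\<forall>v\<in>verts G. \<exists>!e. e \<in> D \<and> incident G e v)}"

definition partition_function :: "('v, 'e) pre_digraph \<Rightarrow> ('e \<Rightarrow> real) \<Rightarrow> real" where
  "partition_function G W = (\<Sum>D\<in>perfect_matchings G. \<Prod>e\<in>D. W e)"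

definition dimer_measure :: "('v, 'e) pre_digraph \<Rightarrow> ('e \<Rightarrow> real) \<Rightarrow> 'e set measure" where
  "dimer_measure G W =
     point_measure (perfect_matchings G)
       (\<lambda>D. ennreal ((\<Prod>e\<in>D. W e) / partition_function G W))"


section \<open>Fisher graphs on the band and on cylinders\<close>

datatype corner = Corner_a | Corner_b | Corner_c

datatype vertex =
    is_VBeta: VBeta (corner_of: corner) (xpos: int) (ypos: nat)
  | VOmega (corner_of: corner) (xpos: int) (ypos: nat)

text \<open>\<^term>\<open>VBeta s x y\<close> and \<^term>\<open>VOmega s x y\<close> are the vertices $\beta_s(x,y)$, $\omega_s(x,y)$.\<close>

type_synonym edge = "vertex \<times> vertex"

inductive_set band_arcs :: "nat \<Rightarrow> edge set" for m :: nat where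
  beta_ab: "y < m \<Longrightarrow> (VBeta Corner_a x y, VBeta Corner_b x y) \<in> band_arcs m"
| beta_bc: "y < m \<Longrightarrow> (VBeta Corner_b x y, VBeta Corner_c x y) \<in> band_arcs m"
| beta_ca: "y < m \<Longrightarrow> (VBeta Corner_c x y, VBeta Corner_a x y) \<in> band_arcs m"
| omega_ab: "y < m \<Longrightarrow> (VOmega Corner_a x y, VOmega Corner_b x y) \<in> band_arcs m"
| omega_bc: "y < m \<Longrightarrow> (VOmega Corner_b x y, VOmega Corner_c x y) \<in> band_arcs m"
| omega_ca: "y < m \<Longrightarrow> (VOmega Corner_c x y, VOmega Corner_a x y) \<in> band_arcs m"
| ext_a: "y < m \<Longrightarrow> (VBeta Corner_a x y, VOmega Corner_a x y) \<in> band_arcs m"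
| ext_b: "y < m \<Longrightarrow> (VBeta Corner_b x y, VOmega Corner_b (x + 1) y) \<in> band_arcs m"
| ext_c: "Suc y < m \<Longrightarrow> (VBeta Corner_c x y, VOmega Corner_c x (Suc y)) \<in> band_arcs m"

fun shift :: "int \<Rightarrow> vertex \<Rightarrow> vertex" where
  "shift k (VBeta s x y) = VBeta s (x + k) y"
| "shift k (VOmega s x y) = VOmega s (x + k) y"

definition shift_edge :: "int \<Rightarrow> edge \<Rightarrow> edge" where
  "shift_edge k e = (shift k (fst e), shift k (snd e))"

fun wrap :: "nat \<Rightarrow> vertex \<Rightarrow> vertex" where
  "wrap N (VBeta s x y) = VBeta s (x mod int N) y"
| "wrap N (VOmega s x y) = VOmega s (x mod int N) y"

text \<open>
  An edge of the cylinder of circumference \<open>N\<close> is a band edge modulo translation by \<open>N\<close>. It is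
  represented by the unique translate whose tail has \<open>x\<close>-coordinate in \<open>{0..<N}\<close>; the head of
  that translate may have \<open>x = N\<close>, and is then identified with the vertex at \<open>x = 0\<close>. With this
  convention a function on band edges also serves as a function on cylinder edges.
\<close>

definition cylinder :: "nat \<Rightarrow> nat \<Rightarrow> (vertex, edge) pre_digraph" where
  "cylinder m N =
     \<lparr> verts = {v. 0 \<le> xpos v \<and> xpos v < int N \<and> ypos v < m},
       arcs = {e \<in> band_arcs m. 0 \<le> xpos (fst e) \<and> xpos (fst e) < int N},
       tail = fst,
       head = (\<lambda>e. wrap N (snd e)) \<rparr>"

definition cylinder_edge :: "nat \<Rightarrow> edge \<Rightarrow> edge" where
  "cylinder_edge N e = shift_edge (- (int N * (xpos (fst e) div int N))) e"


section \<open>Characteristic polynomial\<close>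

definition z_edges :: "nat \<Rightarrow> nat \<Rightarrow> edge set" where
  "z_edges m n =
     {(VBeta Corner_b (int n - 1) y, VOmega Corner_b (int n) y) | y. y < m}"

text \<open>Each sum below has at most one term, since the cylinder has no parallel edges.\<close>

definition kasteleyn_entry ::
  "nat \<Rightarrow> nat \<Rightarrow> (edge \<Rightarrow> real) \<Rightarrow> complex \<Rightarrow> vertex \<Rightarrow> vertex \<Rightarrow> complex" where
  "kasteleyn_entry m n W z u v =
     (let G = cylinder m n in
       (\<Sum>e | e \<in> arcs G \<and> tail G e = u \<and> head G e = v.
          (if e \<in> z_edges m n then z else 1) * of_real (W e))
     - (\<Sum>e | e \<in> arcs G \<and> tail G e = v \<and> head G e = u.
          (if e \<in> z_edges m n then inverse z else 1) * of_real (W e)))"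

text \<open>The determinant does not depend on the chosen enumeration of the vertices.\<close>

definition vertex_list :: "nat \<Rightarrow> nat \<Rightarrow> vertex list" where
  "vertex_list m n =
     concat (map (\<lambda>(y, x).
         [VBeta Corner_a (int x) y, VBeta Corner_b (int x) y, VBeta Corner_c (int x) y,
          VOmega Corner_a (int x) y, VOmega Corner_b (int x) y, VOmega Corner_c (int x) y])
       (List.product [0..<m] [0..<n]))"

lemma set_vertex_list: "set (vertex_list m n) = verts (cylinder m n)"
proof (intro subset_antisym subsetI)
  fix v assume "v \<in> set (vertex_list m n)"
  then show "v \<in> verts (cylinder m n)"
    by (auto simp: vertex_list_def cylinder_def)
next
  fix v assume "v \<in> verts (cylinder m n)"
  then have v: "0 \<le> xpos v" "xpos v < int n" "ypos v < m"
    by (auto simp: cylinder_def)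
  obtain x where x: "xpos v = int x" "x < n"
    using v by (metis of_nat_less_iff zero_le_imp_eq_int)
  have "v \<in> {VBeta Corner_a (int x) (ypos v), VBeta Corner_b (int x) (ypos v),
      VBeta Corner_c (int x) (ypos v), VOmega Corner_a (int x) (ypos v),
      VOmega Corner_b (int x) (ypos v), VOmega Corner_c (int x) (ypos v)}"
    using x(1) by (cases v; cases "corner_of v") simp_all
  moreover have "(ypos v, x) \<in> set (List.product [0..<m] [0..<n])"
    using v x by simp
  ultimately show "v \<in> set (vertex_list m n)"
    unfolding vertex_list_def set_concat set_map by (intro UN_I) auto
qed

lemma length_vertex_list: "length (vertex_list m n) = 6 * m * n"
proof -
  have "length (concat (map (\<lambda>(y, x). [a y x, b y x, c y x, d y x, e y x, f y x]) zs)) =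
      6 * length zs" for a b c d e f :: "nat \<Rightarrow> nat \<Rightarrow> vertex" and zs
    by (induction zs) auto
  then show ?thesis
    by (simp add: vertex_list_def)
qed

lemma card_verts_cylinder: "card (verts (cylinder m n)) = 6 * m * n"
proof -
  let ?T = "(UNIV :: bool set) \<times> {Corner_a, Corner_b, Corner_c} \<times> {..<n} \<times> {..<m}"
  let ?f = "\<lambda>(b, s, x, y). if b then VBeta s (int x) y else VOmega s (int x) y"
  have "bij_betw ?f ?T (verts (cylinder m n))"
  proof (intro bij_betw_byWitness[where f' =
        "\<lambda>v. (is_VBeta v, corner_of v, nat (xpos v), ypos v)"] ballI subsetI)
    fix v assume "v \<in> verts (cylinder m n)"
    then show "?f (is_VBeta v, corner_of v, nat (xpos v), ypos v) = v"
      by (cases v) (simp_all add: cylinder_def)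
  next
    fix t assume "t \<in> (\<lambda>v. (is_VBeta v, corner_of v, nat (xpos v), ypos v)) ` verts (cylinder m n)"
    then obtain v where v: "v \<in> verts (cylinder m n)"
      "t = (is_VBeta v, corner_of v, nat (xpos v), ypos v)" by blast
    have "corner_of v \<in> {Corner_a, Corner_b, Corner_c}"
      by (cases "corner_of v") simp_all
    with v show "t \<in> ?T"
      by (simp add: cylinder_def) linarith
  qed (auto simp: cylinder_def split: if_splits)
  then have "card (verts (cylinder m n)) = card ?T"
    by (simp add: bij_betw_same_card)
  then show ?thesis
    by (simp add: card_cartesian_product)
qed

lemma distinct_vertex_list: "distinct (vertex_list m n)"
  by (simp add: card_distinct card_verts_cylinder length_vertex_list set_vertex_list)

definition kasteleyn_matrix ::
  "nat \<Rightarrow> nat \<Rightarrow> (edge \<Rightarrow> real) \<Rightarrow> complex \<Rightarrow> complex mat" where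
  "kasteleyn_matrix m n W z =
     mat (6 * m * n) (6 * m * n)
       (\<lambda>(i, j). kasteleyn_entry m n W z (vertex_list m n ! i) (vertex_list m n ! j))"

definition char_P :: "nat \<Rightarrow> nat \<Rightarrow> (edge \<Rightarrow> real) \<Rightarrow> complex \<Rightarrow> complex" where
  "char_P m n W z = Determinant.det (kasteleyn_matrix m n W z)"


section \<open>Edge probabilities in the limit of infinite circumference\<close>

definition cylinder_prob ::
  "nat \<Rightarrow> nat \<Rightarrow> (edge \<Rightarrow> real) \<Rightarrow> edge set \<Rightarrow> real" where
  "cylinder_prob m N W S =
     measure (dimer_measure (cylinder m N) W)
       {D \<in> perfect_matchings (cylinder m N). cylinder_edge N ` S \<subseteq> D}"

definition band_prob ::
  "nat \<Rightarrow> nat \<Rightarrow> (edge \<Rightarrow> real) \<Rightarrow> edge set \<Rightarrow> real" where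
  "band_prob m n W S = lim (\<lambda>l. cylinder_prob m (l * n) W S)"

text \<open>The limit operator is meaningful only for convergent sequences.\<close>

definition band_prob_exists ::
  "nat \<Rightarrow> nat \<Rightarrow> (edge \<Rightarrow> real) \<Rightarrow> edge set \<Rightarrow> bool" where
  "band_prob_exists m n W S \<longleftrightarrow> convergent (\<lambda>l. cylinder_prob m (l * n) W S)"

definition correlation ::
  "nat \<Rightarrow> nat \<Rightarrow> (edge \<Rightarrow> real) \<Rightarrow> edge \<Rightarrow> edge \<Rightarrow> real" where
  "correlation m n W e1 e2 =
     band_prob m n W {e1, e2} - band_prob m n W {e1} * band_prob m n W {e2}"

definition correlation_exists ::
  "nat \<Rightarrow> nat \<Rightarrow> (edge \<Rightarrow> real) \<Rightarrow> edge \<Rightarrow> edge \<Rightarrow> bool" where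
  "correlation_exists m n W e1 e2 \<longleftrightarrow>
     band_prob_exists m n W {e1, e2} \<and> band_prob_exists m n W {e1} \<and> band_prob_exists m n W {e2}"

text \<open>
  Distance along the band. As the height is fixed, it differs from the Euclidean or graph distance
  at most by bounded multiplicative and additive constants.
\<close>

definition edge_distance :: "edge \<Rightarrow> edge \<Rightarrow> real" where
  "edge_distance e1 e2 = real_of_int \<bar>xpos (fst e1) - xpos (fst e2)\<bar>"

end

theory Submission
  imports Defs "HOL-Real_Asymp.Real_Asymp"
begin

text \<open>
  Cutting the cylinder into columns turns the dimer model into a transfer matrix on the sets of edges
  crossing from one column to the next. The parity of these sets is conserved, and within each parity
  class the transfer matrix is positive. By Perron--Frobenius, applied to both classes, all limits
  exist and the correlation converges exponentially fast in the distance, to \<open>0\<close> if the two Perron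
  eigenvalues differ. It remains to see that \<open>P(1) = 0\<close> whenever they coincide. In that case, the
  signed sum over matchings of the band that leave one vertex uncovered, with an odd Perron vector as
  left and an even one as right boundary condition, is a periodic function of the uncovered vertex.
  It is a nonzero null vector of \<open>K(1)\<close>.
\<close>

section \<open>Powers of positive matrices\<close>

text \<open>The equality of the two eigenvalues enters through periodicity. Leaving one vertex
  uncovered flips the parity carried along the band, so the boundary vectors must lie in opposite
  classes. Over one period the left vector is multiplied by its eigenvalue and the right one is
  divided by its own; only for equal eigenvalues does their product return to itself. Plain weights
  of configurations with an uncovered vertex are positive, whereas the Kasteleyn relations need
  cancellation. The signs are those of the Jordan--Wigner transformation: an edge crossing at height
  y is an occupied site, and an insertion at y carries the parity of the occupied sites below. The
  orientation adds alternating factors in x and y; the one in x closes up around the cylinder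
  because n is even. At height 0 no sites lie below, so one value of the null vector is a sum of
  nonnegative terms, which shows that it is nonzero. The limit of the normalised powers is kept as
  an arbitrary matrix of positive trace, so that one estimate covers equal and different
  eigenvalues; if it has rank one, the trace with two marked edges factorises.\<close>

fun mprod :: "'i set \<Rightarrow> ('i \<Rightarrow> 'i \<Rightarrow> real) list \<Rightarrow> 'i \<Rightarrow> 'i \<Rightarrow> real" where
  "mprod I [] = (\<lambda>i j. of_bool (i = j))"
| "mprod I (A # As) = (\<lambda>i j. \<Sum>k\<in>I. A i k * mprod I As k j)"

lemma mprod_single:
  assumes "finite I" "j \<in> I"
  shows "mprod I [A] i j = A i j"
  using assms by (simp add: of_bool_def if_distrib cong: if_cong)

lemma mprod_append:
  assumes "finite I" "i \<in> I"
  shows "mprod I (xs @ ys) i j = (\<Sum>k\<in>I. mprod I xs i k * mprod I ys k j)"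
  using assms(2)
proof (induction xs arbitrary: i)
  case Nil
  then show ?case
    using assms(1) by (simp add: of_bool_def if_distrib[of "\<lambda>x. x * _"] cong: if_cong)
next
  case (Cons A xs)
  have "mprod I ((A # xs) @ ys) i j
      = (\<Sum>h\<in>I. A i h * (\<Sum>k\<in>I. mprod I xs h k * mprod I ys k j))"
    using Cons.IH by simp
  also have "\<dots> = (\<Sum>h\<in>I. \<Sum>k\<in>I. A i h * mprod I xs h k * mprod I ys k j)"
    by (simp add: sum_distrib_left mult.assoc)
  also have "\<dots> = (\<Sum>k\<in>I. \<Sum>h\<in>I. A i h * mprod I xs h k * mprod I ys k j)"
    by (rule sum.swap)
  finally show ?case
    by (simp add: sum_distrib_right)
qed

lemma mprod_snoc:
  assumes "finite I" "i \<in> I" "j \<in> I"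
  shows "mprod I (xs @ [A]) i j = (\<Sum>k\<in>I. mprod I xs i k * A k j)"
  by (subst mprod_append) (use assms in \<open>simp_all add: mprod_single del: mprod.simps(2)\<close>)

lemma mprod_concat:
  assumes "finite I" "i \<in> I" "j \<in> I"
  shows "mprod I (concat Ass) i j = mprod I (map (mprod I) Ass) i j"
  using assms(2)
proof (induction Ass arbitrary: i)
  case Nil
  then show ?case by simp
next
  case (Cons As Ass)
  then show ?case
    by (simp add: mprod_append[OF assms(1)])
qed

text \<open>Traces appear when a strip of columns is closed to a cylinder. The factors stay a list,
  so that rotating the cylinder is rotating a list.\<close>

definition mtrace :: "'i set \<Rightarrow> ('i \<Rightarrow> 'i \<Rightarrow> real) list \<Rightarrow> real" where
  "mtrace I As = (\<Sum>i\<in>I. mprod I As i i)"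

lemma mtrace_append_commute:
  assumes "finite I"
  shows "mtrace I (xs @ ys) = mtrace I (ys @ xs)"
proof -
  have "mtrace I (xs @ ys) = (\<Sum>i\<in>I. \<Sum>k\<in>I. mprod I xs i k * mprod I ys k i)"
    unfolding mtrace_def by (intro sum.cong) (simp_all add: mprod_append[OF assms])
  also have "\<dots> = (\<Sum>k\<in>I. \<Sum>i\<in>I. mprod I ys k i * mprod I xs i k)"
    by (subst sum.swap) (simp add: mult.commute)
  also have "\<dots> = mtrace I (ys @ xs)"
    unfolding mtrace_def by (intro sum.cong) (simp_all add: mprod_append[OF assms])
  finally show ?thesis .
qed

section \<open>Perron--Frobenius theory of strictly positive matrices, with a rate of
  convergence\<close>

lemma compact_box_fun:
  fixes a b :: "'i \<Rightarrow> real"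
  shows "compact {x. \<forall>i. x i \<in> {a i..b i}}"
proof -
  have "compactin (product_topology (\<lambda>i. euclidean) UNIV) (PiE UNIV (\<lambda>i. {a i..b i}))"
    by (subst compactin_PiE) (auto simp: compactin_euclidean_iff)
  moreover have "PiE UNIV (\<lambda>i. {a i..b i}) = {x. \<forall>i. x i \<in> {a i..b i}}"
    by (auto simp: PiE_def Pi_def)
  ultimately show ?thesis
    by (metis compactin_euclidean_iff euclidean_product_topology)
qed

text \<open>Collatz--Wielandt: a maximiser of the least ratio $(Ax)_i / x_i$ is an eigenvector.\<close>

lemma positive_matrix_eigenvector:
  fixes A :: "'i \<Rightarrow> 'i \<Rightarrow> real"
  assumes I: "finite I" "I \<noteq> {}" and pos: "\<And>i j. i \<in> I \<Longrightarrow> j \<in> I \<Longrightarrow> A i j > 0"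
  obtains r \<Lambda> where "\<Lambda> > 0" "\<And>i. i \<in> I \<Longrightarrow> r i > 0"
    "\<And>i. i \<in> I \<Longrightarrow> (\<Sum>j\<in>I. A i j * r j) = \<Lambda> * r i"
proof -
  define E where "E = (\<lambda>(i, j). A i j) ` (I \<times> I)"
  define lo where "lo = Min E"
  define hi where "hi = Max E"
  have E: "finite E" "E \<noteq> {}" using I by (auto simp: E_def)
  have lohi: "lo \<le> A i j" "A i j \<le> hi" if "i \<in> I" "j \<in> I" for i j
    using that E unfolding lo_def hi_def by (auto simp: E_def intro!: Min_le Max_ge)
  have lo: "lo > 0"
    using Min_in[OF E] pos unfolding lo_def E_def by auto
  have hi: "hi > 0"
    using lo lohi I(2) by (meson all_not_in_conv less_le_trans)
  have "lo \<le> hi" using lohi I(2) by (meson all_not_in_conv order_trans)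
  \<comment> \<open>For a positive vector x, division by \<open>hi * sum x I\<close> brings all
    coordinates of A x between \<open>lo / hi\<close> and 1; so the box \<open>K\<close> also
    contains the improved vector constructed below.\<close>
  define \<kappa> where "\<kappa> = lo / hi"
  have \<kappa>: "\<kappa> > 0" "\<kappa> \<le> 1" using lo hi \<open>lo \<le> hi\<close> by (auto simp: \<kappa>_def)
  define ap where "ap x i = (\<Sum>j\<in>I. A i j * x j)" for x i
  define B where "B = hi * card I / \<kappa>"
  have cI: "card I > 0" using I by (simp add: card_gt_0_iff)
  \<comment> \<open>The index type may be infinite. Coordinates outside \<open>I\<close> are pinned
    to 0 by degenerate intervals, and the box is compact by Tychonoff.\<close>
  define K where "K = {x :: 'i \<Rightarrow> real. \<forall>i. x i \<in> {if i \<in> I then \<kappa> else 0..if i \<in> I then 1 else 0}}"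
  have KI: "\<kappa> \<le> x i" "x i \<le> 1" if "x \<in> K" "i \<in> I" for x i
    using that unfolding K_def by (auto dest!: spec[of _ i])
  \<comment> \<open>Maximising \<mu> over pairs (\<mu>, x) avoids the minimum of the ratios and its
    continuity. The bound \<open>B\<close> makes the set compact; it follows from the inequalities
    themselves, see \<open>PB\<close>.\<close>
  define P where "P = {p \<in> {0..B} \<times> K. \<forall>i\<in>I. fst p * snd p i \<le> ap (snd p) i}"
  have cont: "continuous_on UNIV (\<lambda>p :: real \<times> ('i \<Rightarrow> real). snd p i)" for i
    by (rule continuous_on_product_then_coordinatewise) (intro continuous_intros)
  have "compact P"
  proof -
    have "P = ({0..B} \<times> K) \<inter> (\<Inter>i\<in>I. {p. fst p * snd p i \<le> ap (snd p) i})"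
      using I by (auto simp: P_def)
    moreover have "closed (\<Inter>i\<in>I. {p :: real \<times> ('i \<Rightarrow> real). fst p * snd p i \<le> ap (snd p) i})"
      unfolding ap_def by (intro closed_INT ballI closed_Collect_le continuous_intros cont)
    moreover have "compact ({0..B} \<times> K)"
      unfolding K_def by (intro compact_Times compact_box_fun) auto
    ultimately show ?thesis by (simp add: compact_Int_closed)
  qed
  have apK: "lo * sum x I \<le> ap x i" "ap x i \<le> hi * sum x I"
    if "\<And>i. i \<in> I \<Longrightarrow> x i \<ge> 0" "i \<in> I" for x i
    unfolding ap_def sum_distrib_left using that lohi by (auto intro!: sum_mono mult_right_mono)
  have PB: "\<mu> \<le> B" if "x \<in> K" "i \<in> I" "\<mu> \<ge> 0" "\<mu> * x i \<le> ap x i" for \<mu> x i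
  proof -
    have "\<mu> * \<kappa> \<le> \<mu> * x i" using that KI by (intro mult_left_mono) auto
    also have "\<dots> \<le> hi * sum x I"
      using that KI \<kappa> by (intro order_trans[OF that(4)] apK) (auto intro: less_imp_le less_le_trans)
    also have "\<dots> \<le> hi * (\<Sum>i\<in>I. 1)"
      using that KI hi by (intro mult_left_mono sum_mono) auto
    finally show ?thesis using \<kappa> by (simp add: B_def field_simps)
  qed
  have "P \<noteq> {}"
  proof -
    have "(0, \<lambda>i. of_bool (i \<in> I)) \<in> P"
      using \<kappa> hi cI pos by (auto simp: P_def K_def B_def ap_def intro!: sum_nonneg less_imp_le[OF pos])
    then show ?thesis by blast
  qed
  moreover have "compact (fst ` P)"
    by (intro compact_continuous_image \<open>compact P\<close> continuous_intros)
  ultimately obtain \<Lambda> where \<Lambda>: "\<Lambda> \<in> fst ` P" "\<And>\<mu>. \<mu> \<in> fst ` P \<Longrightarrow> \<mu> \<le> \<Lambda>"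
    using compact_attains_sup[of "fst ` P"] by auto
  then obtain x where x: "(\<Lambda>, x) \<in> P" by auto
  then have xK: "x \<in> K" and l0: "\<Lambda> \<ge> 0" and xle: "\<And>i. i \<in> I \<Longrightarrow> \<Lambda> * x i \<le> ap x i"
    by (auto simp: P_def)
  have x0: "x i > 0" if "i \<in> I" for i using KI[OF xK that] \<kappa> by auto
  have s0: "sum x I > 0" using I x0 by (intro sum_pos) auto
  have eq: "ap x i = \<Lambda> * x i" if "i \<in> I" for i
  proof (rule ccontr)
    assume ne: "ap x i \<noteq> \<Lambda> * x i"
    define c where "c = hi * sum x I"
    \<comment> \<open>If row i has slack, a further application of the positive matrix spreads it to
      all rows: each gains at least \<open>lo\<close> times the slack. Hence y admits a ratio larger
      by \<open>\<epsilon>\<close>, against maximality.\<close>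
    define y where "y j = (if j \<in> I then ap x j / c else 0)" for j
    define \<epsilon> where "\<epsilon> = lo * (ap x i - \<Lambda> * x i) / c"
    have c: "c > 0" using hi s0 by (simp add: c_def)
    have e: "\<epsilon> > 0" using ne xle[OF that] lo c by (simp add: \<epsilon>_def)
    have yb: "\<kappa> \<le> y j" "y j \<le> 1" if "j \<in> I" for j
      using apK[of x j] that x0 c hi s0 by (auto simp: y_def \<kappa>_def c_def field_simps less_imp_le)
    have yK: "y \<in> K"
      using yb by (auto simp: K_def y_def)
    have "(\<Lambda> + \<epsilon>) * y j \<le> ap y j" if j: "j \<in> I" for j
    proof -
      have "ap y j - \<Lambda> * y j = (\<Sum>k\<in>I. A j k * (ap x k - \<Lambda> * x k)) / c"
        using j by (simp add: ap_def y_def sum_divide_distrib sum_subtractf right_diff_distrib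
            diff_divide_distrib sum_distrib_left mult_ac)
      moreover have "(\<Sum>k\<in>I. A j k * (ap x k - \<Lambda> * x k)) \<ge> A j i * (ap x i - \<Lambda> * x i)"
        using I j \<open>i \<in> I\<close> xle pos by (intro member_le_sum) (auto simp: less_imp_le)
      moreover have "A j i * (ap x i - \<Lambda> * x i) \<ge> lo * (ap x i - \<Lambda> * x i)"
        using lohi j \<open>i \<in> I\<close> xle by (intro mult_right_mono) auto
      ultimately have "ap y j - \<Lambda> * y j \<ge> \<epsilon>"
        unfolding \<epsilon>_def using c by (simp add: divide_right_mono)
      moreover have "\<epsilon> * y j \<le> \<epsilon>" using e yb(2)[OF j] by simp
      ultimately show ?thesis by (simp add: algebra_simps)
    qed
    moreover from this have "\<Lambda> + \<epsilon> \<le> B"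
      using PB[OF yK \<open>i \<in> I\<close>] e l0 \<open>i \<in> I\<close> by auto
    ultimately have "(\<Lambda> + \<epsilon>, y) \<in> P"
      using yK e l0 by (auto simp: P_def)
    then have "\<Lambda> + \<epsilon> \<le> \<Lambda>" using \<Lambda>(2) by (metis fst_conv image_eqI)
    then show False using e by simp
  qed
  have "\<Lambda> > 0"
  proof -
    obtain i where i: "i \<in> I" using I by auto
    have "0 < lo * sum x I" using lo s0 by simp
    also have "\<dots> \<le> \<Lambda> * x i" using apK(1)[of x i] x0 i eq by (auto simp: less_imp_le)
    finally show ?thesis using x0[OF i] l0 by (simp add: zero_less_mult_iff)
  qed
  then show ?thesis using that x0 eq unfolding ap_def by blast
qed

text \<open>Doeblin: subtracting the minorant \<open>\<delta>\<close> from all entries does not change the difference of the averages.\<close>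

lemma stochastic_contraction:
  fixes P :: "'i \<Rightarrow> 'i \<Rightarrow> real"
  assumes I: "finite I" "I \<noteq> {}" and ge: "\<And>i j. i \<in> I \<Longrightarrow> j \<in> I \<Longrightarrow> P i j \<ge> \<delta>"
    and row: "\<And>i. i \<in> I \<Longrightarrow> (\<Sum>j\<in>I. P i j) = 1"
    and u: "\<And>i k. i \<in> I \<Longrightarrow> k \<in> I \<Longrightarrow> \<bar>u i - u k\<bar> \<le> d"
    and ik: "i \<in> I" "k \<in> I"
  shows "\<bar>(\<Sum>j\<in>I. P i j * u j) - (\<Sum>j\<in>I. P k j * u j)\<bar> \<le> (1 - real (card I) * \<delta>) * d"
proof -
  define \<theta> where "\<theta> = 1 - real (card I) * \<delta>"
  define lo where "lo = Min (u ` I)"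
  define hi where "hi = Max (u ` I)"
  have lohi: "lo \<le> u i" "u i \<le> hi" if "i \<in> I" for i
    using that I by (auto simp: lo_def hi_def)
  have "lo \<in> u ` I" "hi \<in> u ` I" unfolding lo_def hi_def using I by (auto intro!: Min_in Max_in)
  then obtain a b where "a \<in> I" "b \<in> I" "lo = u a" "hi = u b" by blast
  then have hl: "hi - lo \<le> d" using u[of b a] by simp
  have \<theta>: "(\<Sum>j\<in>I. P i j - \<delta>) = \<theta>" if "i \<in> I" for i
    using row that by (simp add: sum_subtractf \<theta>_def)
  have \<theta>0: "\<theta> \<ge> 0" unfolding \<theta>[OF ik(1), symmetric] using ge ik by (auto intro!: sum_nonneg)
  have b: "\<theta> * lo \<le> (\<Sum>j\<in>I. (P i j - \<delta>) * u j)" "(\<Sum>j\<in>I. (P i j - \<delta>) * u j) \<le> \<theta> * hi"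
    if "i \<in> I" for i
    unfolding \<theta>[OF that, symmetric] sum_distrib_right using that ge lohi
    by (auto intro!: sum_mono mult_left_mono)
  have e: "(\<Sum>j\<in>I. P i j * u j) = (\<Sum>j\<in>I. (P i j - \<delta>) * u j) + \<delta> * sum u I" for i
    by (simp add: left_diff_distrib sum_subtractf sum_distrib_left)
  have "\<bar>(\<Sum>j\<in>I. P i j * u j) - (\<Sum>j\<in>I. P k j * u j)\<bar> \<le> \<theta> * (hi - lo)"
    unfolding e using b[OF ik(1)] b[OF ik(2)] by (simp add: algebra_simps abs_le_iff)
  also have "\<dots> \<le> \<theta> * d" using hl \<theta>0 by (rule mult_left_mono)
  finally show ?thesis unfolding \<theta>_def .
qed

lemma replicate_Suc_snoc: "replicate (Suc l) x = replicate l x @ [x]"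
  by (simp add: replicate_append_same)

text \<open>By contraction, each column of the l-th power oscillates by at most \<theta>^l over the
  rows. Rows of later powers are averages of rows of the l-th power and stay within this
  oscillation. This yields the Cauchy property, a limit common to all rows, and the rate with
  constant 1.\<close>

lemma stochastic_convergence:
  fixes P :: "'i \<Rightarrow> 'i \<Rightarrow> real"
  assumes I: "finite I" "I \<noteq> {}" and pos: "\<And>i j. i \<in> I \<Longrightarrow> j \<in> I \<Longrightarrow> P i j > 0"
    and row: "\<And>i. i \<in> I \<Longrightarrow> (\<Sum>j\<in>I. P i j) = 1"
  obtains \<theta> p where "0 \<le> \<theta>" "\<theta> < 1" "(\<Sum>j\<in>I. p j) = 1"
    "\<And>i j l. i \<in> I \<Longrightarrow> j \<in> I \<Longrightarrow> \<bar>mprod I (replicate l P) i j - p j\<bar> \<le> \<theta> ^ l"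
proof -
  define E where "E = (\<lambda>(i, j). P i j) ` (I \<times> I)"
  define \<delta> where "\<delta> = Min E"
  have E: "finite E" "E \<noteq> {}" using I by (auto simp: E_def)
  have \<delta>: "\<delta> \<le> P i j" if "i \<in> I" "j \<in> I" for i j
    using that E unfolding \<delta>_def by (auto simp: E_def intro!: Min_le)
  have \<delta>0: "\<delta> > 0"
    using Min_in[OF E] pos unfolding \<delta>_def E_def by auto
  define \<theta> where "\<theta> = 1 - real (card I) * \<delta>"
  define Q where "Q l = mprod I (replicate l P)" for l
  have Q0: "Q 0 i j = of_bool (i = j)" for i j by (simp add: Q_def)
  have QS: "Q (Suc l) i j = (\<Sum>k\<in>I. P i k * Q l k j)" for l i j by (simp add: Q_def)
  obtain i0 where i0: "i0 \<in> I" using I by auto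
  have \<theta>1: "\<theta> < 1" using \<delta>0 I by (simp add: \<theta>_def card_gt_0_iff)
  have \<theta>0: "\<theta> \<ge> 0"
  proof -
    have "real (card I) * \<delta> = (\<Sum>j\<in>I. \<delta>)" by simp
    also have "\<dots> \<le> (\<Sum>j\<in>I. P i0 j)" using \<delta> i0 by (intro sum_mono) auto
    finally show ?thesis using row i0 by (simp add: \<theta>_def)
  qed
  have osc: "\<bar>Q l i j - Q l k j\<bar> \<le> \<theta> ^ l" if "i \<in> I" "k \<in> I" for l i k j
    using that
  proof (induction l arbitrary: i k)
    case 0
    then show ?case by (simp add: Q0)
  next
    case (Suc l)
    then show ?case
      unfolding QS power_Suc
      using stochastic_contraction[OF I, of \<delta> P "\<lambda>k. Q l k j" "\<theta> ^ l"] \<delta> row \<theta>_def by simp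
  qed
  have avg: "\<bar>Q (l + l') i j - Q l i j\<bar> \<le> \<theta> ^ l" if "i \<in> I" for l l' i j
    using that
  proof -
    have "\<forall>i\<in>I. \<forall>k\<in>I. \<bar>Q (l + l') i j - Q l k j\<bar> \<le> \<theta> ^ l"
    proof (induction l')
      case 0
      then show ?case using osc by simp
    next
      case (Suc l')
      show ?case
      proof (intro ballI)
        fix i k assume ik: "i \<in> I" "k \<in> I"
        have "Q (l + Suc l') i j - Q l k j = (\<Sum>h\<in>I. P i h * (Q (l + l') h j - Q l k j))"
          using row[OF ik(1)]
          by (simp add: QS right_diff_distrib sum_subtractf flip: sum_distrib_right)
        also have "\<bar>\<dots>\<bar> \<le> (\<Sum>h\<in>I. P i h * \<theta> ^ l)"
          using Suc ik pos
          by (intro order_trans[OF sum_abs] sum_mono)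
             (auto simp: abs_mult intro!: mult_mono less_imp_le[OF pos] abs_of_pos[THEN eq_refl])
        also have "\<dots> = \<theta> ^ l" using row[OF ik(1)] by (simp flip: sum_distrib_right)
        finally show "\<bar>Q (l + Suc l') i j - Q l k j\<bar> \<le> \<theta> ^ l" .
      qed
    qed
    then show ?thesis using that by blast
  qed
  define p where "p j = lim (\<lambda>l. Q l i0 j)" for j
  have conv: "(\<lambda>l. Q l i0 j) \<longlonglongrightarrow> p j" for j
  proof -
    have "Cauchy (\<lambda>l. Q l i0 j)"
    proof (rule metric_CauchyI)
      fix e :: real assume "e > 0"
      moreover have "(\<lambda>l. \<theta> ^ l) \<longlonglongrightarrow> 0" using \<theta>0 \<theta>1 by (intro LIMSEQ_power_zero) simp
      ultimately obtain M where M: "\<theta> ^ M < e / 2"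
        by (metis half_gt_zero LIMSEQ_D[of _ 0] diff_zero le_refl real_norm_def abs_of_nonneg
            zero_le_power \<theta>0)
      have "dist (Q a i0 j) (Q b i0 j) < e" if "a \<ge> M" "b \<ge> M" for a b
        using avg[OF i0, of M "a - M" j] avg[OF i0, of M "b - M" j] that M
        by (simp add: dist_real_def abs_le_iff abs_less_iff)
      then show "\<exists>M. \<forall>a\<ge>M. \<forall>b\<ge>M. dist (Q a i0 j) (Q b i0 j) < e" by blast
    qed
    then show ?thesis unfolding p_def by (simp add: Cauchy_convergent_iff convergent_LIMSEQ_iff)
  qed
  have convi: "(\<lambda>l. Q l i j) \<longlonglongrightarrow> p j" if "i \<in> I" for i j
  proof -
    have "(\<lambda>l. Q l i j - Q l i0 j) \<longlonglongrightarrow> 0"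
    proof (rule Lim_null_comparison)
      show "\<forall>\<^sub>F l in sequentially. norm (Q l i j - Q l i0 j) \<le> \<theta> ^ l"
        using osc[OF that i0] by simp
      show "(\<lambda>l. \<theta> ^ l) \<longlonglongrightarrow> 0" using \<theta>0 \<theta>1 by (intro LIMSEQ_power_zero) simp
    qed
    from tendsto_add[OF this conv[of j]] show ?thesis by simp
  qed
  have b: "\<bar>Q l i j - p j\<bar> \<le> \<theta> ^ l" if "i \<in> I" for i j l
  proof -
    have "(\<lambda>l'. \<bar>Q (l' + l) i j - Q l i j\<bar>) \<longlonglongrightarrow> \<bar>p j - Q l i j\<bar>"
      by (intro tendsto_intros LIMSEQ_ignore_initial_segment convi that)
    then have "\<bar>p j - Q l i j\<bar> \<le> \<theta> ^ l"
      by (rule LIMSEQ_le_const2) (use avg[OF that, of l _ j] in \<open>auto simp: add.commute\<close>)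
    then show ?thesis by (simp add: abs_minus_commute)
  qed
  have rowQ: "(\<Sum>j\<in>I. Q l i j) = 1" if "i \<in> I" for l i
    using that
  proof (induction l arbitrary: i)
    case 0
    then show ?case using I by (simp add: Q0 of_bool_def)
  next
    case (Suc l)
    have "(\<Sum>j\<in>I. Q (Suc l) i j) = (\<Sum>k\<in>I. P i k * (\<Sum>j\<in>I. Q l k j))"
      unfolding QS sum_distrib_left by (rule sum.swap)
    then show ?case using Suc row by simp
  qed
  have "(\<lambda>l. \<Sum>j\<in>I. Q l i0 j) \<longlonglongrightarrow> (\<Sum>j\<in>I. p j)"
    by (intro tendsto_sum conv)
  then have "(\<Sum>j\<in>I. p j) = 1"
    using rowQ[OF i0] by (simp add: LIMSEQ_const_iff)
  with that[of \<theta> p] \<theta>0 \<theta>1 b show ?thesis by (simp add: Q_def)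
qed

text \<open>Conjugating by the right eigenvector r and dividing by \<Lambda> makes A stochastic
  (Doob transform). The limiting row p of the stochastic powers gives the left vector q = p / r, and
  C is the largest ratio of two coordinates of r.\<close>

lemma perron_frobenius_positive:
  fixes A :: "'i \<Rightarrow> 'i \<Rightarrow> real"
  assumes I: "finite I" "I \<noteq> {}" and A: "\<forall>i\<in>I. \<forall>j\<in>I. A i j > 0"
  shows "\<exists>\<Lambda> \<theta> r q C. \<Lambda> > 0 \<and> 0 \<le> \<theta> \<and> \<theta> < 1 \<and> (\<forall>i\<in>I. r i > 0) \<and> (\<forall>i\<in>I. q i > 0)
    \<and> (\<Sum>i\<in>I. q i * r i) = 1
    \<and> (\<forall>i\<in>I. (\<Sum>j\<in>I. A i j * r j) = \<Lambda> * r i)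
    \<and> (\<forall>j\<in>I. (\<Sum>i\<in>I. q i * A i j) = \<Lambda> * q j)
    \<and> (\<forall>i\<in>I. \<forall>j\<in>I. \<forall>l. \<bar>mprod I (replicate l A) i j / \<Lambda> ^ l - r i * q j\<bar> \<le> C * \<theta> ^ l)"
proof -
  have pos: "A i j > 0" if "i \<in> I" "j \<in> I" for i j
    using A that by blast
  obtain r \<Lambda> where \<Lambda>: "\<Lambda> > 0" and r: "\<And>i. i \<in> I \<Longrightarrow> r i > 0"
    and ev: "\<And>i. i \<in> I \<Longrightarrow> (\<Sum>j\<in>I. A i j * r j) = \<Lambda> * r i"
    by (rule positive_matrix_eigenvector[of I A]) (use I pos in auto)
  define P where "P i j = A i j * r j / (\<Lambda> * r i)" for i j
  have Ppos: "P i j > 0" if "i \<in> I" "j \<in> I" for i j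
    using that pos r \<Lambda> by (simp add: P_def)
  have row: "(\<Sum>j\<in>I. P i j) = 1" if "i \<in> I" for i
    using ev[OF that] r[OF that] \<Lambda> by (simp add: P_def flip: sum_divide_distrib)
  obtain \<theta> p where \<theta>: "0 \<le> \<theta>" "\<theta> < 1" and p1: "(\<Sum>j\<in>I. p j) = 1"
    and conv: "\<And>i j l. i \<in> I \<Longrightarrow> j \<in> I \<Longrightarrow> \<bar>mprod I (replicate l P) i j - p j\<bar> \<le> \<theta> ^ l"
    by (rule stochastic_convergence[of I P]) (use I Ppos row in auto)
  define q where "q j = p j / r j" for j
  have AP: "mprod I (replicate l A) i j = \<Lambda> ^ l * (r i / r j) * mprod I (replicate l P) i j"
    if "i \<in> I" "j \<in> I" for i j l
    using that(1)
  proof (induction l arbitrary: i)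
    case 0
    then show ?case using r[OF that(2)] by auto
  next
    case (Suc l)
    have "mprod I (replicate (Suc l) A) i j
        = (\<Sum>k\<in>I. A i k * (\<Lambda> ^ l * (r k / r j) * mprod I (replicate l P) k j))"
      using Suc.IH by simp
    also have "\<dots> = (\<Sum>k\<in>I. \<Lambda> ^ Suc l * (r i / r j) * (P i k * mprod I (replicate l P) k j))"
      using \<Lambda> r[OF Suc.prems] by (intro sum.cong) (auto simp: P_def field_simps)
    finally show ?case by (simp add: sum_distrib_left)
  qed
  define F where "F = (\<lambda>(i, j). r i / r j) ` (I \<times> I)"
  define C where "C = Max F"
  have F: "finite F" using I by (simp add: F_def)
  have C: "r i / r j \<le> C" if "i \<in> I" "j \<in> I" for i j
    using that F unfolding C_def by (intro Max_ge) (auto simp: F_def)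
  have bound: "\<bar>mprod I (replicate l A) i j / \<Lambda> ^ l - r i * q j\<bar> \<le> C * \<theta> ^ l"
    if "i \<in> I" "j \<in> I" for i j l
  proof -
    have "0 < r i / r j" using r that by simp
    have "mprod I (replicate l A) i j / \<Lambda> ^ l - r i * q j
        = r i / r j * (mprod I (replicate l P) i j - p j)"
      using \<Lambda> by (simp add: AP[OF that] q_def right_diff_distrib)
    also have "\<bar>\<dots>\<bar> \<le> C * \<theta> ^ l"
      unfolding abs_mult using conv[OF that] C[OF that] \<open>0 < r i / r j\<close>
      by (intro mult_mono) auto
    finally show ?thesis .
  qed
  have lim: "(\<lambda>l. mprod I (replicate l A) i j / \<Lambda> ^ l) \<longlonglongrightarrow> r i * q j"
    if "i \<in> I" "j \<in> I" for i j
  proof -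
    have "(\<lambda>l. mprod I (replicate l A) i j / \<Lambda> ^ l - r i * q j) \<longlonglongrightarrow> 0"
    proof (rule Lim_null_comparison)
      show "\<forall>\<^sub>F l in sequentially.
          norm (mprod I (replicate l A) i j / \<Lambda> ^ l - r i * q j) \<le> C * \<theta> ^ l"
        using bound[OF that] by simp
      show "(\<lambda>l. C * \<theta> ^ l) \<longlonglongrightarrow> 0"
        using \<theta> by (intro tendsto_mult_right_zero LIMSEQ_power_zero) simp
    qed
    then show ?thesis by (simp add: LIM_zero_iff)
  qed
  \<comment> \<open>Pass to the limit in A^(l+1) = A^l A, row \<open>i0\<close>; the common factor
    \<open>r i0\<close> cancels.\<close>
  have lev: "(\<Sum>i\<in>I. q i * A i j) = \<Lambda> * q j" if j: "j \<in> I" for j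
  proof -
    obtain i0 where i0: "i0 \<in> I" using I by auto
    have "(\<lambda>l. \<Sum>i\<in>I. mprod I (replicate l A) i0 i / \<Lambda> ^ l * A i j)
        \<longlonglongrightarrow> (\<Sum>i\<in>I. r i0 * q i * A i j)"
      by (intro tendsto_intros lim i0)
    moreover have "(\<Sum>i\<in>I. mprod I (replicate l A) i0 i / \<Lambda> ^ l * A i j)
        = \<Lambda> * (mprod I (replicate (Suc l) A) i0 j / \<Lambda> ^ Suc l)" for l
      using \<Lambda> unfolding replicate_Suc_snoc mprod_snoc[OF I(1) i0 j]
      by (simp add: sum_divide_distrib sum_distrib_left)
    moreover have "(\<lambda>l. \<Lambda> * (mprod I (replicate (Suc l) A) i0 j / \<Lambda> ^ Suc l)) \<longlonglongrightarrow> \<Lambda> * (r i0 * q j)"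
      by (intro tendsto_intros LIMSEQ_Suc[OF lim] i0 j)
    ultimately have "(\<Sum>i\<in>I. r i0 * q i * A i j) = \<Lambda> * (r i0 * q j)"
      using LIMSEQ_unique by fastforce
    then have "r i0 * (\<Sum>i\<in>I. q i * A i j) = r i0 * (\<Lambda> * q j)"
      by (simp add: sum_distrib_left mult_ac)
    then show ?thesis using r[OF i0] by simp
  qed
  have qr: "(\<Sum>i\<in>I. q i * r i) = 1"
    unfolding p1[symmetric] by (intro sum.cong) (auto simp: q_def dest: r)
  have q0: "q j \<ge> 0" if "j \<in> I" for j
  proof -
    have "0 \<le> mprod I (replicate l A) j j / \<Lambda> ^ l" for l
    proof -
      have "0 \<le> mprod I (replicate l A) i j" if "i \<in> I" for i
        using that by (induction l arbitrary: i) (auto intro!: sum_nonneg mult_nonneg_nonneg less_imp_le[OF pos])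
      then show ?thesis using \<Lambda> \<open>j \<in> I\<close> by simp
    qed
    then have "0 \<le> r j * q j" using lim[OF that that] by (intro LIMSEQ_le_const) auto
    then show ?thesis using r[OF that] by (simp add: zero_le_mult_iff)
  qed
  \<comment> \<open>A nonzero nonnegative left eigenvector becomes positive after one application of
    a positive matrix.\<close>
  have qpos: "q j > 0" if "j \<in> I" for j
  proof -
    have "\<exists>i\<in>I. q i > 0"
    proof (rule ccontr)
      assume "\<not> ?thesis"
      then have "\<forall>i\<in>I. q i = 0" using q0 by fastforce
      then show False using qr by simp
    qed
    then obtain i where i: "i \<in> I" "q i > 0" by blast
    have "0 < q i * A i j" using i pos that by simp
    also have "\<dots> \<le> (\<Sum>i\<in>I. q i * A i j)"
      using I i that q0 pos by (intro member_le_sum) (auto simp: less_imp_le)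
    finally show ?thesis using lev[OF that] \<Lambda> by (simp add: zero_less_mult_iff)
  qed
  show ?thesis
    by (rule exI[of _ \<Lambda>], rule exI[of _ \<theta>], rule exI[of _ r], rule exI[of _ q], rule exI[of _ C])
      (intro conjI ballI allI \<Lambda> \<theta> r qpos qr ev lev bound)
qed

section \<open>Configurations of a column\<close>

abbreviation "Bab x y \<equiv> (VBeta Corner_a x y, VBeta Corner_b x y)"
abbreviation "Bbc x y \<equiv> (VBeta Corner_b x y, VBeta Corner_c x y)"
abbreviation "Bca x y \<equiv> (VBeta Corner_c x y, VBeta Corner_a x y)"
abbreviation "Oab x y \<equiv> (VOmega Corner_a x y, VOmega Corner_b x y)"
abbreviation "Obc x y \<equiv> (VOmega Corner_b x y, VOmega Corner_c x y)"
abbreviation "Oca x y \<equiv> (VOmega Corner_c x y, VOmega Corner_a x y)"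
abbreviation "Ea x y \<equiv> (VBeta Corner_a x y, VOmega Corner_a x y)"
abbreviation "Eb x y \<equiv> (VBeta Corner_b x y, VOmega Corner_b (x + 1) y)"
abbreviation "Ec x y \<equiv> (VBeta Corner_c x y, VOmega Corner_c x (Suc y))"

text \<open>An edge belongs to the column of its tail. Thus \<open>Eb x y\<close> lies in column x
  although its head is in column x + 1; these edges form the state passed to the right.\<close>

definition col_arcs :: "nat \<Rightarrow> int \<Rightarrow> edge set" where
  "col_arcs m x = {e \<in> band_arcs m. xpos (fst e) = x}"

lemma col_arcs_cases:
  assumes "e \<in> col_arcs m x"
  obtains (ab) y where "y < m" "e = Bab x y" | (bc) y where "y < m" "e = Bbc x y"
    | (ca) y where "y < m" "e = Bca x y" | (oab) y where "y < m" "e = Oab x y"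
    | (obc) y where "y < m" "e = Obc x y" | (oca) y where "y < m" "e = Oca x y"
    | (a) y where "y < m" "e = Ea x y" | (b) y where "y < m" "e = Eb x y"
    | (c) y where "Suc y < m" "e = Ec x y"
proof -
  have "xpos (fst e) = x" "e \<in> band_arcs m"
    using assms by (auto simp: col_arcs_def)
  then show ?thesis
    using that by (cases e) (auto elim!: band_arcs.cases)
qed

lemma finite_col_arcs: "finite (col_arcs m x)"
proof (rule finite_subset)
  show "col_arcs m x \<subseteq> (\<Union>y<m. {Bab x y, Bbc x y, Bca x y, Oab x y, Obc x y, Oca x y, Ea x y, Eb x y, Ec x y})"
    by (rule subsetI, elim col_arcs_cases) auto
qed simp

lemma band_arcs_iff [simp]:
  "Bab x y \<in> band_arcs m \<longleftrightarrow> y < m"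
  "Bbc x y \<in> band_arcs m \<longleftrightarrow> y < m"
  "Bca x y \<in> band_arcs m \<longleftrightarrow> y < m"
  "Oab x y \<in> band_arcs m \<longleftrightarrow> y < m"
  "Obc x y \<in> band_arcs m \<longleftrightarrow> y < m"
  "Oca x y \<in> band_arcs m \<longleftrightarrow> y < m"
  "Ea x y \<in> band_arcs m \<longleftrightarrow> y < m"
  "Eb x y \<in> band_arcs m \<longleftrightarrow> y < m"
  "Ec x y \<in> band_arcs m \<longleftrightarrow> Suc y < m"
  by (auto elim: band_arcs.cases intro: band_arcs.intros)

text \<open>
  The number of edges covering a vertex, where a bit \<open>y \<in> S\<close> stands for an edge entering
  \<open>\<omega>\<^sub>b(x,y)\<close> from the column to the left.
\<close>

fun vdeg :: "nat set \<Rightarrow> edge set \<Rightarrow> vertex \<Rightarrow> nat" where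
  "vdeg S M (VBeta Corner_a x y) = of_bool (Bab x y \<in> M) + of_bool (Bca x y \<in> M) + of_bool (Ea x y \<in> M)"
| "vdeg S M (VBeta Corner_b x y) = of_bool (Bab x y \<in> M) + of_bool (Bbc x y \<in> M) + of_bool (Eb x y \<in> M)"
| "vdeg S M (VBeta Corner_c x y) = of_bool (Bbc x y \<in> M) + of_bool (Bca x y \<in> M) + of_bool (Ec x y \<in> M)"
| "vdeg S M (VOmega Corner_a x y) = of_bool (Oab x y \<in> M) + of_bool (Oca x y \<in> M) + of_bool (Ea x y \<in> M)"
| "vdeg S M (VOmega Corner_b x y) = of_bool (Oab x y \<in> M) + of_bool (Obc x y \<in> M) + of_bool (y \<in> S)"
| "vdeg S M (VOmega Corner_c x y) = of_bool (Obc x y \<in> M) + of_bool (Oca x y \<in> M)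
     + of_bool (y > 0 \<and> Ec x (y - 1) \<in> M)"

definition right_state :: "edge set \<Rightarrow> int \<Rightarrow> nat set" where
  "right_state M x = {y. Eb x y \<in> M}"

text \<open>The degrees d are a parameter because three kinds occur: 1 everywhere for matchings, 0
  at one vertex for a defect, and 2 at one vertex for the terms of the Kasteleyn relations.\<close>

definition column_configs :: "nat \<Rightarrow> int \<Rightarrow> nat set \<Rightarrow> nat set \<Rightarrow> (vertex \<Rightarrow> nat) \<Rightarrow> edge set set" where
  "column_configs m x S S' d = {M. M \<subseteq> col_arcs m x \<and> right_state M x = S' \<and>
     (\<forall>u. xpos u = x \<longrightarrow> ypos u < m \<longrightarrow> vdeg S M u = d u)}"

definition column_weight :: "nat \<Rightarrow> (edge \<Rightarrow> real) \<Rightarrow> int \<Rightarrow> nat set \<Rightarrow> nat set \<Rightarrow> (vertex \<Rightarrow> nat) \<Rightarrow> real" where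
  "column_weight m W x S S' d = (\<Sum>M\<in>column_configs m x S S' d. prod W M)"

lemma finite_column_configs: "finite (column_configs m x S S' d)"
  by (rule finite_subset[of _ "Pow (col_arcs m x)"]) (auto simp: column_configs_def finite_col_arcs)

lemma column_configs_finite: "M \<in> column_configs m x S S' d \<Longrightarrow> finite M"
  by (auto simp: column_configs_def intro: finite_subset[OF _ finite_col_arcs])

lemma vertex_cases:
  obtains (ba) x y where "u = VBeta Corner_a x y" | (bb) x y where "u = VBeta Corner_b x y"
    | (bc) x y where "u = VBeta Corner_c x y" | (oa) x y where "u = VOmega Corner_a x y"
    | (ob) x y where "u = VOmega Corner_b x y" | (oc) x y where "u = VOmega Corner_c x y"
proof (cases u)
  case (VBeta s x y)
  then show ?thesis using that by (cases s) auto
next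
  case (VOmega s x y)
  then show ?thesis using that by (cases s) auto
qed

text \<open>The head of an edge \<open>Eb\<close> lies in the next column and is excluded by
  \<open>xpos u = x\<close>; there it is counted through the bit of the left state instead.\<close>

lemma vdeg_insert:
  assumes "e \<in> col_arcs m x" "e \<notin> M" "xpos u = x"
  shows "vdeg S (insert e M) u = vdeg S M u + of_bool (u = fst e) + of_bool (u = snd e)"
proof (cases u rule: vertex_cases)
  case (oc x y)
  then show ?thesis
    using assms by (elim col_arcs_cases; cases y) auto
qed (use assms in \<open>elim col_arcs_cases; simp\<close>)+

text \<open>Inserting e is a weight-multiplying bijection that raises the degree at the ends of e.
  The right states T and T' may differ, since e may be an edge \<open>Eb\<close> leading out of the
  column.\<close>

lemma sum_column_configs_insert:
  fixes W :: "edge \<Rightarrow> real"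
  assumes e: "e \<in> col_arcs m x"
    and d': "\<And>u. xpos u = x \<Longrightarrow> d' u = d u + of_bool (u = fst e) + of_bool (u = snd e)"
    and T': "\<And>M. e \<notin> M \<Longrightarrow> right_state (insert e M) x = T' \<longleftrightarrow> right_state M x = T"
  shows "W e * (\<Sum>M | M \<in> column_configs m x S T d \<and> e \<notin> M. prod W M)
       = (\<Sum>M | M \<in> column_configs m x S T' d' \<and> e \<in> M. prod W M)"
proof -
  have "(\<Sum>M | M \<in> column_configs m x S T' d' \<and> e \<in> M. prod W M)
      = (\<Sum>M | M \<in> column_configs m x S T d \<and> e \<notin> M. prod W (insert e M))"
  proof (rule sum.reindex_bij_witness[of _ "insert e" "\<lambda>M. M - {e}"])
    fix M assume M: "M \<in> {M \<in> column_configs m x S T' d'. e \<in> M}"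
    then have ins: "insert e (M - {e}) = M" by auto
    then show "insert e (M - {e}) = M" .
    then show "prod W (insert e (M - {e})) = prod W M" by simp
    have "vdeg S (M - {e}) u = d u" if "xpos u = x" "ypos u < m" for u
    proof -
      have "vdeg S M u = vdeg S (M - {e}) u + of_bool (u = fst e) + of_bool (u = snd e)"
        using vdeg_insert[OF e, of "M - {e}" u S] that(1) unfolding ins by simp
      moreover have "vdeg S M u = d' u" using M that by (simp add: column_configs_def)
      ultimately show ?thesis using d'[OF that(1)] by simp
    qed
    moreover have "right_state (M - {e}) x = T"
      using T'[of "M - {e}"] M unfolding ins by (simp add: column_configs_def)
    ultimately show "M - {e} \<in> {M \<in> column_configs m x S T d. e \<notin> M}"
      using M by (auto simp: column_configs_def)
  next
    fix M assume M: "M \<in> {M \<in> column_configs m x S T d. e \<notin> M}"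
    then show "insert e M - {e} = M" by auto
    show "insert e M \<in> {M \<in> column_configs m x S T' d'. e \<in> M}"
      using M T'[of M] e d' vdeg_insert[OF e, of M _ S] by (auto simp: column_configs_def)
  qed
  also have "\<dots> = (\<Sum>M | M \<in> column_configs m x S T d \<and> e \<notin> M. W e * prod W M)"
    by (intro sum.cong) (auto dest: column_configs_finite)
  finally show ?thesis by (simp add: sum_distrib_left)
qed

text \<open>An edge of a triangle covers two of its three corners. If every corner is covered once,
  the number of external edges A, B, C in use is therefore odd; p, q, r are the triangle
  edges.\<close>

lemma triangle_parity:
  assumes "of_bool p + of_bool r + of_bool A = (1::nat)" "of_bool p + of_bool q + of_bool B = (1::nat)"
    "of_bool q + of_bool r + of_bool C = (1::nat)"
  shows "(-1::real) ^ of_bool A * (-1) ^ of_bool B * (-1) ^ of_bool C = -1"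
  using assms by (cases p; cases q; cases r; simp)

lemma parity_below:
  assumes M: "M \<in> column_configs m x S S' d" and y: "y \<le> m"
    and d: "\<And>u. xpos u = x \<Longrightarrow> ypos u < y \<Longrightarrow> d u = 1"
  shows "(-1::real) ^ card (S \<inter> {..<y})
       = (-1) ^ card (S' \<inter> {..<y}) * (-1) ^ of_bool (y > 0 \<and> Ec x (y - 1) \<in> M)"
  using y d
proof (induction y)
  case 0
  then show ?case by simp
next
  case (Suc y)
  have dg: "vdeg S M u = 1" if "xpos u = x" "ypos u = y" for u
    using M Suc.prems that by (auto simp: column_configs_def)
  have R: "y \<in> S' \<longleftrightarrow> Eb x y \<in> M"
    using M by (auto simp: column_configs_def right_state_def)
  have card: "card (T \<inter> {..<Suc y}) = card (T \<inter> {..<y}) + of_bool (y \<in> T)" for T :: "nat set"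
    by (auto simp: lessThan_Suc Int_insert_right)
  have IH: "(-1::real) ^ card (S \<inter> {..<y})
       = (-1) ^ card (S' \<inter> {..<y}) * (-1) ^ of_bool (y > 0 \<and> Ec x (y - 1) \<in> M)"
    using Suc by simp
  have "(-1::real) ^ of_bool (y > 0 \<and> Ec x (y - 1) \<in> M) * (-1) ^ of_bool (y \<in> S)
      = (-1) ^ of_bool (Eb x y \<in> M) * (-1) ^ of_bool (Ec x y \<in> M)"
  proof -
    have "(-1::real) ^ of_bool (Ea x y \<in> M) * (-1) ^ of_bool (Eb x y \<in> M) * (-1) ^ of_bool (Ec x y \<in> M) = -1"
      using dg[of "VBeta Corner_a x y"] dg[of "VBeta Corner_b x y"] dg[of "VBeta Corner_c x y"]
      by (intro triangle_parity[where p = "Bab x y \<in> M" and q = "Bbc x y \<in> M" and r = "Bca x y \<in> M"]) simp_all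
    moreover have "(-1::real) ^ of_bool (Ea x y \<in> M) * (-1) ^ of_bool (y \<in> S)
        * (-1) ^ of_bool (y > 0 \<and> Ec x (y - 1) \<in> M) = -1"
      using dg[of "VOmega Corner_a x y"] dg[of "VOmega Corner_b x y"] dg[of "VOmega Corner_c x y"]
      by (intro triangle_parity[where p = "Oab x y \<in> M" and q = "Obc x y \<in> M" and r = "Oca x y \<in> M"]) simp_all
    ultimately show ?thesis
      by (cases "Ea x y \<in> M") (simp_all add: mult.commute)
  qed
  then show ?case
    unfolding card power_add IH R by (simp add: mult_ac)
qed

lemma column_configs_nonempty:
  assumes "S \<subseteq> {..<m}" "S' \<subseteq> {..<m}" "even (card S + card S')"
  shows "column_configs m x S S' (\<lambda>_. 1) \<noteq> {}"
proof -
  \<comment> \<open>By \<open>parity_below\<close>, the vertical edge from y - 1 to y has to be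
    present exactly if S and S' differ in parity below y. Then \<open>Ea\<close> is fixed by the odd
    number of external edges at the \<omega> triangle.\<close>
  define c where "c y = odd (card (S \<inter> {..<y}) + card (S' \<inter> {..<y}))" for y
  define a where "a y = (c y \<longleftrightarrow> y \<in> S)" for y
  have cS: "c (Suc y) = (a y \<longleftrightarrow> y \<in> S')" for y
    by (auto simp: c_def a_def lessThan_Suc Int_insert_right)
  have c0: "\<not> c 0" by (simp add: c_def)
  \<comment> \<open>The parity assumption on S and S' says that no vertical edge is required above
    the top row.\<close>
  have cm: "\<not> c m"
    using assms by (simp add: c_def Int_absorb2)
  \<comment> \<open>A triangle edge is added when both its corners are still free. One external edge
    leaves two free corners and hence one triangle edge; three external edges leave none.\<close>
  define M where "M = {e. \<exists>y<m. e = Ea x y \<and> a y \<or> e = Eb x y \<and> y \<in> S' \<or> e = Ec x y \<and> c (Suc y)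
      \<or> e = Bab x y \<and> \<not> a y \<and> y \<notin> S' \<or> e = Bbc x y \<and> y \<notin> S' \<and> \<not> c (Suc y)
      \<or> e = Bca x y \<and> \<not> a y \<and> \<not> c (Suc y) \<or> e = Oab x y \<and> \<not> a y \<and> y \<notin> S
      \<or> e = Obc x y \<and> y \<notin> S \<and> \<not> c y \<or> e = Oca x y \<and> \<not> a y \<and> \<not> c y}"
  have mem: "Ea x y \<in> M \<longleftrightarrow> y < m \<and> a y" "Eb x y \<in> M \<longleftrightarrow> y < m \<and> y \<in> S'"
    "Ec x y \<in> M \<longleftrightarrow> y < m \<and> c (Suc y)" "Bab x y \<in> M \<longleftrightarrow> y < m \<and> \<not> a y \<and> y \<notin> S'"
    "Bbc x y \<in> M \<longleftrightarrow> y < m \<and> y \<notin> S' \<and> \<not> c (Suc y)"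
    "Bca x y \<in> M \<longleftrightarrow> y < m \<and> \<not> a y \<and> \<not> c (Suc y)"
    "Oab x y \<in> M \<longleftrightarrow> y < m \<and> \<not> a y \<and> y \<notin> S"
    "Obc x y \<in> M \<longleftrightarrow> y < m \<and> y \<notin> S \<and> \<not> c y"
    "Oca x y \<in> M \<longleftrightarrow> y < m \<and> \<not> a y \<and> \<not> c y" for y
    unfolding M_def by auto
  have "M \<subseteq> col_arcs m x"
  proof
    fix e assume "e \<in> M"
    then obtain y where y: "y < m" and e: "e \<in> {Ea x y, Eb x y, Bab x y, Bbc x y, Bca x y, Oab x y, Obc x y, Oca x y}
       \<or> e = Ec x y \<and> c (Suc y)"
      unfolding M_def by blast
    moreover have "Suc y < m" if "c (Suc y)"
      using that cm y by (metis Suc_lessI)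
    ultimately show "e \<in> col_arcs m x"
      by (auto simp: col_arcs_def)
  qed
  moreover have "right_state M x = S'"
    using assms(2) by (auto simp: right_state_def mem)
  moreover have "vdeg S M u = 1" if "xpos u = x" "ypos u < m" for u
  proof (cases u rule: vertex_cases)
    case (oc x' y)
    then show ?thesis using that c0 a_def[of y] by (cases y) (auto simp: mem)
  qed (use that cS a_def in \<open>auto simp: mem\<close>)
  ultimately have "M \<in> column_configs m x S S' (\<lambda>_. 1)"
    by (simp add: column_configs_def)
  then show ?thesis by blast
qed

section \<open>Defects and the Kasteleyn relations\<close>

lemma vdeg_pos:
  assumes "e \<in> col_arcs m x" "e \<in> M" "u = fst e \<or> u = snd e" "xpos u = x"
  shows "vdeg S M u > 0"
proof -
  have "vdeg S M u = vdeg S (insert e (M - {e})) u"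
    using assms(2) by (simp add: insert_absorb)
  then show ?thesis
    using vdeg_insert[OF assms(1), of "M - {e}" u S] assms(3,4) by auto
qed

lemma col_arcs_ypos:
  assumes "e \<in> col_arcs m x"
  shows "ypos (fst e) < m" "ypos (snd e) < m" "xpos (fst e) = x" "fst e \<noteq> snd e"
  using assms by (auto elim: col_arcs_cases)

abbreviation "dens (v :: vertex) (k :: nat) \<equiv> (\<lambda>_. 1)(v := k)"

lemma dens_other: "ypos u \<noteq> ypos v \<Longrightarrow> dens v k u = 1"
  by auto

lemma sum_filter_of_bool:
  fixes f :: "'a \<Rightarrow> real"
  assumes "finite A"
  shows "(\<Sum>x | x \<in> A \<and> P x. f x) = (\<Sum>x\<in>A. of_bool (P x) * f x)"
proof -
  have "(\<Sum>x | x \<in> A \<and> P x. f x) = (\<Sum>x\<in>A. if P x then f x else 0)"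
    by (rule sum.inter_filter[OF assms])
  also have "\<dots> = (\<Sum>x\<in>A. of_bool (P x) * f x)"
    by (intro sum.cong) auto
  finally show ?thesis .
qed

text \<open>
  All terms of row \<open>v\<close> of the Kasteleyn relation become sums over configurations covering \<open>v\<close> twice,
  where they cancel in pairs.
\<close>

lemma monomer_edge:
  assumes e: "e \<in> col_arcs m x" and x: "xpos (snd e) = x" and uv: "{u, v} = {fst e, snd e}"
  shows "W e * column_weight m W x S S' (dens u 0)
       = (\<Sum>M\<in>column_configs m x S S' (dens v 2). of_bool (e \<in> M) * prod W M)"
proof -
  have uv': "u = fst e \<and> v = snd e \<or> u = snd e \<and> v = fst e"
    using uv by (auto simp: doubleton_eq_iff)
  have u: "xpos u = x" "ypos u < m" "u \<noteq> v" using col_arcs_ypos[OF e] x uv' by auto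
  have "e \<notin> M" if "M \<in> column_configs m x S S' (dens u 0)" for M
    using vdeg_pos[OF e, of M u S] u uv' that by (auto simp: column_configs_def)
  then have "{M. M \<in> column_configs m x S S' (dens u 0) \<and> e \<notin> M} = column_configs m x S S' (dens u 0)"
    by blast
  then have "W e * column_weight m W x S S' (dens u 0)
      = W e * (\<Sum>M | M \<in> column_configs m x S S' (dens u 0) \<and> e \<notin> M. prod W M)"
    unfolding column_weight_def by simp
  also have "\<dots> = (\<Sum>M | M \<in> column_configs m x S S' (dens v 2) \<and> e \<in> M. prod W M)"
  proof (rule sum_column_configs_insert[OF e])
    have "Eb x y \<noteq> e" for y
    proof
      assume "Eb x y = e"
      then have "snd e = VOmega Corner_b (x + 1) y" by (metis snd_conv)
      then show False using x by simp
    qed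
    then have "right_state (insert e M) x = right_state M x" for M
      by (simp add: right_state_def)
    then show "right_state (insert e M) x = S' \<longleftrightarrow> right_state M x = S'" for M
      by simp
    show "dens v 2 w = dens u 0 w + of_bool (w = fst e) + of_bool (w = snd e)" for w
      using uv' u(3) by auto
  qed
  finally show ?thesis by (simp add: sum_filter_of_bool finite_column_configs)
qed

abbreviation transfer_weight :: "nat \<Rightarrow> (edge \<Rightarrow> real) \<Rightarrow> int \<Rightarrow> nat set \<Rightarrow> nat set \<Rightarrow> real" where
  "transfer_weight m W x S S' \<equiv> column_weight m W x S S' (\<lambda>_. 1)"

lemma right_state_column_configs: "M \<in> column_configs m x S S' d \<Longrightarrow> Eb x y \<in> M \<longleftrightarrow> y \<in> S'"
  by (auto simp: column_configs_def right_state_def)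

text \<open>The edge \<open>Eb x y\<close> leaves the column, so adding it removes the defect at
  \<beta>_b and sets bit y of the right state. If the bit is already set, \<beta>_b is covered and
  there is no such defect.\<close>

lemma column_weight_beta_b_0:
  assumes y: "y < m"
  shows "W (Eb x y) * column_weight m W x S S' (dens (VBeta Corner_b x y) 0)
       = (if y \<in> S' then 0 else transfer_weight m W x S (insert y S'))"
proof (cases "y \<in> S'")
  case True
  have e: "Eb x y \<in> col_arcs m x" using y by (simp add: col_arcs_def)
  have "M \<notin> column_configs m x S S' (dens (VBeta Corner_b x y) 0)" for M
    using vdeg_pos[OF e, of M "VBeta Corner_b x y" S] True y right_state_column_configs[of M m x S S' _ y]
    by (auto simp: column_configs_def)
  then have "column_configs m x S S' (dens (VBeta Corner_b x y) 0) = {}" by blast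
  then show ?thesis using True by (simp add: column_weight_def)
next
  case False
  have e: "Eb x y \<in> col_arcs m x" using y by (simp add: col_arcs_def)
  have "W (Eb x y) * (\<Sum>M | M \<in> column_configs m x S S' (dens (VBeta Corner_b x y) 0) \<and> Eb x y \<notin> M. prod W M)
      = (\<Sum>M | M \<in> column_configs m x S (insert y S') (\<lambda>_. 1) \<and> Eb x y \<in> M. prod W M)"
  proof (rule sum_column_configs_insert[OF e])
    show "1 = dens (VBeta Corner_b x y) 0 u + of_bool (u = fst (Eb x y)) + of_bool (u = snd (Eb x y))"
      if "xpos u = x" for u
      using that by (cases u rule: vertex_cases) auto
  qed (use False in \<open>auto simp: right_state_def\<close>)
  moreover have "{M. M \<in> column_configs m x S S' (dens (VBeta Corner_b x y) 0) \<and> Eb x y \<notin> M}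
      = column_configs m x S S' (dens (VBeta Corner_b x y) 0)"
    using False right_state_column_configs by blast
  moreover have "{M. M \<in> column_configs m x S (insert y S') (\<lambda>_. 1) \<and> Eb x y \<in> M}
      = column_configs m x S (insert y S') (\<lambda>_. 1)"
    using right_state_column_configs by blast
  ultimately show ?thesis using False by (simp add: column_weight_def)
qed

lemma column_weight_beta_b_2:
  assumes y: "y < m" "y \<in> S'"
  shows "column_weight m W x S S' (dens (VBeta Corner_b x y) 2) = W (Eb x y) * transfer_weight m W x S (S' - {y})"
proof -
  have e: "Eb x y \<in> col_arcs m x" using y by (simp add: col_arcs_def)
  have "W (Eb x y) * (\<Sum>M | M \<in> column_configs m x S (S' - {y}) (\<lambda>_. 1) \<and> Eb x y \<notin> M. prod W M)
      = (\<Sum>M | M \<in> column_configs m x S S' (dens (VBeta Corner_b x y) 2) \<and> Eb x y \<in> M. prod W M)"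
  proof (rule sum_column_configs_insert[OF e])
    show "dens (VBeta Corner_b x y) 2 u = 1 + of_bool (u = fst (Eb x y)) + of_bool (u = snd (Eb x y))"
      if "xpos u = x" for u
      using that by (cases u rule: vertex_cases) auto
  qed (use y in \<open>auto simp: right_state_def\<close>)
  moreover have "{M. M \<in> column_configs m x S (S' - {y}) (\<lambda>_. 1) \<and> Eb x y \<notin> M}
      = column_configs m x S (S' - {y}) (\<lambda>_. 1)"
    using right_state_column_configs by blast
  moreover have "{M. M \<in> column_configs m x S S' (dens (VBeta Corner_b x y) 2) \<and> Eb x y \<in> M}
      = column_configs m x S S' (dens (VBeta Corner_b x y) 2)"
    using y right_state_column_configs by blast
  ultimately show ?thesis by (simp add: column_weight_def)
qed

lemma vdeg_left:
  "vdeg (insert y S) M u = (if y \<in> S then vdeg S M u else vdeg S M u + of_bool (\<exists>x. u = VOmega Corner_b x y))"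
  by (cases u rule: vertex_cases) auto

text \<open>The edge reaching \<omega>_b from the left is only a bit of S here, its weight being
  counted in the previous column. Setting that bit covers the defect without touching M, so the sets
  of configurations are equal and not merely their weights up to a factor.\<close>

lemma column_configs_omega_b_0:
  assumes y: "y < m"
  shows "column_configs m x S S' (dens (VOmega Corner_b x y) 0)
       = (if y \<in> S then {} else column_configs m x (insert y S) S' (\<lambda>_. 1))"
proof (cases "y \<in> S")
  case True
  have "M \<notin> column_configs m x S S' (dens (VOmega Corner_b x y) 0)" for M
    using y True by (auto simp: column_configs_def dest!: spec[of _ "VOmega Corner_b x y"])
  then show ?thesis using True by auto
next
  case False
  have "vdeg S M u = dens (VOmega Corner_b x y) 0 u \<longleftrightarrow> vdeg (insert y S) M u = 1"
    if "xpos u = x" for u M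
    using False that unfolding vdeg_left by auto
  then show ?thesis using False unfolding column_configs_def by auto
qed

lemma column_configs_omega_b_2:
  assumes y: "y \<in> S"
  shows "column_configs m x S S' (dens (VOmega Corner_b x y) 2) = column_configs m x (S - {y}) S' (\<lambda>_. 1)"
proof -
  have "vdeg S M u = dens (VOmega Corner_b x y) 2 u \<longleftrightarrow> vdeg (S - {y}) M u = 1"
    if "xpos u = x" for u M
    using y that vdeg_left[of y "S - {y}" M u] by (auto simp: insert_absorb)
  then show ?thesis unfolding column_configs_def by auto
qed

section \<open>Signs of defects and the rows of the Kasteleyn relation within a column\<close>

definition sign_below :: "nat set \<Rightarrow> nat \<Rightarrow> real" where
  "sign_below S y = (-1) ^ card (S \<inter> {..<y})"

lemma sign_below_Suc: "sign_below S (Suc y) = sign_below S y * (-1) ^ of_bool (y \<in> S)"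
  by (auto simp: sign_below_def lessThan_Suc Int_insert_right)

lemma sign_below_insert [simp]: "sign_below (insert y S) y = sign_below S y"
  by (simp add: sign_below_def)

text \<open>
  The Jordan--Wigner sign of a defect, that is, of a vertex left uncovered. By parity it is determined
  by the boundary states alone.
\<close>

fun defect_sign :: "nat set \<Rightarrow> nat set \<Rightarrow> vertex \<Rightarrow> real" where
  "defect_sign S S' (VBeta Corner_a x y) = (-1) ^ y * sign_below S' y"
| "defect_sign S S' (VBeta Corner_b x y) = (-1) ^ y * sign_below S' y"
| "defect_sign S S' (VBeta Corner_c x y) = (-1) ^ y * sign_below S' (Suc y)"
| "defect_sign S S' (VOmega Corner_a x y) = - ((-1) ^ y * sign_below S' y)"
| "defect_sign S S' (VOmega Corner_b x y) = - ((-1) ^ y * sign_below S y)"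
| "defect_sign S S' (VOmega Corner_c x y) = - ((-1) ^ y * sign_below S' y)"

definition defect :: "nat \<Rightarrow> (edge \<Rightarrow> real) \<Rightarrow> nat set \<Rightarrow> nat set \<Rightarrow> vertex \<Rightarrow> real" where
  "defect m W S S' v = defect_sign S S' v * column_weight m W (xpos v) S S' (dens v 0)"

lemma defect_edge:
  assumes "e \<in> col_arcs m x" "xpos (snd e) = x" "{u, v} = {fst e, snd e}"
  shows "W e * defect m W S S' u
       = (\<Sum>M\<in>column_configs m x S S' (dens v 2). (defect_sign S S' u * of_bool (e \<in> M)) * prod W M)"
proof -
  have "xpos u = x" using assms col_arcs_ypos[OF assms(1)] by (auto simp: doubleton_eq_iff)
  then have "W e * defect m W S S' u = defect_sign S S' u * (W e * column_weight m W x S S' (dens u 0))"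
    by (simp add: defect_def)
  then show ?thesis
    unfolding monomer_edge[OF assms] by (simp add: sum_distrib_left mult.assoc)
qed

lemma column_configs_vdeg:
  "M \<in> column_configs m x S S' d \<Longrightarrow> xpos u = x \<Longrightarrow> ypos u < m \<Longrightarrow> vdeg S M u = d u"
  by (auto simp: column_configs_def)

lemma defect_two_edges:
  assumes "e1 \<in> col_arcs m x" "xpos (snd e1) = x" "{u1, v} = {fst e1, snd e1}"
    and "e2 \<in> col_arcs m x" "xpos (snd e2) = x" "{u2, v} = {fst e2, snd e2}"
  shows "W e1 * defect m W S S' u1 - W e2 * defect m W S S' u2
       = (\<Sum>M\<in>column_configs m x S S' (dens v 2).
            (defect_sign S S' u1 * of_bool (e1 \<in> M) - defect_sign S S' u2 * of_bool (e2 \<in> M)) * prod W M)"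
  unfolding defect_edge[OF assms(1-3)] defect_edge[OF assms(4-6)]
  by (simp add: sum_subtractf left_diff_distrib)

text \<open>The relation holds configuration by configuration. Exactly two of the three edges at the
  doubly covered vertex occur; the degrees of the other two corners of the triangle then decide
  whether y lies in S', and with it the sign of \<beta>_c relative to the other corners. The rows of
  \<beta>_c, \<omega>_a and \<omega>_c, whose edges also stay in the column, are treated
  alike.\<close>

lemma row_beta_a:
  assumes y: "y < m"
  shows "W (Bab x y) * defect m W S S' (VBeta Corner_b x y)
     - W (Bca x y) * defect m W S S' (VBeta Corner_c x y)
     = - (W (Ea x y) * defect m W S S' (VOmega Corner_a x y))"
proof -
  let ?v = "VBeta Corner_a x y"
  have "defect_sign S S' (VBeta Corner_b x y) * of_bool (Bab x y \<in> M)
     - defect_sign S S' (VBeta Corner_c x y) * of_bool (Bca x y \<in> M)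
     = - (defect_sign S S' (VOmega Corner_a x y) * of_bool (Ea x y \<in> M))"
    if M: "M \<in> column_configs m x S S' (dens ?v 2)" for M
    using column_configs_vdeg[OF M, of ?v] column_configs_vdeg[OF M, of "VBeta Corner_b x y"]
      column_configs_vdeg[OF M, of "VBeta Corner_c x y"] right_state_column_configs[OF M, of y] y
    by (cases "Bab x y \<in> M"; cases "Bbc x y \<in> M"; cases "Bca x y \<in> M"; cases "y \<in> S'";
        cases "Ea x y \<in> M"; simp add: sign_below_Suc)
  then show ?thesis
    using y
    by (subst defect_two_edges[where x = x and v = ?v], simp_all add: col_arcs_def
        defect_edge[where x = x and v = ?v] insert_commute sum_negf[symmetric] del: defect_sign.simps)
qed

lemma row_beta_c:
  assumes y: "y < m"
  shows "W (Bca x y) * defect m W S S' (VBeta Corner_a x y)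
     - W (Bbc x y) * defect m W S S' (VBeta Corner_b x y)
     = - (if Suc y < m then W (Ec x y) * defect m W S S' (VOmega Corner_c x (Suc y)) else 0)"
proof -
  let ?v = "VBeta Corner_c x y"
  have *: "defect_sign S S' (VBeta Corner_a x y) * of_bool (Bca x y \<in> M)
     - defect_sign S S' (VBeta Corner_b x y) * of_bool (Bbc x y \<in> M)
     = - (if Suc y < m then defect_sign S S' (VOmega Corner_c x (Suc y)) * of_bool (Ec x y \<in> M) else 0)"
    if M: "M \<in> column_configs m x S S' (dens ?v 2)" for M
  proof -
    have "Suc y < m" if "Ec x y \<in> M"
      using that M by (auto simp: column_configs_def col_arcs_def)
    then show ?thesis
    using column_configs_vdeg[OF M, of ?v] column_configs_vdeg[OF M, of "VBeta Corner_a x y"]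
      column_configs_vdeg[OF M, of "VBeta Corner_b x y"] right_state_column_configs[OF M, of y] y
    by (cases "Bab x y \<in> M"; cases "Bbc x y \<in> M"; cases "Bca x y \<in> M"; cases "y \<in> S'";
        cases "Ec x y \<in> M"; simp add: sign_below_Suc)
  qed
  show ?thesis
  proof (cases "Suc y < m")
    case True
    then show ?thesis
      using y *
      by (subst defect_two_edges[where x = x and v = ?v], simp_all add: col_arcs_def
        defect_edge[where x = x and v = ?v] insert_commute sum_negf[symmetric] del: defect_sign.simps)
  next
    case False
    then show ?thesis
      using y *
      by (subst defect_two_edges[where x = x and v = ?v], simp_all add: col_arcs_def
         insert_commute del: defect_sign.simps)
  qed
qed

lemma row_omega_a:
  assumes y: "y < m"
  shows "W (Oab x y) * defect m W S S' (VOmega Corner_b x y)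
     - W (Oca x y) * defect m W S S' (VOmega Corner_c x y)
     = W (Ea x y) * defect m W S S' (VBeta Corner_a x y)"
proof -
  let ?v = "VOmega Corner_a x y"
  have "defect_sign S S' (VOmega Corner_b x y) * of_bool (Oab x y \<in> M)
     - defect_sign S S' (VOmega Corner_c x y) * of_bool (Oca x y \<in> M)
     = defect_sign S S' (VBeta Corner_a x y) * of_bool (Ea x y \<in> M)"
    if M: "M \<in> column_configs m x S S' (dens ?v 2)" for M
  proof -
    \<comment> \<open>The sign at \<omega>_b is read from the left state, those at \<omega>_a and
      \<omega>_c from the right state. Parity below y makes them comparable through the vertical
      edge, whose presence is visible at the triangle.\<close>
    have "sign_below S y = sign_below S' y * (-1) ^ of_bool (y > 0 \<and> Ec x (y - 1) \<in> M)"
      unfolding sign_below_def using y by (intro parity_below[OF M] dens_other) auto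
    then show ?thesis
    using column_configs_vdeg[OF M, of ?v] column_configs_vdeg[OF M, of "VOmega Corner_b x y"]
      column_configs_vdeg[OF M, of "VOmega Corner_c x y"] y
    by (cases "Oab x y \<in> M"; cases "Obc x y \<in> M"; cases "Oca x y \<in> M"; cases "y \<in> S";
        cases "Ea x y \<in> M"; simp)
  qed
  then show ?thesis
    using y
    by (subst defect_two_edges[where x = x and v = ?v], simp_all add: col_arcs_def
        defect_edge[where x = x and v = ?v] insert_commute sum_negf[symmetric] del: defect_sign.simps)
qed

lemma row_omega_c:
  assumes y: "y < m"
  shows "W (Oca x y) * defect m W S S' (VOmega Corner_a x y)
     - W (Obc x y) * defect m W S S' (VOmega Corner_b x y)
     = (if y > 0 then W (Ec x (y - 1)) * defect m W S S' (VBeta Corner_c x (y - 1)) else 0)"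
proof -
  let ?v = "VOmega Corner_c x y"
  have *: "defect_sign S S' (VOmega Corner_a x y) * of_bool (Oca x y \<in> M)
     - defect_sign S S' (VOmega Corner_b x y) * of_bool (Obc x y \<in> M)
     = (if y > 0 then defect_sign S S' (VBeta Corner_c x (y - 1)) * of_bool (Ec x (y - 1) \<in> M) else 0)"
    if M: "M \<in> column_configs m x S S' (dens ?v 2)" for M
  proof -
    have "sign_below S y = sign_below S' y * (-1) ^ of_bool (y > 0 \<and> Ec x (y - 1) \<in> M)"
      unfolding sign_below_def using y by (intro parity_below[OF M] dens_other) auto
    then show ?thesis
    using column_configs_vdeg[OF M, of ?v] column_configs_vdeg[OF M, of "VOmega Corner_b x y"]
      column_configs_vdeg[OF M, of "VOmega Corner_a x y"] y
    by (cases "Oab x y \<in> M"; cases "Obc x y \<in> M"; cases "Oca x y \<in> M"; cases "y \<in> S";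
        cases "Ec x (y - 1) \<in> M"; cases y; simp)
  qed
  show ?thesis
  proof (cases y)
    case (Suc k)
    then show ?thesis
      using y *
      by (subst defect_two_edges[where x = x and v = ?v], simp_all add: col_arcs_def
        defect_edge[where x = x and v = ?v] insert_commute sum_negf[symmetric] del: defect_sign.simps)
  next
    case 0
    then show ?thesis
      using y *
      by (subst defect_two_edges[where x = x and v = ?v], simp_all add: col_arcs_def
         insert_commute del: defect_sign.simps)
  qed
qed

text \<open>The third neighbour of \<beta>_b lies in the next column, so its term cannot cancel
  here. What survives are configurations containing \<open>Eb x y\<close>, rewritten with bit y of
  the right state cleared; the defect at \<omega>_b in the next column supplies the opposite
  term.\<close>

lemma row_beta_b:
  assumes y: "y < m"
  shows "W (Bbc x y) * defect m W S S' (VBeta Corner_c x y)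
     - W (Bab x y) * defect m W S S' (VBeta Corner_a x y)
     = - ((-1) ^ y * sign_below S' y * of_bool (y \<in> S') * W (Eb x y) * transfer_weight m W x S (S' - {y}))"
proof -
  let ?v = "VBeta Corner_b x y"
  have "defect_sign S S' (VBeta Corner_c x y) * of_bool (Bbc x y \<in> M)
     - defect_sign S S' (VBeta Corner_a x y) * of_bool (Bab x y \<in> M)
     = - ((-1) ^ y * sign_below S' y * of_bool (y \<in> S'))"
    if M: "M \<in> column_configs m x S S' (dens ?v 2)" for M
    using column_configs_vdeg[OF M, of ?v] column_configs_vdeg[OF M, of "VBeta Corner_a x y"]
      column_configs_vdeg[OF M, of "VBeta Corner_c x y"] right_state_column_configs[OF M, of y] y
    by (cases "Bab x y \<in> M"; cases "Bbc x y \<in> M"; cases "Bca x y \<in> M"; cases "y \<in> S'"; simp add: sign_below_Suc)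
  then have "W (Bbc x y) * defect m W S S' (VBeta Corner_c x y)
     - W (Bab x y) * defect m W S S' (VBeta Corner_a x y)
     = - ((-1) ^ y * sign_below S' y * of_bool (y \<in> S')) * column_weight m W x S S' (dens ?v 2)"
    using y unfolding column_weight_def sum_distrib_left
    by (subst defect_two_edges[where x = x and v = ?v], simp_all add: col_arcs_def
        insert_commute del: defect_sign.simps)
  then show ?thesis using column_weight_beta_b_2[OF y, of S' W x S] by (cases "y \<in> S'") simp_all
qed

text \<open>Mirror image at the left boundary. No weight of the entering edge appears, since that
  edge belongs to the previous column.\<close>

lemma row_omega_b:
  assumes y: "y < m"
  shows "W (Obc x y) * defect m W S S' (VOmega Corner_c x y)
     - W (Oab x y) * defect m W S S' (VOmega Corner_a x y)
     = - ((-1) ^ y * sign_below S y * of_bool (y \<in> S) * transfer_weight m W x (S - {y}) S')"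
proof -
  let ?v = "VOmega Corner_b x y"
  have "defect_sign S S' (VOmega Corner_c x y) * of_bool (Obc x y \<in> M)
     - defect_sign S S' (VOmega Corner_a x y) * of_bool (Oab x y \<in> M)
     = - ((-1) ^ y * sign_below S y * of_bool (y \<in> S))"
    if M: "M \<in> column_configs m x S S' (dens ?v 2)" for M
  proof -
    have "sign_below S y = sign_below S' y * (-1) ^ of_bool (y > 0 \<and> Ec x (y - 1) \<in> M)"
      unfolding sign_below_def using y by (intro parity_below[OF M] dens_other) auto
    then show ?thesis
    using column_configs_vdeg[OF M, of ?v] column_configs_vdeg[OF M, of "VOmega Corner_c x y"]
      column_configs_vdeg[OF M, of "VOmega Corner_a x y"] y
    by (cases "Oab x y \<in> M"; cases "Obc x y \<in> M"; cases "Oca x y \<in> M"; cases "y \<in> S"; simp)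
  qed
  then have "W (Obc x y) * defect m W S S' (VOmega Corner_c x y)
     - W (Oab x y) * defect m W S S' (VOmega Corner_a x y)
     = - ((-1) ^ y * sign_below S y * of_bool (y \<in> S)) * column_weight m W x S S' (dens ?v 2)"
    using y unfolding column_weight_def sum_distrib_left
    by (subst defect_two_edges[where x = x and v = ?v], simp_all add: col_arcs_def
        insert_commute del: defect_sign.simps)
  then show ?thesis using column_configs_omega_b_2[of y S m x S']
    by (cases "y \<in> S") (simp_all add: column_weight_def)
qed

lemma defect_beta_b:
  assumes y: "y < m"
  shows "W (Eb x y) * defect m W S S' (VBeta Corner_b x y)
     = (-1) ^ y * sign_below S' y * of_bool (y \<notin> S') * transfer_weight m W x S (insert y S')"
  using column_weight_beta_b_0[OF y, of W x S S'] by (simp add: defect_def)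

lemma defect_omega_b:
  assumes y: "y < m"
  shows "defect m W S S' (VOmega Corner_b x y)
     = - ((-1) ^ y * sign_below S y * of_bool (y \<notin> S) * transfer_weight m W x (insert y S) S')"
  using column_configs_omega_b_0[OF y, of x S S'] by (simp add: defect_def column_weight_def)

section \<open>Summation of defects over boundary states\<close>

abbreviation states :: "nat \<Rightarrow> nat set set" where
  "states m \<equiv> Pow {..<m}"

lemma finite_states: "finite (states m)"
  by simp

lemma sum_states_flip:
  fixes h :: "nat set \<Rightarrow> real"
  assumes "y < m"
  shows "(\<Sum>S\<in>states m. of_bool (y \<in> S) * h S) = (\<Sum>S\<in>states m. of_bool (y \<notin> S) * h (insert y S))"
proof -
  have "(\<Sum>S\<in>{S \<in> states m. y \<in> S}. h S) = (\<Sum>S\<in>{S \<in> states m. y \<notin> S}. h (insert y S))"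
    by (rule sum.reindex_bij_witness[of _ "insert y" "\<lambda>S. S - {y}"])
       (use assms in \<open>auto simp: insert_absorb\<close>)
  then show ?thesis
    by (simp add: sum_filter_of_bool[of "states m", simplified])
qed

text \<open>The candidate for the null vector: the signed weight of a band with a monomer at v,
  where \<open>L\<close> and \<open>R\<close> stand for all columns to the left and right of its
  column. A bit flip seen from both sides of a column boundary comes with the same sign; the factor
  (-1)^x makes the two contributions cancel.\<close>

definition monomer :: "nat \<Rightarrow> (edge \<Rightarrow> real) \<Rightarrow> (int \<Rightarrow> nat set \<Rightarrow> real) \<Rightarrow> (int \<Rightarrow> nat set \<Rightarrow> real) \<Rightarrow> vertex \<Rightarrow> real" where
  "monomer m W L R v = (-1) ^ nat (xpos v) *
     (\<Sum>S\<in>states m. \<Sum>S'\<in>states m. L (xpos v) S * defect m W S S' v * R (xpos v + 1) S')"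

lemma monomer_scale:
  "a * monomer m W L R v = (-1) ^ nat (xpos v) *
     (\<Sum>S\<in>states m. \<Sum>S'\<in>states m. L (xpos v) S * (a * defect m W S S' v) * R (xpos v + 1) S')"
  by (simp add: monomer_def sum_distrib_left mult_ac)

lemma monomer_two:
  assumes "xpos u = x" "xpos v = x"
    and "\<And>S S'. a * defect m W S S' u - b * defect m W S S' v = D S S'"
  shows "a * monomer m W L R u - b * monomer m W L R v = (-1) ^ nat x *
     (\<Sum>S\<in>states m. \<Sum>S'\<in>states m. L x S * D S S' * R (x + 1) S')"
  unfolding monomer_scale assms(1,2) assms(3)[symmetric]
  by (simp add: right_diff_distrib left_diff_distrib sum_subtractf)

lemma monomer_three:
  assumes "xpos u = x" "xpos v = x" "xpos w = x"
    and "\<And>S S'. a * defect m W S S' u - b * defect m W S S' v = c * defect m W S S' w"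
  shows "a * monomer m W L R u - b * monomer m W L R v = c * monomer m W L R w"
  unfolding monomer_two[OF assms(1,2,4)] unfolding monomer_scale assms(3) by simp

text \<open>
  Two boundary sums left over from the rows of the corners \<open>b\<close>, whose edges join consecutive columns.
\<close>

definition flip_in :: "nat \<Rightarrow> (int \<Rightarrow> nat set \<Rightarrow> real) \<Rightarrow> (int \<Rightarrow> nat set \<Rightarrow> real) \<Rightarrow> int \<Rightarrow> nat \<Rightarrow> real" where
  "flip_in m L R x y = (-1) ^ y * (\<Sum>S\<in>states m. of_bool (y \<notin> S) * (sign_below S y * L x S * R x (insert y S)))"

definition flip_out :: "nat \<Rightarrow> (int \<Rightarrow> nat set \<Rightarrow> real) \<Rightarrow> (int \<Rightarrow> nat set \<Rightarrow> real) \<Rightarrow> int \<Rightarrow> nat \<Rightarrow> real" where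
  "flip_out m L R x y = (-1) ^ y * (\<Sum>S\<in>states m. of_bool (y \<notin> S) * (sign_below S y * L x (insert y S) * R x S))"

context
  fixes m :: nat and W :: "edge \<Rightarrow> real" and L R :: "int \<Rightarrow> nat set \<Rightarrow> real" and x :: int and y :: nat
  assumes y: "y < m"
begin

text \<open>A missing \<omega>_b acts like an additional incoming bit, so the column is an ordinary
  one with left state \<open>insert y S\<close>, and the sum over S' is the transfer equation of
  \<open>R\<close>.\<close>

lemma monomer_omega_b:
  assumes R: "\<And>S. S \<in> states m \<Longrightarrow> (\<Sum>S'\<in>states m. transfer_weight m W x S S' * R (x + 1) S') = R x S"
  shows "monomer m W L R (VOmega Corner_b x y) = - ((-1) ^ nat x * flip_in m L R x y)"
proof -
  have "(\<Sum>S'\<in>states m. L x S * defect m W S S' (VOmega Corner_b x y) * R (x + 1) S')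
      = - ((-1) ^ y * (of_bool (y \<notin> S) * (sign_below S y * L x S * R x (insert y S))))"
    if "S \<in> states m" for S
  proof -
    have "insert y S \<in> states m" using that y by auto
    then show ?thesis
      unfolding R[OF \<open>insert y S \<in> states m\<close>, symmetric] sum_distrib_left defect_omega_b[OF y]
        sum_negf[symmetric]
      by (intro sum.cong) (auto simp: mult_ac)
  qed
  then show ?thesis
    by (simp add: monomer_def flip_in_def sum_negf sum_distrib_left del: sum_of_bool_mult_eq)
qed

lemma monomer_row_omega_b:
  assumes R: "\<And>S. S \<in> states m \<Longrightarrow> (\<Sum>S'\<in>states m. transfer_weight m W x S S' * R (x + 1) S') = R x S"
  shows "W (Obc x y) * monomer m W L R (VOmega Corner_c x y)
     - W (Oab x y) * monomer m W L R (VOmega Corner_a x y) = - ((-1) ^ nat x * flip_out m L R x y)"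
proof -
  have "(\<Sum>S'\<in>states m. L x S * (- ((-1) ^ y * sign_below S y * of_bool (y \<in> S) * transfer_weight m W x (S - {y}) S')) * R (x + 1) S')
      = of_bool (y \<in> S) * - ((-1) ^ y * sign_below S y * L x S * R x (S - {y}))"
    if "S \<in> states m" for S
  proof -
    have "S - {y} \<in> states m" using that by auto
    then show ?thesis
      unfolding R[OF \<open>S - {y} \<in> states m\<close>, symmetric] sum_distrib_left
        sum_negf[symmetric]
      by (intro sum.cong) (auto simp: mult_ac)
  qed
  then have "(\<Sum>S\<in>states m. \<Sum>S'\<in>states m.
        L x S * (- ((-1) ^ y * sign_below S y * of_bool (y \<in> S) * transfer_weight m W x (S - {y}) S')) * R (x + 1) S')
      = (\<Sum>S\<in>states m. of_bool (y \<in> S) * - ((-1) ^ y * sign_below S y * L x S * R x (S - {y})))"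
    by (intro sum.cong) auto
  \<comment> \<open>Reindexing by the state without bit y gives the same sum as a defect at
    \<beta>_b in the column to the left; this is why only two boundary sums are needed.\<close>
  also have "\<dots> = (\<Sum>S\<in>states m. - ((-1) ^ y * (of_bool (y \<notin> S) * (sign_below S y * L x (insert y S) * R x S))))"
    unfolding sum_states_flip[OF y] by (intro sum.cong) auto
  also have "\<dots> = - flip_out m L R x y"
    by (simp add: flip_out_def sum_negf sum_distrib_left del: sum_of_bool_mult_eq)
  finally have *: "(\<Sum>S\<in>states m. \<Sum>S'\<in>states m.
        L x S * (- ((-1) ^ y * sign_below S y * of_bool (y \<in> S) * transfer_weight m W x (S - {y}) S')) * R (x + 1) S')
      = - flip_out m L R x y" .
  have "W (Obc x y) * monomer m W L R (VOmega Corner_c x y)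
     - W (Oab x y) * monomer m W L R (VOmega Corner_a x y) = (-1) ^ nat x *
     (\<Sum>S\<in>states m. \<Sum>S'\<in>states m.
        L x S * (- ((-1) ^ y * sign_below S y * of_bool (y \<in> S) * transfer_weight m W x (S - {y}) S')) * R (x + 1) S')"
    by (rule monomer_two[OF _ _ row_omega_b[OF y]]) simp_all
  then show ?thesis unfolding * by simp
qed

text \<open>Here the defect sets a bit of the outgoing state, and the sum over S collapses by the
  transfer equation of \<open>L\<close>; the flip is therefore located at x + 1.\<close>

lemma monomer_beta_b:
  assumes L: "\<And>S'. S' \<in> states m \<Longrightarrow> (\<Sum>S\<in>states m. L x S * transfer_weight m W x S S') = L (x + 1) S'"
  shows "W (Eb x y) * monomer m W L R (VBeta Corner_b x y) = (-1) ^ nat x * flip_out m L R (x + 1) y"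
proof -
  have "(\<Sum>S\<in>states m. L x S * (W (Eb x y) * defect m W S S' (VBeta Corner_b x y)) * R (x + 1) S')
      = (-1) ^ y * (of_bool (y \<notin> S') * (sign_below S' y * L (x + 1) (insert y S') * R (x + 1) S'))"
    if "S' \<in> states m" for S'
  proof -
    have "insert y S' \<in> states m" using that y by auto
    then show ?thesis
      unfolding L[OF \<open>insert y S' \<in> states m\<close>, symmetric] sum_distrib_left sum_distrib_right defect_beta_b[OF y]
      by (intro sum.cong) (auto simp: mult_ac)
  qed
  then show ?thesis
    unfolding monomer_scale vertex.sel
    by (subst sum.swap) (simp add: flip_out_def sum_distrib_left del: sum_of_bool_mult_eq)
qed

lemma monomer_row_beta_b:
  assumes L: "\<And>S'. S' \<in> states m \<Longrightarrow> (\<Sum>S\<in>states m. L x S * transfer_weight m W x S S') = L (x + 1) S'"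
  shows "W (Bbc x y) * monomer m W L R (VBeta Corner_c x y)
     - W (Bab x y) * monomer m W L R (VBeta Corner_a x y)
     = - ((-1) ^ nat x * (W (Eb x y) * flip_in m L R (x + 1) y))"
proof -
  have "(\<Sum>S\<in>states m. L x S * (- ((-1) ^ y * sign_below S' y * of_bool (y \<in> S') * W (Eb x y) * transfer_weight m W x S (S' - {y}))) * R (x + 1) S')
      = of_bool (y \<in> S') * - ((-1) ^ y * W (Eb x y) * sign_below S' y * L (x + 1) (S' - {y}) * R (x + 1) S')"
    if "S' \<in> states m" for S'
  proof -
    have "S' - {y} \<in> states m" using that by auto
    then show ?thesis
      unfolding L[OF \<open>S' - {y} \<in> states m\<close>, symmetric] sum_distrib_left sum_distrib_right
        sum_negf[symmetric]
      by (intro sum.cong) (auto simp: mult_ac)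
  qed
  then have "(\<Sum>S'\<in>states m. \<Sum>S\<in>states m.
        L x S * (- ((-1) ^ y * sign_below S' y * of_bool (y \<in> S') * W (Eb x y) * transfer_weight m W x S (S' - {y}))) * R (x + 1) S')
      = (\<Sum>S'\<in>states m. of_bool (y \<in> S') * - ((-1) ^ y * W (Eb x y) * sign_below S' y * L (x + 1) (S' - {y}) * R (x + 1) S'))"
    by (intro sum.cong) auto
  also have "\<dots> = (\<Sum>S\<in>states m. - (W (Eb x y) * ((-1) ^ y * (of_bool (y \<notin> S) * (sign_below S y * L (x + 1) S * R (x + 1) (insert y S))))))"
    unfolding sum_states_flip[OF y] by (intro sum.cong) auto
  also have "\<dots> = - (W (Eb x y) * flip_in m L R (x + 1) y)"
    by (simp add: flip_in_def sum_negf sum_distrib_left del: sum_of_bool_mult_eq)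
  finally have *: "(\<Sum>S'\<in>states m. \<Sum>S\<in>states m.
        L x S * (- ((-1) ^ y * sign_below S' y * of_bool (y \<in> S') * W (Eb x y) * transfer_weight m W x S (S' - {y}))) * R (x + 1) S')
      = - (W (Eb x y) * flip_in m L R (x + 1) y)" .
  have "W (Bbc x y) * monomer m W L R (VBeta Corner_c x y)
     - W (Bab x y) * monomer m W L R (VBeta Corner_a x y) = (-1) ^ nat x *
     (\<Sum>S\<in>states m. \<Sum>S'\<in>states m.
        L x S * (- ((-1) ^ y * sign_below S' y * of_bool (y \<in> S') * W (Eb x y) * transfer_weight m W x S (S' - {y}))) * R (x + 1) S')"
    by (rule monomer_two[OF _ _ row_beta_b[OF y]]) simp_all
  also have "\<dots> = (-1) ^ nat x * (- (W (Eb x y) * flip_in m L R (x + 1) y))"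
    by (subst sum.swap) (simp only: *)
  finally show ?thesis by simp
qed

end

section \<open>The matrix K(1) on the cylinder and its null vector\<close>

lemma mod_pred_iff:
  fixes x x' :: int
  assumes "0 \<le> x" "x < int N" "0 \<le> x'" "x' < int N"
  shows "(x' + 1) mod int N = x \<longleftrightarrow> x' = (x - 1) mod int N"
proof
  assume "(x' + 1) mod int N = x"
  then have "(x - 1) mod int N = (x' + 1 - 1) mod int N" by (metis mod_diff_left_eq)
  then show "x' = (x - 1) mod int N" using assms by simp
next
  assume "x' = (x - 1) mod int N"
  then have "(x' + 1) mod int N = (x - 1 + 1) mod int N" by (metis mod_add_left_eq)
  then show "(x' + 1) mod int N = x" using assms by simp
qed

context
  fixes m N :: nat and x :: int and y :: nat
  assumes x: "0 \<le> x" "x < int N" and y: "y < m"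
begin

lemma cylinder_out_arcs:
  "{e \<in> arcs (cylinder m N). fst e = VBeta Corner_a x y} = {Bab x y, Ea x y}"
  "{e \<in> arcs (cylinder m N). fst e = VBeta Corner_b x y} = {Bbc x y, Eb x y}"
  "{e \<in> arcs (cylinder m N). fst e = VBeta Corner_c x y} = insert (Bca x y) (if Suc y < m then {Ec x y} else {})"
  "{e \<in> arcs (cylinder m N). fst e = VOmega Corner_a x y} = {Oab x y}"
  "{e \<in> arcs (cylinder m N). fst e = VOmega Corner_b x y} = {Obc x y}"
  "{e \<in> arcs (cylinder m N). fst e = VOmega Corner_c x y} = {Oca x y}"
  using x y by (auto simp: cylinder_def elim: band_arcs.cases)

lemma cylinder_in_arcs:
  "{e \<in> arcs (cylinder m N). wrap N (snd e) = VBeta Corner_a x y} = {Bca x y}"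
  "{e \<in> arcs (cylinder m N). wrap N (snd e) = VBeta Corner_b x y} = {Bab x y}"
  "{e \<in> arcs (cylinder m N). wrap N (snd e) = VBeta Corner_c x y} = {Bbc x y}"
  "{e \<in> arcs (cylinder m N). wrap N (snd e) = VOmega Corner_a x y} = {Oca x y, Ea x y}"
  "{e \<in> arcs (cylinder m N). wrap N (snd e) = VOmega Corner_b x y} = {Oab x y, Eb ((x - 1) mod int N) y}"
  "{e \<in> arcs (cylinder m N). wrap N (snd e) = VOmega Corner_c x y} = insert (Obc x y) (if y > 0 then {Ec x (y - 1)} else {})"
proof -
  show "{e \<in> arcs (cylinder m N). wrap N (snd e) = VBeta Corner_a x y} = {Bca x y}"
    "{e \<in> arcs (cylinder m N). wrap N (snd e) = VBeta Corner_b x y} = {Bab x y}"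
    "{e \<in> arcs (cylinder m N). wrap N (snd e) = VBeta Corner_c x y} = {Bbc x y}"
    "{e \<in> arcs (cylinder m N). wrap N (snd e) = VOmega Corner_a x y} = {Oca x y, Ea x y}"
    using x y by (auto simp: cylinder_def elim: band_arcs.cases)
  show "{e \<in> arcs (cylinder m N). wrap N (snd e) = VOmega Corner_c x y} = insert (Obc x y) (if y > 0 then {Ec x (y - 1)} else {})"
    using x y by (cases y) (auto simp: cylinder_def elim: band_arcs.cases)
  have "(x - 1) mod int N + 1 \<ge> 0" "((x - 1) mod int N + 1) mod int N = x"
    using x mod_pred_iff[of x N "(x - 1) mod int N"] by auto
  then show "{e \<in> arcs (cylinder m N). wrap N (snd e) = VOmega Corner_b x y} = {Oab x y, Eb ((x - 1) mod int N) y}"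
    using x y by (auto simp: cylinder_def mod_pred_iff elim: band_arcs.cases)
qed

end

lemma finite_arcs_cylinder: "finite (arcs (cylinder m N))"
proof (rule finite_subset)
  show "arcs (cylinder m N) \<subseteq> (\<Union>x\<in>{0..<int N}. col_arcs m x)"
    by (auto simp: cylinder_def col_arcs_def)
qed (simp add: finite_col_arcs)

lemma band_arc_ends:
  assumes "e \<in> band_arcs m"
  shows "ypos (fst e) < m" "ypos (snd e) < m"
  using assms by (cases e; auto elim: band_arcs.cases)+

lemma wrap_in_cylinder:
  assumes "N > 0" "ypos v < m"
  shows "wrap N v \<in> verts (cylinder m N)"
  using assms by (cases v) (auto simp: cylinder_def)

text \<open>At z = 1 the z-edges carry no special factor. Grouping arcs by their other end turns row
  u into outgoing minus incoming arcs, which avoids evaluating individual matrix entries.\<close>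

lemma sum_kasteleyn_entry:
  fixes g :: "vertex \<Rightarrow> real"
  assumes "n > 0"
  shows "(\<Sum>v\<in>verts (cylinder m n). kasteleyn_entry m n W 1 u v * of_real (g v))
    = of_real ((\<Sum>e\<in>{e \<in> arcs (cylinder m n). fst e = u}. W e * g (wrap n (snd e)))
     - (\<Sum>e\<in>{e \<in> arcs (cylinder m n). wrap n (snd e) = u}. W e * g (fst e)))"
proof -
  let ?A = "arcs (cylinder m n)" and ?V = "verts (cylinder m n)"
  let ?O = "{e \<in> ?A. fst e = u}" and ?I = "{e \<in> ?A. wrap n (snd e) = u}"
  have V: "finite ?V" by (metis List.finite_set set_vertex_list)
  have th: "tail (cylinder m n) = fst" "head (cylinder m n) = (\<lambda>e. wrap n (snd e))"
    by (simp_all add: cylinder_def)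
  have OI: "(\<lambda>e. wrap n (snd e)) ` ?O \<subseteq> ?V" "fst ` ?I \<subseteq> ?V"
    using wrap_in_cylinder[OF assms] band_arc_ends
    by (fastforce simp: cylinder_def)+
  have "(\<Sum>v\<in>?V. (\<Sum>e | e \<in> ?A \<and> fst e = u \<and> wrap n (snd e) = v. W e) * g v)
      = (\<Sum>v\<in>?V. \<Sum>e\<in>{e \<in> ?O. wrap n (snd e) = v}. W e * g (wrap n (snd e)))"
    by (intro sum.cong) (auto simp: sum_distrib_right intro!: sum.cong)
  also have "\<dots> = (\<Sum>e\<in>?O. W e * g (wrap n (snd e)))"
    by (rule sum.group[OF _ V OI(1)]) (simp add: finite_arcs_cylinder)
  finally have 1: "(\<Sum>v\<in>?V. (\<Sum>e | e \<in> ?A \<and> fst e = u \<and> wrap n (snd e) = v. W e) * g v)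
      = (\<Sum>e\<in>?O. W e * g (wrap n (snd e)))" .
  have "(\<Sum>v\<in>?V. (\<Sum>e | e \<in> ?A \<and> fst e = v \<and> wrap n (snd e) = u. W e) * g v)
      = (\<Sum>v\<in>?V. \<Sum>e\<in>{e \<in> ?I. fst e = v}. W e * g (fst e))"
    by (intro sum.cong) (auto simp: sum_distrib_right intro!: sum.cong)
  also have "\<dots> = (\<Sum>e\<in>?I. W e * g (fst e))"
    by (rule sum.group[OF _ V OI(2)]) (simp add: finite_arcs_cylinder)
  finally have 2: "(\<Sum>v\<in>?V. (\<Sum>e | e \<in> ?A \<and> fst e = v \<and> wrap n (snd e) = u. W e) * g v)
      = (\<Sum>e\<in>?I. W e * g (fst e))" .
  have "kasteleyn_entry m n W 1 u v = of_real ((\<Sum>e | e \<in> ?A \<and> fst e = u \<and> wrap n (snd e) = v. W e)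
     - (\<Sum>e | e \<in> ?A \<and> fst e = v \<and> wrap n (snd e) = u. W e))" for v
    by (simp add: kasteleyn_entry_def Let_def th cong: if_cong)
  then have "(\<Sum>v\<in>?V. kasteleyn_entry m n W 1 u v * of_real (g v))
     = of_real (\<Sum>v\<in>?V. (\<Sum>e | e \<in> ?A \<and> fst e = u \<and> wrap n (snd e) = v. W e) * g v
     - (\<Sum>e | e \<in> ?A \<and> fst e = v \<and> wrap n (snd e) = u. W e) * g v)"
    by (simp add: left_diff_distrib)
  then show ?thesis unfolding sum_subtractf 1 2 .
qed

text \<open>K(1) has real entries, so a real null vector suffices. The kernel condition is a balance
  over arcs, the form in which the column relations deliver it.\<close>

lemma char_P_1_eq_0I:
  fixes g :: "vertex \<Rightarrow> real"
  assumes "n > 0"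
    and ker: "\<And>u. u \<in> verts (cylinder m n) \<Longrightarrow>
      (\<Sum>e\<in>{e \<in> arcs (cylinder m n). fst e = u}. W e * g (wrap n (snd e)))
      = (\<Sum>e\<in>{e \<in> arcs (cylinder m n). wrap n (snd e) = u}. W e * g (fst e))"
    and nz: "v \<in> verts (cylinder m n)" "g v \<noteq> 0"
  shows "char_P m n W 1 = 0"
proof -
  let ?N = "6 * m * n"
  let ?K = "kasteleyn_matrix m n W 1"
  define gv where "gv = vec ?N (\<lambda>i. complex_of_real (g (vertex_list m n ! i)))"
  have bij: "bij_betw (\<lambda>i. vertex_list m n ! i) {..<?N} (verts (cylinder m n))"
    using bij_betw_nth[OF distinct_vertex_list] by (simp add: length_vertex_list set_vertex_list)
  have "?K *\<^sub>v gv = 0\<^sub>v ?N"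
  proof (intro eq_vecI)
    fix i assume "i < dim_vec (0\<^sub>v ?N :: complex vec)"
    then have i: "i < ?N" by simp
    then have u: "vertex_list m n ! i \<in> verts (cylinder m n)"
      using bij by (auto dest: bij_betwE)
    have "(?K *\<^sub>v gv) $ i = (\<Sum>j<?N. kasteleyn_entry m n W 1 (vertex_list m n ! i) (vertex_list m n ! j)
        * of_real (g (vertex_list m n ! j)))"
      using i by (simp add: kasteleyn_matrix_def gv_def scalar_prod_def atLeast0LessThan)
    also have "\<dots> = (\<Sum>v\<in>verts (cylinder m n). kasteleyn_entry m n W 1 (vertex_list m n ! i) v * of_real (g v))"
      by (rule sum.reindex_bij_betw[OF bij])
    also have "\<dots> = 0"
      unfolding sum_kasteleyn_entry[OF assms(1)] ker[OF u] by simp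
    finally show "(?K *\<^sub>v gv) $ i = 0\<^sub>v ?N $ i" using i by simp
  qed (simp add: kasteleyn_matrix_def)
  moreover have "gv \<noteq> 0\<^sub>v ?N"
  proof
    assume z: "gv = 0\<^sub>v ?N"
    have "v \<in> (\<lambda>i. vertex_list m n ! i) ` {..<?N}"
      using nz(1) by (simp only: bij_betw_imp_surj_on[OF bij])
    then obtain i where i: "i < ?N" "vertex_list m n ! i = v" by auto
    have "gv $ i = 0" using i(1) by (simp add: z)
    then show False using i nz(2) by (simp add: gv_def)
  qed
  moreover have "gv \<in> carrier_vec ?N" "?K \<in> carrier_mat ?N ?N"
    by (simp_all add: gv_def kasteleyn_matrix_def)
  ultimately show ?thesis
    unfolding char_P_def using det_0_iff_vec_prod_zero by blast
qed

text \<open>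
  The defect function between left and right boundary vectors that are multiplied by inverse factors
  along one period is a null vector of \<open>K(1)\<close>. The circumference is even because the sign of the
  defect alternates from column to column.
\<close>

lemma char_P_1_eq_0_of_boundary_vectors:
  fixes L R :: "int \<Rightarrow> nat set \<Rightarrow> real"
  assumes m: "m \<ge> 1" and n: "n > 0" "even n"
    and L: "\<And>x S'. 0 \<le> x \<Longrightarrow> x < int n \<Longrightarrow> S' \<in> states m \<Longrightarrow>
      (\<Sum>S\<in>states m. L x S * transfer_weight m W x S S') = L (x + 1) S'"
    and R: "\<And>x S. 0 \<le> x \<Longrightarrow> x < int n \<Longrightarrow> S \<in> states m \<Longrightarrow>
      (\<Sum>S'\<in>states m. transfer_weight m W x S S' * R (x + 1) S') = R x S"
    and per: "\<And>S S'. S \<in> states m \<Longrightarrow> S' \<in> states m \<Longrightarrow> L (int n) S * R (int n) S' = L 0 S * R 0 S'"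
    and nonneg: "\<And>S. S \<in> states m \<Longrightarrow> L (int n) S \<ge> 0" "\<And>S. S \<in> states m \<Longrightarrow> R (int n) S \<ge> 0"
    and pos: "L (int n) {0} > 0" "R (int n) {} > 0"
  shows "char_P m n W 1 = 0"
proof (rule char_P_1_eq_0I[OF n(1)])
  let ?f = "monomer m W L R"
  have "W (Eb (int n - 1) 0) * ?f (VBeta Corner_b (int n - 1) 0)
      = (-1) ^ nat (int n - 1) * flip_out m L R (int n) 0"
    using monomer_beta_b[where y = 0 and m = m and L = L and W = W and x = "int n - 1" and R = R] L[of "int n - 1"] n m by simp
  moreover have "flip_out m L R (int n) 0 > 0"
  proof -
    \<comment> \<open>At height 0 the sign \<open>sign_below\<close> is 1. All terms are
      nonnegative, and the one of the empty state is \<open>L (int n) {0} * R (int n) {}\<close>,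
      which is positive.\<close>
    define h where "h S = of_bool (0 \<notin> S) * (sign_below S 0 * L (int n) (insert 0 S) * R (int n) S)" for S
    have "h S \<ge> 0" if "S \<in> states m" for S
    proof -
      have "insert 0 S \<in> states m" using that m by auto
      then show ?thesis using nonneg that by (simp add: h_def sign_below_def)
    qed
    then have "h {} \<le> sum h (states m)"
      by (intro member_le_sum) auto
    moreover have "0 < h {}" using pos by (simp add: h_def sign_below_def)
    ultimately show ?thesis by (simp add: flip_out_def h_def del: sum_of_bool_mult_eq)
  qed
  ultimately show "?f (VBeta Corner_b (int n - 1) 0) \<noteq> 0" by auto
  show "VBeta Corner_b (int n - 1) 0 \<in> verts (cylinder m n)"
    using m n by (simp add: cylinder_def)
next
  let ?f = "monomer m W L R"
  fix u assume u: "u \<in> verts (cylinder m n)"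
  \<comment> \<open>Neither boundary vector is periodic alone; the boundary sums involve only
    products of the two.\<close>
  have per_in: "flip_in m L R (int n) y = flip_in m L R 0 y" if "y < m" for y
  proof -
    have "L (int n) S * R (int n) (insert y S) = L 0 S * R 0 (insert y S)" if "S \<in> states m" for S
      using that \<open>y < m\<close> by (intro per) auto
    then show ?thesis by (simp add: flip_in_def mult.assoc del: sum_of_bool_mult_eq)
  qed
  have per_out: "flip_out m L R (int n) y = flip_out m L R 0 y" if "y < m" for y
  proof -
    have "L (int n) (insert y S) * R (int n) S = L 0 (insert y S) * R 0 S" if "S \<in> states m" for S
      using that \<open>y < m\<close> by (intro per) auto
    then show ?thesis by (simp add: flip_out_def mult.assoc del: sum_of_bool_mult_eq)
  qed
  show "(\<Sum>e\<in>{e \<in> arcs (cylinder m n). fst e = u}. W e * ?f (wrap n (snd e)))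
      = (\<Sum>e\<in>{e \<in> arcs (cylinder m n). wrap n (snd e) = u}. W e * ?f (fst e))"
  proof (cases u rule: vertex_cases)
    case (ba x y)
    then have xy: "0 \<le> x" "x < int n" "y < m" using u by (auto simp: cylinder_def)
    have "W (Bab x y) * ?f (VBeta Corner_b x y) - W (Bca x y) * ?f (VBeta Corner_c x y)
        = - W (Ea x y) * ?f (VOmega Corner_a x y)"
      by (rule monomer_three) (simp_all add: row_beta_a[OF xy(3)])
    then show ?thesis
      using xy by (simp add: ba cylinder_out_arcs[OF xy] cylinder_in_arcs[OF xy])
  next
    case (bc x y)
    then have xy: "0 \<le> x" "x < int n" "y < m" using u by (auto simp: cylinder_def)
    have "W (Bca x y) * ?f (VBeta Corner_a x y) - W (Bbc x y) * ?f (VBeta Corner_b x y)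
        = (if Suc y < m then - W (Ec x y) else 0) * ?f (VOmega Corner_c x (Suc y))"
      by (rule monomer_three) (simp_all add: row_beta_c[OF xy(3)])
    then show ?thesis
      using xy by (auto simp: bc cylinder_out_arcs[OF xy] cylinder_in_arcs[OF xy] split: if_splits)
  next
    case (oa x y)
    then have xy: "0 \<le> x" "x < int n" "y < m" using u by (auto simp: cylinder_def)
    have "W (Oab x y) * ?f (VOmega Corner_b x y) - W (Oca x y) * ?f (VOmega Corner_c x y)
        = W (Ea x y) * ?f (VBeta Corner_a x y)"
      by (rule monomer_three) (simp_all add: row_omega_a[OF xy(3)])
    then show ?thesis
      using xy by (simp add: oa cylinder_out_arcs[OF xy] cylinder_in_arcs[OF xy])
  next
    case (oc x y)
    then have xy: "0 \<le> x" "x < int n" "y < m" using u by (auto simp: cylinder_def)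
    have "W (Oca x y) * ?f (VOmega Corner_a x y) - W (Obc x y) * ?f (VOmega Corner_b x y)
        = (if y > 0 then W (Ec x (y - 1)) else 0) * ?f (VBeta Corner_c x (y - 1))"
      by (rule monomer_three) (simp_all add: row_omega_c[OF xy(3)])
    then show ?thesis
      using xy by (auto simp: oc cylinder_out_arcs[OF xy] cylinder_in_arcs[OF xy] split: if_splits)
  next
    case (bb x y)
    then have xy: "0 \<le> x" "x < int n" "y < m" using u by (auto simp: cylinder_def)
    have "W (Bbc x y) * ?f (VBeta Corner_c x y) - W (Bab x y) * ?f (VBeta Corner_a x y)
        = - ((-1) ^ nat x * (W (Eb x y) * flip_in m L R (x + 1) y))"
      using xy by (intro monomer_row_beta_b L) auto
    moreover have "?f (wrap n (VOmega Corner_b (x + 1) y)) = (-1) ^ nat x * flip_in m L R (x + 1) y"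
    proof (cases "x + 1 = int n")
      case True
      \<comment> \<open>At the seam the sign jumps from (-1)^(n-1) to (-1)^0. Evenness of n makes
        this the same change of sign as between neighbouring columns.\<close>
      have "odd (nat x)" using True n xy by (metis even_Suc nat_int Suc_nat_eq_nat_zadd1 add.commute)
      moreover have "wrap n (VOmega Corner_b (x + 1) y) = VOmega Corner_b 0 y"
        using True by simp
      ultimately show ?thesis
        using monomer_omega_b[OF xy(3), where W = W and x = 0 and R = R and L = L] R[of 0] n per_in[OF xy(3)] unfolding True by simp
    next
      case False
      then have "wrap n (VOmega Corner_b (x + 1) y) = VOmega Corner_b (x + 1) y"
        using xy by simp
      moreover have "(-1::real) ^ nat (x + 1) = - ((-1) ^ nat x)"
        using xy by (simp add: nat_add_distrib)
      ultimately show ?thesis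
        using monomer_omega_b[OF xy(3), where W = W and x = "x + 1" and R = R and L = L] R[of "x + 1"] xy False by simp
    qed
    moreover have "wrap n (VBeta Corner_c x y) = VBeta Corner_c x y"
      using xy by simp
    ultimately show ?thesis
      by (simp add: bb cylinder_out_arcs[OF xy] cylinder_in_arcs[OF xy] mult_ac del: wrap.simps)
  next
    case (ob x y)
    then have xy: "0 \<le> x" "x < int n" "y < m" using u by (auto simp: cylinder_def)
    define x' where "x' = (x - 1) mod int n"
    have x': "0 \<le> x'" "x' < int n" using n by (auto simp: x'_def)
    have "W (Obc x y) * ?f (VOmega Corner_c x y) - W (Oab x y) * ?f (VOmega Corner_a x y)
        = - ((-1) ^ nat x * flip_out m L R x y)"
      using xy by (intro monomer_row_omega_b R) auto
    moreover have "W (Eb x' y) * ?f (VBeta Corner_b x' y) = (-1) ^ nat x' * flip_out m L R (x' + 1) y"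
      using xy x' by (intro monomer_beta_b L) auto
    moreover have "(-1) ^ nat x' * flip_out m L R (x' + 1) y = - ((-1) ^ nat x * flip_out m L R x y)"
    proof (cases "x = 0")
      case True
      then have "x' = int n - 1" using n by (simp add: x'_def zmod_minus1)
      moreover from this have "odd (nat x')" using n by (simp add: nat_diff_distrib')
      ultimately show ?thesis using True per_out[OF xy(3)] by simp
    next
      case False
      then have "x' = x - 1" using xy by (simp add: x'_def)
      moreover from this have "(-1::real) ^ nat x' = - ((-1) ^ nat x)"
      proof -
        have "nat x = Suc (nat x')" using \<open>x' = x - 1\<close> xy False by simp
        then show ?thesis by simp
      qed
      ultimately show ?thesis by simp
    qed
    ultimately show ?thesis
      using xy by (simp add: ob cylinder_out_arcs[OF xy] cylinder_in_arcs[OF xy] flip: x'_def)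
  qed
qed

section \<open>Transfer matrices for cylinders\<close>

text \<open>S supplies the bits entering column 0. At x = N the value is the outgoing state of a
  strip of N columns; for N = 0 it is S itself, as an identity matrix requires.\<close>

definition left_state :: "nat set \<Rightarrow> edge set \<Rightarrow> int \<Rightarrow> nat set" where
  "left_state S D x = (if x = 0 then S else right_state D (x - 1))"

definition strip_arcs :: "nat \<Rightarrow> nat \<Rightarrow> edge set" where
  "strip_arcs m N = {e \<in> band_arcs m. 0 \<le> xpos (fst e) \<and> xpos (fst e) < int N}"

definition strip :: "nat \<Rightarrow> nat \<Rightarrow> nat set \<Rightarrow> nat set \<Rightarrow> edge set set" where
  "strip m N S S' = {D. D \<subseteq> strip_arcs m N \<and> left_state S D (int N) = S' \<and>
     (\<forall>u. 0 \<le> xpos u \<longrightarrow> xpos u < int N \<longrightarrow> ypos u < m \<longrightarrow> vdeg (left_state S D (xpos u)) D u = 1)}"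

text \<open>The transfer matrix of a column in which the edges of F are forced to be present. It
  turns the probability of F into a product with a few altered factors.\<close>

definition transfer_weight_on :: "nat \<Rightarrow> (edge \<Rightarrow> real) \<Rightarrow> edge set \<Rightarrow> int \<Rightarrow> nat set \<Rightarrow> nat set \<Rightarrow> real" where
  "transfer_weight_on m W F x S S' = (\<Sum>M | M \<in> column_configs m x S S' (\<lambda>_. 1) \<and> F \<inter> col_arcs m x \<subseteq> M. prod W M)"

lemma transfer_weight_on_empty: "transfer_weight_on m W {} = transfer_weight m W"
  by (intro ext) (simp add: transfer_weight_on_def column_weight_def)

lemma transfer_weight_on_cong:
  assumes "F \<inter> col_arcs m x = F' \<inter> col_arcs m x"
  shows "transfer_weight_on m W F x = transfer_weight_on m W F' x"
  unfolding transfer_weight_on_def assms ..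

lemma vdeg_cong:
  assumes "\<And>e. xpos (fst e) = xpos u \<Longrightarrow> e \<in> D \<longleftrightarrow> e \<in> D'"
  shows "vdeg S D u = vdeg S D' u"
  using assms by (cases u rule: vertex_cases) simp_all

lemma right_state_cong:
  assumes "\<And>e. xpos (fst e) = x \<Longrightarrow> e \<in> D \<longleftrightarrow> e \<in> D'"
  shows "right_state D x = right_state D' x"
  using assms by (simp add: right_state_def)

lemma right_state_states: "D \<subseteq> band_arcs m \<Longrightarrow> right_state D x \<in> states m"
  by (auto simp: right_state_def)

lemma finite_strip_arcs: "finite (strip_arcs m N)"
  using finite_arcs_cylinder[of m N] by (simp add: strip_arcs_def cylinder_def)

lemma strip_arcs_Suc: "strip_arcs m (Suc N) = strip_arcs m N \<union> col_arcs m (int N)"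
  by (auto simp: strip_arcs_def col_arcs_def)

lemma strip_arcs_disjoint: "strip_arcs m N \<inter> col_arcs m (int N) = {}"
  by (auto simp: strip_arcs_def col_arcs_def)

lemma finite_strip: "finite (strip m N S S')"
  by (rule finite_subset[of _ "Pow (strip_arcs m N)"]) (auto simp: strip_def finite_strip_arcs)

lemma strip_0: "strip m 0 S S' = (if S = S' then {{}} else {})"
  by (auto simp: strip_def left_state_def strip_arcs_def)

text \<open>The degree of a vertex depends only on its own column and the state to the left of it,
  so the conditions on a longer strip separate into those on the shorter one and on the last
  column.\<close>

lemma strip_union:
  assumes D: "D \<subseteq> strip_arcs m N" and M: "M \<subseteq> col_arcs m (int N)"
  shows "D \<union> M \<in> strip m (Suc N) S S' \<longleftrightarrow>
    (D \<in> strip m N S (left_state S D (int N)) \<and> M \<in> column_configs m (int N) (left_state S D (int N)) S' (\<lambda>_. 1))"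
proof -
  have mem: "e \<in> D \<union> M \<longleftrightarrow> e \<in> D" if "xpos (fst e) < int N" for e
    using that M by (auto simp: col_arcs_def)
  have memN: "e \<in> D \<union> M \<longleftrightarrow> e \<in> M" if "xpos (fst e) = int N" for e
    using that D by (auto simp: strip_arcs_def)
  have lb: "left_state S (D \<union> M) x = left_state S D x" if "x \<le> int N" for x
  proof (cases "x = 0")
    case True
    then show ?thesis by (simp add: left_state_def)
  next
    case False
    have "right_state (D \<union> M) (x - 1) = right_state D (x - 1)"
      by (rule right_state_cong, rule mem) (use that in simp)
    then show ?thesis using False by (simp add: left_state_def)
  qed
  have lbN: "left_state S (D \<union> M) (int (Suc N)) = right_state M (int N)"
  proof -
    have "right_state (D \<union> M) (int N) = right_state M (int N)"
      by (rule right_state_cong, rule memN) simp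
    then show ?thesis by (simp add: left_state_def)
  qed
  have vd: "vdeg (left_state S (D \<union> M) (xpos u)) (D \<union> M) u = vdeg (left_state S D (xpos u)) D u"
    if "xpos u < int N" for u
    unfolding lb[OF less_imp_le[OF that]] by (rule vdeg_cong, rule mem) (use that in simp)
  have vdN: "vdeg (left_state S (D \<union> M) (xpos u)) (D \<union> M) u = vdeg (left_state S D (int N)) M u"
    if "xpos u = int N" for u
    unfolding lb[OF eq_refl[OF that]] unfolding that by (rule vdeg_cong, rule memN) (use that in simp)
  have A: "(\<forall>u. 0 \<le> xpos u \<longrightarrow> xpos u < int (Suc N) \<longrightarrow> ypos u < m \<longrightarrow> vdeg (left_state S (D \<union> M) (xpos u)) (D \<union> M) u = 1)
    \<longleftrightarrow> (\<forall>u. 0 \<le> xpos u \<longrightarrow> xpos u < int N \<longrightarrow> ypos u < m \<longrightarrow> vdeg (left_state S D (xpos u)) D u = 1)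
      \<and> (\<forall>u. xpos u = int N \<longrightarrow> ypos u < m \<longrightarrow> vdeg (left_state S D (int N)) M u = 1)"
    (is "?A \<longleftrightarrow> ?B \<and> ?C")
  proof (intro iffI conjI allI impI)
    fix u assume A: ?A and u: "0 \<le> xpos u" "xpos u < int N" "ypos u < m"
    then show "vdeg (left_state S D (xpos u)) D u = 1" using vd[of u] by force
  next
    fix u assume A: ?A and u: "xpos u = int N" "ypos u < m"
    then show "vdeg (left_state S D (int N)) M u = 1" using vdN[of u] by force
  next
    fix u assume A: "?B \<and> ?C" and u: "0 \<le> xpos u" "xpos u < int (Suc N)" "ypos u < m"
    show "vdeg (left_state S (D \<union> M) (xpos u)) (D \<union> M) u = 1"
    proof (cases "xpos u = int N")
      case True
      then show ?thesis using A u vdN[of u] by simp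
    next
      case False
      then show ?thesis using A u vd[of u] by simp
    qed
  qed
  have sub: "D \<union> M \<subseteq> strip_arcs m (Suc N)" using D M strip_arcs_Suc by blast
  show ?thesis
    unfolding strip_def column_configs_def mem_Collect_eq lbN A using D M sub by argo
qed

text \<open>The state between the strip and its last column is determined by the matching, so
  cutting there is a bijection; summing over this state is one step of a matrix product. Forced
  edges are distributed over the columns.\<close>

lemma sum_strip:
  assumes "S \<in> states m" "S' \<in> states m"
  shows "(\<Sum>D | D \<in> strip m N S S' \<and> F \<inter> strip_arcs m N \<subseteq> D. prod W D)
       = mprod (states m) (map (\<lambda>x. transfer_weight_on m W F (int x)) [0..<N]) S S'"
  using assms(2)
proof (induction N arbitrary: S')
  case 0
  have "strip_arcs m 0 = {}" by (auto simp: strip_arcs_def)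
  then show ?case by (simp add: strip_0)
next
  case (Suc N)
  let ?P = "\<lambda>S''. {D. D \<in> strip m N S S'' \<and> F \<inter> strip_arcs m N \<subseteq> D}"
  let ?Q = "\<lambda>S''. {M. M \<in> column_configs m (int N) S'' S' (\<lambda>_. 1) \<and> F \<inter> col_arcs m (int N) \<subseteq> M}"
  have fin: "finite (?P S'')" "finite (?Q S'')" for S''
    by (auto simp: finite_strip finite_column_configs)
  have cut: "(D \<inter> strip_arcs m N) \<union> (D \<inter> col_arcs m (int N)) = D" if "D \<subseteq> strip_arcs m (Suc N)" for D
    using that unfolding strip_arcs_Suc by blast
  have subs: "D \<subseteq> strip_arcs m N" if "D \<in> ?P S''" for D S''
    using that by (simp add: strip_def)
  have subM: "M \<subseteq> col_arcs m (int N)" if "M \<in> ?Q S''" for M S''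
    using that by (simp add: column_configs_def)
  have "(\<Sum>D | D \<in> strip m (Suc N) S S' \<and> F \<inter> strip_arcs m (Suc N) \<subseteq> D. prod W D)
      = (\<Sum>(S'', D, M)\<in>(SIGMA S'':states m. ?P S'' \<times> ?Q S''). prod W D * prod W M)"
  proof (rule sum.reindex_bij_witness[where
        j = "\<lambda>D. (left_state S (D \<inter> strip_arcs m N) (int N), D \<inter> strip_arcs m N, D \<inter> col_arcs m (int N))"
        and i = "\<lambda>(S'', D, M). D \<union> M"])
    fix D assume D: "D \<in> {D. D \<in> strip m (Suc N) S S' \<and> F \<inter> strip_arcs m (Suc N) \<subseteq> D}"
    then have sub: "D \<subseteq> strip_arcs m (Suc N)" by (simp add: strip_def)
    let ?D = "D \<inter> strip_arcs m N" and ?M = "D \<inter> col_arcs m (int N)"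
    show "(case (left_state S ?D (int N), ?D, ?M) of (S'', D, M) \<Rightarrow> D \<union> M) = D"
      using cut[OF sub] by simp
    have "?D \<in> strip m N S (left_state S ?D (int N)) \<and> ?M \<in> column_configs m (int N) (left_state S ?D (int N)) S' (\<lambda>_. 1)"
      by (subst strip_union[symmetric]) (use D cut[OF sub] in auto)
    moreover have "left_state S ?D (int N) \<in> states m"
      unfolding left_state_def using assms(1) right_state_states[of ?D m] by (auto simp: strip_arcs_def)
    moreover have "F \<inter> strip_arcs m N \<subseteq> ?D" "F \<inter> col_arcs m (int N) \<subseteq> ?M"
      using D unfolding strip_arcs_Suc by blast+
    ultimately show "(left_state S ?D (int N), ?D, ?M) \<in> (SIGMA S'':states m. ?P S'' \<times> ?Q S'')"
      by blast
    have "prod W D = prod W (?D \<union> ?M)" using cut[OF sub] by simp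
    also have "\<dots> = prod W ?D * prod W ?M"
      by (rule prod.union_disjoint) (use strip_arcs_disjoint in \<open>auto simp: finite_strip_arcs finite_col_arcs\<close>)
    finally show "(case (left_state S ?D (int N), ?D, ?M) of (S'', D, M) \<Rightarrow> prod W D * prod W M) = prod W D"
      by simp
  next
    fix t assume "t \<in> (SIGMA S'':states m. ?P S'' \<times> ?Q S'')"
    then obtain S'' D M where t: "t = (S'', D, M)" and S'': "S'' \<in> states m" "D \<in> ?P S''" "M \<in> ?Q S''"
      by blast
    have D: "D \<subseteq> strip_arcs m N" and M: "M \<subseteq> col_arcs m (int N)"
      using S'' by (auto simp: strip_def column_configs_def)
    have S: "left_state S D (int N) = S''" using S'' by (auto simp: strip_def)
    have eq: "(D \<union> M) \<inter> strip_arcs m N = D" "(D \<union> M) \<inter> col_arcs m (int N) = M"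
      using D M strip_arcs_disjoint[of m N] by blast+
    show "(case t of (S'', D, M) \<Rightarrow> D \<union> M) \<in> {D. D \<in> strip m (Suc N) S S' \<and> F \<inter> strip_arcs m (Suc N) \<subseteq> D}"
      using S'' strip_union[OF D M, of S S'] unfolding t S strip_arcs_Suc by auto
    show "(left_state S ((case t of (S'', D, M) \<Rightarrow> D \<union> M) \<inter> strip_arcs m N) (int N),
        (case t of (S'', D, M) \<Rightarrow> D \<union> M) \<inter> strip_arcs m N,
        (case t of (S'', D, M) \<Rightarrow> D \<union> M) \<inter> col_arcs m (int N)) = t"
      unfolding t by (simp add: eq S)
  qed
  also have "\<dots> = (\<Sum>S''\<in>states m. \<Sum>(D, M)\<in>?P S'' \<times> ?Q S''. prod W D * prod W M)"
    by (subst sum.Sigma) (use fin in \<open>auto intro!: finite_cartesian_product\<close>)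
  also have "\<dots> = (\<Sum>S''\<in>states m. (\<Sum>D\<in>?P S''. prod W D) * (\<Sum>M\<in>?Q S''. prod W M))"
    by (simp add: sum_product sum.cartesian_product)
  also have "\<dots> = (\<Sum>S''\<in>states m. mprod (states m) (map (\<lambda>x. transfer_weight_on m W F (int x)) [0..<N]) S S'' * transfer_weight_on m W F (int N) S'' S')"
    by (intro sum.cong refl) (simp only: Suc.IH transfer_weight_on_def[of m W F "int N"])
  also have "\<dots> = mprod (states m) (map (\<lambda>x. transfer_weight_on m W F (int x)) [0..<Suc N]) S S'"
    using mprod_snoc[OF finite_states assms(1) Suc.prems] by simp
  finally show ?case .
qed

section \<open>Perfect matchings of the cylinder as closed strips\<close>

lemma ex1_three:
  assumes "a \<noteq> b" "b \<noteq> c" "a \<noteq> c"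
  shows "(\<exists>!e. e \<in> D \<and> (e = a \<or> e = b \<or> e = c)) \<longleftrightarrow> of_bool (a \<in> D) + of_bool (b \<in> D) + of_bool (c \<in> D) = (1::nat)"
  using assms by (cases "a \<in> D"; cases "b \<in> D"; cases "c \<in> D") auto

lemma ex1_two:
  assumes "a \<noteq> b"
  shows "(\<exists>!e. e \<in> D \<and> (e = a \<or> e = b)) \<longleftrightarrow> of_bool (a \<in> D) + of_bool (b \<in> D) = (1::nat)"
  using assms by (cases "a \<in> D"; cases "b \<in> D") auto

text \<open>On the cylinder the edges entering column 0 come from column N - 1, so the strip
  description applies with the outgoing state of the last column as incoming state.\<close>

lemma matched_once_iff:
  assumes N: "N > 0" and D: "D \<subseteq> arcs (cylinder m N)" and u: "u \<in> verts (cylinder m N)"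
  shows "(\<exists>!e. e \<in> D \<and> incident (cylinder m N) e u)
    \<longleftrightarrow> vdeg (left_state (right_state D (int N - 1)) D (xpos u)) D u = 1"
proof -
  let ?A = "arcs (cylinder m N)"
  have inc: "(e \<in> D \<and> incident (cylinder m N) e u)
      \<longleftrightarrow> e \<in> D \<and> e \<in> {e \<in> ?A. fst e = u} \<union> {e \<in> ?A. wrap N (snd e) = u}" for e
    using D by (auto simp: incident_def cylinder_def)
  show ?thesis
    unfolding inc
  proof (cases u rule: vertex_cases)
    case (ba x y)
    then have xy: "0 \<le> x" "x < int N" "y < m" using u by (auto simp: cylinder_def)
    show "(\<exists>!e. e \<in> D \<and> e \<in> {e \<in> ?A. fst e = u} \<union> {e \<in> ?A. wrap N (snd e) = u})
      \<longleftrightarrow> vdeg (left_state (right_state D (int N - 1)) D (xpos u)) D u = 1"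
      using ex1_three[of "Bab x y" "Bca x y" "Ea x y" D]
      by (simp add: ba cylinder_out_arcs[OF xy] cylinder_in_arcs[OF xy] disj_ac)
  next
    case (bb x y)
    then have xy: "0 \<le> x" "x < int N" "y < m" using u by (auto simp: cylinder_def)
    show "(\<exists>!e. e \<in> D \<and> e \<in> {e \<in> ?A. fst e = u} \<union> {e \<in> ?A. wrap N (snd e) = u})
      \<longleftrightarrow> vdeg (left_state (right_state D (int N - 1)) D (xpos u)) D u = 1"
      using ex1_three[of "Bab x y" "Bbc x y" "Eb x y" D]
      by (simp add: bb cylinder_out_arcs[OF xy] cylinder_in_arcs[OF xy] disj_ac)
  next
    case (bc x y)
    then have xy: "0 \<le> x" "x < int N" "y < m" using u by (auto simp: cylinder_def)
    have "Ec x y \<notin> D" if "\<not> Suc y < m"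
      using that D by (auto simp: cylinder_def)
    then show "(\<exists>!e. e \<in> D \<and> e \<in> {e \<in> ?A. fst e = u} \<union> {e \<in> ?A. wrap N (snd e) = u})
      \<longleftrightarrow> vdeg (left_state (right_state D (int N - 1)) D (xpos u)) D u = 1"
      using ex1_three[of "Bbc x y" "Bca x y" "Ec x y" D] ex1_two[of "Bbc x y" "Bca x y" D]
      by (simp add: bc cylinder_out_arcs[OF xy] cylinder_in_arcs[OF xy] disj_ac)
  next
    case (oa x y)
    then have xy: "0 \<le> x" "x < int N" "y < m" using u by (auto simp: cylinder_def)
    show "(\<exists>!e. e \<in> D \<and> e \<in> {e \<in> ?A. fst e = u} \<union> {e \<in> ?A. wrap N (snd e) = u})
      \<longleftrightarrow> vdeg (left_state (right_state D (int N - 1)) D (xpos u)) D u = 1"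
      using ex1_three[of "Oab x y" "Oca x y" "Ea x y" D]
      by (simp add: oa cylinder_out_arcs[OF xy] cylinder_in_arcs[OF xy] disj_ac)
  next
    case (ob x y)
    then have xy: "0 \<le> x" "x < int N" "y < m" using u by (auto simp: cylinder_def)
    have "y \<in> left_state (right_state D (int N - 1)) D x \<longleftrightarrow> Eb ((x - 1) mod int N) y \<in> D"
    proof (cases "x = 0")
      case True
      then have "(x - 1) mod int N = int N - 1" using N by (simp add: zmod_minus1)
      then show ?thesis using True by (simp add: left_state_def right_state_def)
    next
      case False
      then show ?thesis using xy by (simp add: left_state_def right_state_def)
    qed
    then show "(\<exists>!e. e \<in> D \<and> e \<in> {e \<in> ?A. fst e = u} \<union> {e \<in> ?A. wrap N (snd e) = u})
      \<longleftrightarrow> vdeg (left_state (right_state D (int N - 1)) D (xpos u)) D u = 1"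
      using ex1_three[of "Oab x y" "Obc x y" "Eb ((x - 1) mod int N) y" D]
      by (simp add: ob cylinder_out_arcs[OF xy] cylinder_in_arcs[OF xy] disj_ac)
  next
    case (oc x y)
    then have xy: "0 \<le> x" "x < int N" "y < m" using u by (auto simp: cylinder_def)
    show "(\<exists>!e. e \<in> D \<and> e \<in> {e \<in> ?A. fst e = u} \<union> {e \<in> ?A. wrap N (snd e) = u})
      \<longleftrightarrow> vdeg (left_state (right_state D (int N - 1)) D (xpos u)) D u = 1"
    proof (cases y)
      case 0
      then show ?thesis
        using ex1_two[of "Obc x y" "Oca x y" D]
        by (simp add: oc cylinder_out_arcs[OF xy[unfolded 0]] cylinder_in_arcs[OF xy[unfolded 0]] disj_ac)
    next
      case (Suc k)
      then show ?thesis
        using ex1_three[of "Obc x y" "Oca x y" "Ec x k" D]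
        by (simp add: oc cylinder_out_arcs[OF xy[unfolded Suc]] cylinder_in_arcs[OF xy[unfolded Suc]] disj_ac)
    qed
  qed
qed

text \<open>S is the set of heights at which the matching crosses the seam. The matching determines
  it, hence the union is disjoint and weighted sums become traces.\<close>

lemma perfect_matchings_cylinder:
  assumes N: "N > 0"
  shows "perfect_matchings (cylinder m N) = (\<Union>S\<in>states m. strip m N S S)"
proof -
  have arcs: "arcs (cylinder m N) = strip_arcs m N"
    by (simp add: cylinder_def strip_arcs_def)
  have verts: "u \<in> verts (cylinder m N) \<longleftrightarrow> 0 \<le> xpos u \<and> xpos u < int N \<and> ypos u < m" for u
    by (auto simp: cylinder_def)
  have lbN: "left_state S D (int N) = right_state D (int N - 1)" for S D
    using N by (simp add: left_state_def)
  have iff: "D \<in> perfect_matchings (cylinder m N) \<longleftrightarrow> D \<in> strip m N (right_state D (int N - 1)) (right_state D (int N - 1))" for D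
  proof (cases "D \<subseteq> strip_arcs m N")
    case True
    then have "D \<in> perfect_matchings (cylinder m N) \<longleftrightarrow>
      (\<forall>u\<in>verts (cylinder m N). vdeg (left_state (right_state D (int N - 1)) D (xpos u)) D u = 1)"
      using matched_once_iff[OF N, of D m] by (simp add: perfect_matchings_def arcs)
    then show ?thesis using True by (simp add: strip_def lbN Ball_def verts imp_conjL)
  next
    case False
    then show ?thesis by (simp add: strip_def perfect_matchings_def arcs)
  qed
  show ?thesis
  proof (intro subset_antisym subsetI)
    fix D assume "D \<in> perfect_matchings (cylinder m N)"
    then have D: "D \<in> strip m N (right_state D (int N - 1)) (right_state D (int N - 1))"
      using iff by simp
    then have "right_state D (int N - 1) \<in> states m"
      by (intro right_state_states) (auto simp: strip_def strip_arcs_def)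
    then show "D \<in> (\<Union>S\<in>states m. strip m N S S)" using D by (rule UN_I)
  next
    fix D assume "D \<in> (\<Union>S\<in>states m. strip m N S S)"
    then obtain S where S: "D \<in> strip m N S S" by auto
    then have "S = right_state D (int N - 1)" by (simp add: strip_def lbN)
    then show "D \<in> perfect_matchings (cylinder m N)" using S iff[of D] by simp
  qed
qed

lemma sum_perfect_matchings_cylinder:
  assumes N: "N > 0" and F: "F \<subseteq> strip_arcs m N"
  shows "(\<Sum>D | D \<in> perfect_matchings (cylinder m N) \<and> F \<subseteq> D. prod W D)
       = mtrace (states m) (map (\<lambda>x. transfer_weight_on m W F (int x)) [0..<N])"
proof -
  have F': "F \<inter> strip_arcs m N = F" using F by blast
  have "{D. D \<in> perfect_matchings (cylinder m N) \<and> F \<subseteq> D}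
      = (\<Union>S\<in>states m. {D. D \<in> strip m N S S \<and> F \<inter> strip_arcs m N \<subseteq> D})"
    unfolding perfect_matchings_cylinder[OF N] F' by blast
  then have "(\<Sum>D | D \<in> perfect_matchings (cylinder m N) \<and> F \<subseteq> D. prod W D)
      = (\<Sum>S\<in>states m. \<Sum>D | D \<in> strip m N S S \<and> F \<inter> strip_arcs m N \<subseteq> D. prod W D)"
  proof (simp only:, intro sum.UNION_disjoint ballI impI)
    fix S S' :: "nat set" assume "S \<noteq> S'"
    moreover have "S = right_state D (int N - 1)" if "D \<in> strip m N S S" for D S
      using that N by (auto simp: strip_def left_state_def)
    ultimately show "{D. D \<in> strip m N S S \<and> F \<inter> strip_arcs m N \<subseteq> D}
        \<inter> {D. D \<in> strip m N S' S' \<and> F \<inter> strip_arcs m N \<subseteq> D} = {}"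
      by blast
  qed (simp_all add: finite_strip)
  also have "\<dots> = mtrace (states m) (map (\<lambda>x. transfer_weight_on m W F (int x)) [0..<N])"
    unfolding mtrace_def by (intro sum.cong refl sum_strip)
  finally show ?thesis .
qed

section \<open>Translations and the transfer matrix of a fundamental domain\<close>

lemma xpos_shift_edge [simp]: "xpos (fst (shift_edge k e)) = xpos (fst e) + k"
  by (cases "fst e") (simp_all add: shift_edge_def)

lemma shift_edge_band_arcs:
  assumes "e \<in> band_arcs m"
  shows "shift_edge k e \<in> band_arcs m"
proof -
  obtain x where "e \<in> col_arcs m x" using assms by (simp add: col_arcs_def)
  then show ?thesis
  proof (cases rule: col_arcs_cases)
    case (b y)
    then have "shift_edge k e = Eb (x + k) y" by (simp add: shift_edge_def)
    then show ?thesis using b by simp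
  qed (auto simp: shift_edge_def)
qed

lemma cylinder_edge_strip_arcs:
  assumes "e \<in> band_arcs m" "N > 0"
  shows "cylinder_edge N e \<in> strip_arcs m N"
  using assms shift_edge_band_arcs[of e m]
  by (simp add: cylinder_edge_def strip_arcs_def minus_mult_div_eq_mod)

lemma cylinder_prob_eq:
  assumes N: "N > 0" and F: "F \<subseteq> band_arcs m" and W: "\<And>e. e \<in> band_arcs m \<Longrightarrow> W e > 0"
  shows "cylinder_prob m N W F
    = mtrace (states m) (map (\<lambda>x. transfer_weight_on m W (cylinder_edge N ` F) (int x)) [0..<N])
      / mtrace (states m) (map (\<lambda>x. transfer_weight m W (int x)) [0..<N])"
proof -
  let ?PM = "perfect_matchings (cylinder m N)"
  let ?F = "cylinder_edge N ` F"
  have fin: "finite ?PM" 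
    unfolding perfect_matchings_cylinder[OF N] by (simp add: finite_strip)
  have Z: "partition_function (cylinder m N) W = mtrace (states m) (map (\<lambda>x. transfer_weight m W (int x)) [0..<N])"
    using sum_perfect_matchings_cylinder[OF N, of "{}" m W]
    by (simp add: partition_function_def transfer_weight_on_empty)
  have pos: "prod W D \<ge> 0" if "D \<in> ?PM" for D
  proof (rule prod_nonneg)
    fix e assume "e \<in> D"
    then have "e \<in> band_arcs m"
      using that by (auto simp: perfect_matchings_def cylinder_def)
    then show "W e \<ge> 0" using W by (simp add: less_imp_le)
  qed
  then have "partition_function (cylinder m N) W \<ge> 0"
    unfolding partition_function_def by (intro sum_nonneg) auto
  then have "cylinder_prob m N W F
      = (\<Sum>D\<in>{D \<in> ?PM. ?F \<subseteq> D}. prod W D / partition_function (cylinder m N) W)"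
    unfolding cylinder_prob_def dimer_measure_def
    using fin pos by (subst measure_point_measure_finite_if) auto
  also have "\<dots> = (\<Sum>D | D \<in> ?PM \<and> ?F \<subseteq> D. prod W D) / partition_function (cylinder m N) W"
    by (simp add: sum_divide_distrib)
  also have "(\<Sum>D | D \<in> ?PM \<and> ?F \<subseteq> D. prod W D) = mtrace (states m) (map (\<lambda>x. transfer_weight_on m W ?F (int x)) [0..<N])"
    by (rule sum_perfect_matchings_cylinder[OF N]) (use F cylinder_edge_strip_arcs[OF _ N] in auto)
  finally show ?thesis unfolding Z .
qed

lemma shift_shift [simp]: "shift j (shift k v) = shift (j + k) v"
  by (cases v) (auto simp: ac_simps)

lemma shift_0 [simp]: "shift 0 v = v"
  by (cases v) auto

lemma shift_edge_shift_edge [simp]: "shift_edge j (shift_edge k e) = shift_edge (j + k) e"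
  by (simp add: shift_edge_def)

lemma shift_edge_0 [simp]: "shift_edge 0 e = e"
  by (simp add: shift_edge_def)

lemma shift_edge_image_iff: "e \<in> shift_edge k ` M \<longleftrightarrow> shift_edge (- k) e \<in> M"
proof
  assume "shift_edge (- k) e \<in> M"
  then have "shift_edge k (shift_edge (- k) e) \<in> shift_edge k ` M" by (rule imageI)
  then show "e \<in> shift_edge k ` M" by simp
qed auto

lemma inj_shift_edge: "inj (shift_edge k)"
proof (rule injI)
  fix e e' assume "shift_edge k e = shift_edge k e'"
  then have "shift_edge (- k) (shift_edge k e) = shift_edge (- k) (shift_edge k e')" by simp
  then show "e = e'" by simp
qed

lemma shift_edge_band_arcs_iff [simp]: "shift_edge k e \<in> band_arcs m \<longleftrightarrow> e \<in> band_arcs m"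
  using shift_edge_band_arcs[of e m k] shift_edge_band_arcs[of "shift_edge k e" m "- k"] by auto

lemma col_arcs_shift: "shift_edge k e \<in> col_arcs m x \<longleftrightarrow> e \<in> col_arcs m (x - k)"
  by (auto simp: col_arcs_def)

lemma shift_edge_Eb: "shift_edge k (Eb x y) = Eb (x + k) y"
  by (simp add: shift_edge_def)

lemma pair_shift_edge_image_iff:
  "(u, v) \<in> shift_edge k ` M \<longleftrightarrow> (shift (- k) u, shift (- k) v) \<in> M"
  unfolding shift_edge_image_iff by (simp add: shift_edge_def)

lemma vdeg_shift: "vdeg S (shift_edge k ` M) u = vdeg S M (shift (- k) u)"
proof (cases u rule: vertex_cases)
  case (bb x y)
  have "Eb x y \<in> shift_edge k ` M \<longleftrightarrow> Eb (x - k) y \<in> M"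
    using shift_edge_Eb[of "- k" x y] by (simp add: shift_edge_image_iff)
  moreover have "Bab x y \<in> shift_edge k ` M \<longleftrightarrow> Bab (x - k) y \<in> M"
    "Bbc x y \<in> shift_edge k ` M \<longleftrightarrow> Bbc (x - k) y \<in> M"
    by (simp_all add: pair_shift_edge_image_iff)
  ultimately show ?thesis unfolding bb by simp
next
  case (oc x y)
  then show ?thesis by (cases y) (simp_all add: pair_shift_edge_image_iff)
qed (simp_all add: pair_shift_edge_image_iff)

lemma right_state_shift: "right_state (shift_edge k ` M) x = right_state M (x - k)"
  using shift_edge_Eb[of "- k" x] by (simp add: right_state_def shift_edge_image_iff)

lemma xpos_shift [simp]: "xpos (shift k u) = xpos u + k" and ypos_shift [simp]: "ypos (shift k u) = ypos u"
  by (cases u; simp)+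

lemma column_configs_shift:
  assumes "M \<in> column_configs m x S S' (\<lambda>_. 1)"
  shows "shift_edge k ` M \<in> column_configs m (x + k) S S' (\<lambda>_. 1)"
proof -
  have "shift_edge k ` M \<subseteq> col_arcs m (x + k)"
    using assms by (auto simp: column_configs_def col_arcs_shift)
  then show ?thesis
    using assms by (simp add: column_configs_def right_state_shift vdeg_shift)
qed

text \<open>The transfer matrix of one fundamental domain, columns 0 to n - 1, with the edges of F
  forced. Edges of F outside these columns have no effect, so a whole edge set can be passed without
  selecting its part first.\<close>

definition block :: "nat \<Rightarrow> nat \<Rightarrow> (edge \<Rightarrow> real) \<Rightarrow> edge set \<Rightarrow> nat set \<Rightarrow> nat set \<Rightarrow> real" where
  "block m n W F = mprod (states m) (map (\<lambda>x. transfer_weight_on m W F (int x)) [0..<n])"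

lemma block_cong:
  assumes "F \<inter> strip_arcs m n = F' \<inter> strip_arcs m n"
  shows "block m n W F = block m n W F'"
proof -
  have "transfer_weight_on m W F (int x) = transfer_weight_on m W F' (int x)" if "x < n" for x
  proof (rule transfer_weight_on_cong)
    have "col_arcs m (int x) \<subseteq> strip_arcs m n"
      using that by (auto simp: col_arcs_def strip_arcs_def)
    then show "F \<inter> col_arcs m (int x) = F' \<inter> col_arcs m (int x)" using assms by blast
  qed
  then have "map (\<lambda>x. transfer_weight_on m W F (int x)) [0..<n] = map (\<lambda>x. transfer_weight_on m W F' (int x)) [0..<n]"
    by simp
  then show ?thesis unfolding block_def by (rule arg_cong)
qed

lemma upt_mult: "[0..<l * n] = concat (map (\<lambda>j. map (\<lambda>x. j * n + x) [0..<n]) [0..<l])"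
proof (induction l)
  case 0
  then show ?case by simp
next
  case (Suc l)
  have "[0..<Suc l * n] = [0..<l * n] @ [l * n..<l * n + n]"
    using upt_add_eq_append[of 0 "l * n" n] by (simp add: add.commute)
  also have "[l * n..<l * n + n] = map (\<lambda>x. l * n + x) [0..<n]"
    by (rule nth_equalityI) auto
  finally show ?case using Suc by simp
qed

context
  fixes m n :: nat and W :: "edge \<Rightarrow> real"
  assumes per: "\<And>e. e \<in> band_arcs m \<Longrightarrow> W (shift_edge (int n) e) = W e"
begin

lemma weight_shift:
  assumes "e \<in> band_arcs m"
  shows "W (shift_edge (int n * j) e) = W e"
proof -
  have nat: "W (shift_edge (int n * int i) e) = W e" if "e \<in> band_arcs m" for i e
  proof (induction i)
    case 0
    then show ?case by simp
  next
    case (Suc i)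
    have "shift_edge (int n * int (Suc i)) e = shift_edge (int n) (shift_edge (int n * int i) e)"
      by (simp add: algebra_simps)
    then show ?case using per[of "shift_edge (int n * int i) e"] Suc that by simp
  qed
  show ?thesis
  proof (cases "j \<ge> 0")
    case True
    then show ?thesis using nat[OF assms, of "nat j"] by simp
  next
    case False
    then show ?thesis using nat[of "shift_edge (int n * j) e" "nat (- j)"] assms by simp
  qed
qed

text \<open>Translation by periods preserves weights and configurations, so moving the column
  amounts to moving the forced edges the other way.\<close>

lemma transfer_weight_on_shift:
  "transfer_weight_on m W F (x + int n * j) S S' = transfer_weight_on m W (shift_edge (- (int n * j)) ` F) x S S'"
proof -
  let ?k = "int n * j"
  have ins: "shift_edge (- ?k) ` (shift_edge ?k ` M) = M" "shift_edge ?k ` (shift_edge (- ?k) ` M) = M" for M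
    by (simp_all add: image_image)
  have prod: "prod W (shift_edge ?k ` M) = prod W M" if "M \<in> column_configs m x S S' (\<lambda>_. 1)" for M
  proof -
    have "prod W (shift_edge ?k ` M) = prod (\<lambda>e. W (shift_edge ?k e)) M"
      using inj_shift_edge by (subst prod.reindex) (auto simp: inj_on_def inj_def)
    also have "\<dots> = prod W M"
      using that by (intro prod.cong refl weight_shift) (auto simp: column_configs_def col_arcs_def)
    finally show ?thesis .
  qed
  have sub: "shift_edge (- ?k) ` F \<inter> col_arcs m x \<subseteq> M \<longleftrightarrow> F \<inter> col_arcs m (x + ?k) \<subseteq> shift_edge ?k ` M" for M
  proof -
    have "shift_edge (- ?k) ` (F \<inter> col_arcs m (x + ?k)) = shift_edge (- ?k) ` F \<inter> col_arcs m x"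
      by (auto simp: col_arcs_shift shift_edge_image_iff image_iff)
    then show ?thesis
      using shift_edge_image_iff by (metis (no_types, lifting) ins image_mono)
  qed
  show ?thesis
    unfolding transfer_weight_on_def
  proof (rule sum.reindex_bij_witness[where i = "\<lambda>M. shift_edge ?k ` M" and j = "\<lambda>M. shift_edge (- ?k) ` M"])
    fix M assume M: "M \<in> {M. M \<in> column_configs m (x + ?k) S S' (\<lambda>_. 1) \<and> F \<inter> col_arcs m (x + ?k) \<subseteq> M}"
    then show "shift_edge ?k ` shift_edge (- ?k) ` M = M" using ins by simp
    have "shift_edge (- ?k) ` M \<in> column_configs m x S S' (\<lambda>_. 1)"
      using column_configs_shift[of M m "x + ?k" S S' "- ?k"] M by simp
    then show "shift_edge (- ?k) ` M \<in> {M. M \<in> column_configs m x S S' (\<lambda>_. 1) \<and> shift_edge (- ?k) ` F \<inter> col_arcs m x \<subseteq> M}"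
      using M by (simp add: sub ins)
    then show "prod W (shift_edge (- ?k) ` M) = prod W M"
      using prod[of "shift_edge (- ?k) ` M"] by (simp add: ins)
  next
    fix M assume M: "M \<in> {M. M \<in> column_configs m x S S' (\<lambda>_. 1) \<and> shift_edge (- ?k) ` F \<inter> col_arcs m x \<subseteq> M}"
    then show "shift_edge (- ?k) ` shift_edge ?k ` M = M" using ins by simp
    show "shift_edge ?k ` M \<in> {M. M \<in> column_configs m (x + ?k) S S' (\<lambda>_. 1) \<and> F \<inter> col_arcs m (x + ?k) \<subseteq> M}"
      using M column_configs_shift by (simp add: sub)
  qed
qed

lemma mtrace_blocks:
  "mtrace (states m) (map (\<lambda>x. transfer_weight_on m W F (int x)) [0..<l * n])
   = mtrace (states m) (map (\<lambda>j. block m n W (shift_edge (- (int n * int j)) ` F)) [0..<l])"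
proof -
  have "transfer_weight_on m W F (int (j * n + x)) = transfer_weight_on m W (shift_edge (- (int n * int j)) ` F) (int x)" for j x
    using transfer_weight_on_shift[of F "int x" "int j"] by (intro ext) (simp add: mult.commute add.commute)
  then have "map (\<lambda>x. transfer_weight_on m W F (int x)) [0..<l * n]
      = concat (map (\<lambda>j. map (\<lambda>x. transfer_weight_on m W (shift_edge (- (int n * int j)) ` F) (int x)) [0..<n]) [0..<l])"
    unfolding upt_mult map_concat by (simp add: comp_def)
  then show ?thesis
    unfolding mtrace_def
    by (intro sum.cong) (simp_all add: mprod_concat comp_def block_def)
qed

text \<open>Division by l n is division by n followed by division by l. So the representative on the
  large cylinder is that on the fundamental domain, moved to its domain index modulo l.\<close>

lemma cylinder_edge_block:
  assumes "n > 0"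
  shows "cylinder_edge (l * n) e
    = shift_edge (int n * ((xpos (fst e) div int n) mod int l)) (cylinder_edge n e)"
proof -
  let ?x = "xpos (fst e)"
  have "int (l * n) = int n * int l" by simp
  then have "?x div int (l * n) = ?x div (int n * int l)" by (rule arg_cong)
  also have "\<dots> = ?x div int n div int l" by (rule zdiv_zmult2_eq) simp
  finally have "?x div int (l * n) = ?x div int n div int l" .
  moreover have aux: "- (int (l * n) * q) = int n * r + - (int n * c)" if "c = int l * q + r" for c q r
    using that by (simp add: algebra_simps)
  have "- (int (l * n) * (?x div int n div int l))
      = int n * ((?x div int n) mod int l) + - (int n * (?x div int n))"
    by (rule aux) simp
  ultimately show ?thesis unfolding cylinder_edge_def by simp
qed

text \<open>Translates of the fundamental domain by different multiples of n are disjoint; only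
  edges whose domain index is j modulo l land in columns 0 to n - 1, and there they become their
  representatives at circumference n.\<close>

lemma block_cylinder_edges:
  assumes n: "n > 0" and F: "F \<subseteq> band_arcs m" and l: "l > 0"
  shows "block m n W (shift_edge (- (int n * int j)) ` cylinder_edge (l * n) ` F)
       = block m n W (cylinder_edge n ` {e \<in> F. (xpos (fst e) div int n) mod int l = int j})"
proof (rule block_cong)
  have arc: "cylinder_edge n e \<in> strip_arcs m n" if "e \<in> F" for e
    using that F n by (intro cylinder_edge_strip_arcs) auto
  have "shift_edge (int n * i) f \<in> strip_arcs m n \<longleftrightarrow> i = 0" if f: "f \<in> strip_arcs m n" for i f
  proof
    assume "shift_edge (int n * i) f \<in> strip_arcs m n"
    then have "0 \<le> xpos (fst f) + int n * i" "xpos (fst f) + int n * i < int n"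
      by (auto simp: strip_arcs_def)
    then have "(xpos (fst f) + int n * i) div int n = 0" by simp
    moreover have "xpos (fst f) div int n = 0" using f by (simp add: strip_arcs_def)
    ultimately show "i = 0" using n by simp
  qed (use f in simp)
  then have *: "shift_edge (- (int n * int j)) (cylinder_edge (l * n) e) \<in> strip_arcs m n
      \<longleftrightarrow> (xpos (fst e) div int n) mod int l = int j" if "e \<in> F" for e
    using arc[OF that] unfolding cylinder_edge_block[OF n] shift_edge_shift_edge
    by (metis (no_types, opaque_lifting) add.commute diff_eq_eq right_diff_distrib' uminus_add_conv_diff add.left_neutral)
  have eq: "shift_edge (- (int n * int j)) (cylinder_edge (l * n) e) = cylinder_edge n e"
    if "(xpos (fst e) div int n) mod int l = int j" for e
    unfolding cylinder_edge_block[OF n] that by simp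
  show "shift_edge (- (int n * int j)) ` cylinder_edge (l * n) ` F \<inter> strip_arcs m n
      = cylinder_edge n ` {e \<in> F. (xpos (fst e) div int n) mod int l = int j} \<inter> strip_arcs m n"
  proof (intro subset_antisym subsetI)
    fix f assume "f \<in> shift_edge (- (int n * int j)) ` cylinder_edge (l * n) ` F \<inter> strip_arcs m n"
    then obtain e where e: "e \<in> F" "f = shift_edge (- (int n * int j)) (cylinder_edge (l * n) e)" "f \<in> strip_arcs m n"
      by auto
    then have "(xpos (fst e) div int n) mod int l = int j" using * by simp
    then show "f \<in> cylinder_edge n ` {e \<in> F. (xpos (fst e) div int n) mod int l = int j} \<inter> strip_arcs m n"
      using e eq by auto
  next
    fix f assume "f \<in> cylinder_edge n ` {e \<in> F. (xpos (fst e) div int n) mod int l = int j} \<inter> strip_arcs m n"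
    then obtain e where e: "e \<in> F" "(xpos (fst e) div int n) mod int l = int j" "f = cylinder_edge n e" "f \<in> strip_arcs m n"
      by auto
    then have "f = shift_edge (- (int n * int j)) (cylinder_edge (l * n) e)" using eq by simp
    then show "f \<in> shift_edge (- (int n * int j)) ` cylinder_edge (l * n) ` F \<inter> strip_arcs m n"
      using e by auto
  qed
qed

lemma cylinder_prob_blocks:
  assumes n: "n > 0" and F: "F \<subseteq> band_arcs m" and l: "l > 0" and W: "\<And>e. e \<in> band_arcs m \<Longrightarrow> W e > 0"
  shows "cylinder_prob m (l * n) W F
    = mtrace (states m) (map (\<lambda>j. block m n W (cylinder_edge n ` {e \<in> F. (xpos (fst e) div int n) mod int l = int j})) [0..<l])
      / mtrace (states m) (replicate l (block m n W {}))"
proof -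
  have "map (\<lambda>j. block m n W (shift_edge (- (int n * int j)) ` {})) [0..<l] = replicate l (block m n W {})"
    by (simp add: map_replicate_const)
  moreover have "l * n > 0" using n l by simp
  ultimately show ?thesis
    using mtrace_blocks[of "{}" l]
    by (simp add: cylinder_prob_eq[OF _ F W] mtrace_blocks block_cylinder_edges[OF n F l] transfer_weight_on_empty
        flip: transfer_weight_on_empty[of m W])
qed

end

section \<open>Limits of correlations\<close>

lemma map_upt_const:
  assumes "\<And>i. a \<le> i \<Longrightarrow> i < b \<Longrightarrow> f i = c"
  shows "map f [a..<b] = replicate (b - a) c"
  using assms by (intro replicate_eqI) auto

lemma upt_split:
  assumes "a \<le> j" "j < l"
  shows "[a..<l] = [a..<j] @ j # [Suc j..<l]"
  using assms upt_add_eq_append[of a j "l - j"] by (simp add: upt_conv_Cons)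

text \<open>From here on a defect is an altered factor of a matrix product, not an uncovered vertex.
  Cyclicity moves it to the front, so its position is irrelevant.\<close>

lemma mtrace_one_defect:
  assumes "finite I" "j < l"
  shows "mtrace I (map (\<lambda>i. if i = j then X else A) [0..<l]) = mtrace I (X # replicate (l - 1) A)"
proof -
  have "[0..<l] = [0..<j] @ j # [Suc j..<l]"
    using assms(2) by (intro upt_split) auto
  then have "map (\<lambda>i. if i = j then X else A) [0..<l] = replicate j A @ (X # replicate (l - Suc j) A)"
    by (simp add: map_upt_const)
  moreover have "(X # replicate (l - Suc j) A) @ replicate j A = X # replicate (l - 1) A"
    using assms(2) by (simp flip: replicate_add)
  ultimately show ?thesis
    using mtrace_append_commute[OF assms(1)] by metis
qed

lemma mtrace_two_defects_aux:
  assumes "finite I" "j1 + d < l" "d > 0"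
  shows "mtrace I (map (\<lambda>i. if i = j1 then X else if i = j1 + d then Y else A) [0..<l])
       = mtrace I (X # replicate (d - 1) A @ Y # replicate (l - 1 - d) A)"
proof -
  have "[0..<l] = [0..<j1] @ j1 # [Suc j1..<j1 + d] @ (j1 + d) # [Suc (j1 + d)..<l]"
    using assms upt_split[of 0 j1 l] upt_split[of "Suc j1" "j1 + d" l] by simp
  then have "map (\<lambda>i. if i = j1 then X else if i = j1 + d then Y else A) [0..<l]
      = replicate j1 A @ (X # replicate (d - 1) A @ Y # replicate (l - Suc (j1 + d)) A)"
    using assms(3) by (simp add: map_upt_const)
  moreover have "(X # replicate (d - 1) A @ Y # replicate (l - Suc (j1 + d)) A) @ replicate j1 A
      = X # replicate (d - 1) A @ Y # replicate (l - 1 - d) A"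
    using assms(2) by (simp flip: replicate_add)
  ultimately show ?thesis
    using mtrace_append_commute[OF assms(1)] by metis
qed

lemma mtrace_two_defects_swap:
  assumes "finite I"
  shows "mtrace I (X # replicate a A @ Y # replicate b A) = mtrace I (Y # replicate b A @ X # replicate a A)"
  using mtrace_append_commute[OF assms, of "X # replicate a A" "Y # replicate b A"] by simp

text \<open>Only the cyclic distance d from X to Y matters. If Y precedes X in the list, the
  complementary distance l - d is counted from Y, and one rotation exchanges the two.\<close>

lemma mtrace_two_defects:
  assumes "finite I" "j1 < l" "j2 < l" "0 < d" "d < l" "(int j2 - int j1) mod int l = int d"
  shows "mtrace I (map (\<lambda>i. if i = j1 then X else if i = j2 then Y else A) [0..<l])
       = mtrace I (X # replicate (d - 1) A @ Y # replicate (l - 1 - d) A)"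
proof (cases "j1 \<le> j2")
  case True
  then have "j2 = j1 + d" using assms by auto
  then show ?thesis
    using mtrace_two_defects_aux[OF assms(1), of j1 d l X Y A] assms(3,4) by metis
next
  case False
  have "(int j2 - int j1) mod int l = (int j2 - int j1 + int l) mod int l" by simp
  also have "\<dots> = int j2 - int j1 + int l" using False assms by (intro mod_pos_pos_trivial) auto
  finally have d: "int d = int j2 - int j1 + int l" using assms(6) by simp
  then have j1: "j1 = j2 + (l - d)" using assms by linarith
  have ne: "j1 \<noteq> j2" using False by simp
  have "(\<lambda>i. if i = j1 then X else if i = j2 then Y else A) = (\<lambda>i. if i = j2 then Y else if i = j2 + (l - d) then X else A)"
    unfolding j1[symmetric] using ne by (intro ext) auto
  moreover have "mtrace I (map (\<lambda>i. if i = j2 then Y else if i = j2 + (l - d) then X else A) [0..<l])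
      = mtrace I (Y # replicate (l - d - 1) A @ X # replicate (l - 1 - (l - d)) A)"
    using assms j1 by (intro mtrace_two_defects_aux) auto
  moreover have "l - 1 - (l - d) = d - 1" "l - d - 1 = l - 1 - d" using assms by auto
  ultimately show ?thesis
    using mtrace_two_defects_swap[OF assms(1)] by simp
qed

lemma mtrace2:
  assumes "finite I"
  shows "mtrace I [X, U] = (\<Sum>i\<in>I. \<Sum>k\<in>I. X i k * U k i)"
  unfolding mtrace_def mprod.simps(2)[of I X]
  using assms by (intro sum.cong refl) (simp add: mprod_single del: mprod.simps)

lemma mtrace4:
  assumes "finite I"
  shows "mtrace I [X, U, Y, V] = (\<Sum>i\<in>I. \<Sum>k\<in>I. X i k * (\<Sum>h\<in>I. U k h * (\<Sum>g\<in>I. Y h g * V g i)))"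
  unfolding mtrace_def mprod.simps(2)[of I X] mprod.simps(2)[of I U] mprod.simps(2)[of I Y]
  using assms by (intro sum.cong refl) (simp add: mprod_single del: mprod.simps)

lemma mtrace_replicate_1:
  assumes "finite I"
  shows "mtrace I (X # replicate l A) = mtrace I [X, mprod I (replicate l A)]"
  unfolding mtrace2[OF assms] by (simp add: mtrace_def)

lemma mtrace_replicate_2:
  assumes "finite I"
  shows "mtrace I (X # replicate a A @ Y # replicate b A)
    = mtrace I [X, mprod I (replicate a A), Y, mprod I (replicate b A)]"
  unfolding mtrace4[OF assms] by (simp add: mtrace_def mprod_append[OF assms])

text \<open>In the application P is the spectral projection for the dominant eigenvalue: of rank one
  if the parity classes have different Perron eigenvalues, of rank two otherwise. A positive trace
  is what makes the partition function grow exactly like \<Lambda>^l.\<close>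

locale convergent_powers =
  fixes I :: "'i set" and A :: "'i \<Rightarrow> 'i \<Rightarrow> real" and \<Lambda> :: real and P :: "'i \<Rightarrow> 'i \<Rightarrow> real" and C \<theta> :: real
  assumes I: "finite I" and Lam: "\<Lambda> > 0" and th: "0 \<le> \<theta>" "\<theta> < 1"
    and bound: "\<And>i j l. i \<in> I \<Longrightarrow> j \<in> I \<Longrightarrow> \<bar>mprod I (replicate l A) i j / \<Lambda> ^ l - P i j\<bar> \<le> C * \<theta> ^ l"
    and trace_pos: "(\<Sum>i\<in>I. P i i) > 0"
begin

definition "\<tau> = (\<Sum>i\<in>I. P i i)"

definition "Q l = (\<lambda>i j. mprod I (replicate l A) i j / \<Lambda> ^ l)"

lemma tau_pos: "\<tau> > 0"
  using trace_pos by (simp add: \<tau>_def)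

lemma Q_tendsto:
  assumes "i \<in> I" "j \<in> I"
  shows "(\<lambda>l. Q l i j) \<longlonglongrightarrow> P i j"
proof -
  have "(\<lambda>l. Q l i j - P i j) \<longlonglongrightarrow> 0"
  proof (rule Lim_null_comparison)
    show "\<forall>\<^sub>F l in sequentially. norm (Q l i j - P i j) \<le> C * \<theta> ^ l"
      using bound[OF assms] by (simp add: Q_def)
    show "(\<lambda>l. C * \<theta> ^ l) \<longlonglongrightarrow> 0"
      using th by (intro tendsto_mult_right_zero LIMSEQ_power_zero) simp
  qed
  then show ?thesis by (simp add: LIM_zero_iff)
qed

lemma trace_tendsto: "(\<lambda>l. mtrace I (replicate l A) / \<Lambda> ^ l) \<longlonglongrightarrow> \<tau>"
proof -
  have "(\<lambda>l. \<Sum>i\<in>I. Q l i i) \<longlonglongrightarrow> \<tau>"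
    unfolding \<tau>_def by (intro tendsto_sum Q_tendsto)
  then show ?thesis by (simp add: Q_def mtrace_def sum_divide_distrib)
qed

text \<open>The offset k is the number of factors of the numerator that do not belong to the growing
  power of A; the limit pays \<Lambda>^k for them.\<close>

lemma tendsto_ratio:
  assumes "(\<lambda>l. f (l + k) / \<Lambda> ^ l) \<longlonglongrightarrow> a"
  shows "(\<lambda>l. f l / mtrace I (replicate l A)) \<longlonglongrightarrow> a / (\<Lambda> ^ k * \<tau>)"
proof -
  have "(\<lambda>l. mtrace I (replicate (l + k) A) / \<Lambda> ^ (l + k)) \<longlonglongrightarrow> \<tau>"
    by (rule LIMSEQ_ignore_initial_segment[OF trace_tendsto])
  then have "(\<lambda>l. (f (l + k) / \<Lambda> ^ l) / (\<Lambda> ^ k * (mtrace I (replicate (l + k) A) / \<Lambda> ^ (l + k))))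
      \<longlonglongrightarrow> a / (\<Lambda> ^ k * \<tau>)"
    using tau_pos Lam by (intro tendsto_intros assms) auto
  moreover have "(f (l + k) / \<Lambda> ^ l) / (\<Lambda> ^ k * (mtrace I (replicate (l + k) A) / \<Lambda> ^ (l + k)))
      = f (l + k) / mtrace I (replicate (l + k) A)" for l
    using Lam by (simp add: power_add)
  ultimately show ?thesis by (simp add: LIMSEQ_offset)
qed

lemma one_defect_tendsto:
  "(\<lambda>l. mtrace I (X # replicate (l - 1) A) / mtrace I (replicate l A)) \<longlonglongrightarrow> mtrace I [X, P] / (\<Lambda> * \<tau>)"
proof -
  have "mtrace I (X # replicate l A) / \<Lambda> ^ l = mtrace I [X, Q l]" for l
    unfolding mtrace_replicate_1[OF I] mtrace2[OF I] by (simp add: Q_def sum_divide_distrib)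
  moreover have "(\<lambda>l. mtrace I [X, Q l]) \<longlonglongrightarrow> mtrace I [X, P]"
    unfolding mtrace2[OF I] by (intro tendsto_intros Q_tendsto)
  ultimately show ?thesis
    using tendsto_ratio[where f = "\<lambda>l. mtrace I (X # replicate (l - 1) A)" and k = 1] by simp
qed

lemma two_defects_tendsto:
  assumes "d > 0"
  shows "(\<lambda>l. mtrace I (X # replicate (d - 1) A @ Y # replicate (l - 1 - d) A) / mtrace I (replicate l A))
    \<longlonglongrightarrow> mtrace I [X, Q (d - 1), Y, P] / (\<Lambda>\<^sup>2 * \<tau>)"
proof -
  have eq: "mtrace I (X # replicate (d - 1) A @ Y # replicate l A) / \<Lambda> ^ l
      = \<Lambda> ^ (d - 1) * mtrace I [X, Q (d - 1), Y, Q l]" for l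
    unfolding mtrace_replicate_2[OF I] mtrace4[OF I] using Lam
    by (simp add: Q_def sum_divide_distrib sum_distrib_left)
  have "(\<lambda>l. \<Lambda> ^ (d - 1) * mtrace I [X, Q (d - 1), Y, Q l]) \<longlonglongrightarrow> \<Lambda> ^ (d - 1) * mtrace I [X, Q (d - 1), Y, P]"
    unfolding mtrace4[OF I] by (intro tendsto_intros Q_tendsto)
  then have "(\<lambda>l. mtrace I (X # replicate (d - 1) A @ Y # replicate (l - 1 - d) A) / mtrace I (replicate l A))
    \<longlonglongrightarrow> (\<Lambda> ^ (d - 1) * mtrace I [X, Q (d - 1), Y, P]) / (\<Lambda> ^ (d + 1) * \<tau>)"
    unfolding eq[symmetric]
    by (intro tendsto_ratio[where f = "\<lambda>l. mtrace I (X # replicate (d - 1) A @ Y # replicate (l - 1 - d) A)" and k = "d + 1"]) simp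
  moreover have "\<Lambda> ^ (d + 1) = \<Lambda> ^ (d - 1) * \<Lambda>\<^sup>2"
    using assms by (simp flip: power_add)
  ultimately show ?thesis using Lam by simp
qed

text \<open>The trace is linear in its second factor, so the entrywise rate of the powers carries
  over with a constant depending on X, Y and P only.\<close>

lemma two_defects_limit_bound:
  obtains K where "K \<ge> 0" "\<And>d. \<bar>mtrace I [X, Q d, Y, P] - mtrace I [X, P, Y, P]\<bar> \<le> K * \<theta> ^ d"
proof -
  define K where "K = (\<Sum>i\<in>I. \<Sum>k\<in>I. \<bar>X i k\<bar> * (\<Sum>h\<in>I. \<bar>C\<bar> * (\<Sum>g\<in>I. \<bar>Y h g\<bar> * \<bar>P g i\<bar>)))"
  have b: "\<bar>Q d k h - P k h\<bar> \<le> \<bar>C\<bar> * \<theta> ^ d" if "k \<in> I" "h \<in> I" for d k h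
  proof -
    have "C * \<theta> ^ d \<le> \<bar>C\<bar> * \<theta> ^ d" using th by (intro mult_right_mono) auto
    then show ?thesis using bound[OF that, of d] by (simp add: Q_def)
  qed
  have "\<bar>mtrace I [X, Q d, Y, P] - mtrace I [X, P, Y, P]\<bar> \<le> K * \<theta> ^ d" for d
  proof -
    have "mtrace I [X, Q d, Y, P] - mtrace I [X, P, Y, P]
       = (\<Sum>i\<in>I. \<Sum>k\<in>I. X i k * (\<Sum>h\<in>I. (Q d k h - P k h) * (\<Sum>g\<in>I. Y h g * P g i)))"
      unfolding mtrace4[OF I] by (simp add: left_diff_distrib right_diff_distrib sum_subtractf)
    also have "\<bar>\<dots>\<bar> \<le> (\<Sum>i\<in>I. \<Sum>k\<in>I. \<bar>X i k\<bar> * (\<Sum>h\<in>I. (\<bar>C\<bar> * \<theta> ^ d) * (\<Sum>g\<in>I. \<bar>Y h g\<bar> * \<bar>P g i\<bar>)))"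
      by (rule order_trans[OF sum_abs] sum_mono)+
        (auto simp: abs_mult intro!: mult_mono order_trans[OF sum_abs] sum_mono b sum_nonneg mult_nonneg_nonneg th zero_le_power)
    also have "\<dots> = K * \<theta> ^ d"
      unfolding K_def by (simp add: sum_distrib_left sum_distrib_right mult_ac)
    finally show ?thesis .
  qed
  moreover have "K \<ge> 0" unfolding K_def by (intro sum_nonneg mult_nonneg_nonneg) auto
  ultimately show ?thesis using that by blast
qed

end

section \<open>Decomposition into the two parity classes\<close>

definition parity_positive :: "nat \<Rightarrow> (nat set \<Rightarrow> nat set \<Rightarrow> real) \<Rightarrow> bool" where
  "parity_positive m A \<longleftrightarrow> (\<forall>S\<in>states m. \<forall>S'\<in>states m.
     if even (card S) = even (card S') then A S S' > 0 else A S S' = 0)"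

lemma parity_positiveD:
  assumes "parity_positive m A" "S \<in> states m" "S' \<in> states m"
  shows "even (card S) = even (card S') \<Longrightarrow> A S S' > 0" "even (card S) \<noteq> even (card S') \<Longrightarrow> A S S' = 0"
    "A S S' \<ge> 0"
proof -
  have "if even (card S) = even (card S') then A S S' > 0 else A S S' = 0"
    using assms unfolding parity_positive_def by blast
  then show "even (card S) = even (card S') \<Longrightarrow> A S S' > 0" "even (card S) \<noteq> even (card S') \<Longrightarrow> A S S' = 0"
    "A S S' \<ge> 0"
    by (auto split: if_splits)
qed

text \<open>Every transition that conserves parity is realised by an explicit configuration. A
  single column is thus already strictly positive on each class, and no question of irreducibility
  or aperiodicity arises.\<close>

lemma transfer_weight_parity_positive:
  assumes W: "\<And>e. e \<in> band_arcs m \<Longrightarrow> W e > 0"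
  shows "parity_positive m (transfer_weight m W x)"
  unfolding parity_positive_def
proof (intro ballI)
  fix S S' assume S: "S \<in> states m" "S' \<in> states m"
  show "if even (card S) = even (card S') then transfer_weight m W x S S' > 0 else transfer_weight m W x S S' = 0"
  proof (cases "even (card S) = even (card S')")
    case True
    have "column_configs m x S S' (\<lambda>_. 1) \<noteq> {}"
      using S True by (intro column_configs_nonempty) auto
    then have "0 < transfer_weight m W x S S'"
      unfolding column_weight_def using W
      by (intro sum_pos finite_column_configs) (auto intro!: prod_pos simp: column_configs_def col_arcs_def)
    then show ?thesis using True by simp
  next
    case False
    have "M \<notin> column_configs m x S S' (\<lambda>_. 1)" for M
    proof
      assume M: "M \<in> column_configs m x S S' (\<lambda>_. 1)"
      then have "M \<subseteq> band_arcs m"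
        by (auto simp: column_configs_def col_arcs_def)
      \<comment> \<open>No vertical edge leaves the top row, so \<open>parity_below\<close> at y = m
        compares the parities of the full states.\<close>
      moreover have "Ec x (m - 1) \<notin> band_arcs m" if "m > 0"
        using that by (simp only: band_arcs_iff)
      ultimately have "\<not> (m > 0 \<and> Ec x (m - 1) \<in> M)" by blast
      then have "(-1::real) ^ card S = (-1) ^ card S'"
        using parity_below[OF M, of m] S by (simp add: Int_absorb2)
      then show False using False by (simp add: minus_one_power_iff split: if_splits)
    qed
    then have "column_configs m x S S' (\<lambda>_. 1) = {}" by blast
    then show ?thesis using False by (simp add: column_weight_def)
  qed
qed

lemma parity_positive_mult:
  assumes "parity_positive m A" "parity_positive m B"
  shows "parity_positive m (\<lambda>S S'. \<Sum>T\<in>states m. A S T * B T S')"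
  unfolding parity_positive_def
proof (intro ballI)
  fix S S' assume S: "S \<in> states m" "S' \<in> states m"
  show "if even (card S) = even (card S') then (\<Sum>T\<in>states m. A S T * B T S') > 0
      else (\<Sum>T\<in>states m. A S T * B T S') = 0"
  proof (cases "even (card S) = even (card S')")
    case True
    have "0 < A S S' * B S' S'"
      using parity_positiveD(1)[OF assms(1) S True] parity_positiveD(1)[OF assms(2) S(2) S(2)] by simp
    also have "\<dots> \<le> (\<Sum>T\<in>states m. A S T * B T S')"
      using S parity_positiveD(3)[OF assms(1)] parity_positiveD(3)[OF assms(2)]
      by (intro member_le_sum) auto
    finally show ?thesis using True by simp
  next
    case False
    have "A S T * B T S' = 0" if "T \<in> states m" for T
      using False parity_positiveD(2)[OF assms(1) S(1) that] parity_positiveD(2)[OF assms(2) that S(2)]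
      by (cases "even (card S) = even (card T)") auto
    then have "(\<Sum>T\<in>states m. A S T * B T S') = 0"
      by (intro sum.neutral) blast
    then show ?thesis using False by (simp only: if_False)
  qed
qed

lemma parity_positive_cong:
  assumes "\<And>S S'. S \<in> states m \<Longrightarrow> S' \<in> states m \<Longrightarrow> A S S' = B S S'"
  shows "parity_positive m A = parity_positive m B"
  unfolding parity_positive_def using assms by simp

lemma parity_positive_mprod:
  assumes "As \<noteq> []" "\<And>A. A \<in> set As \<Longrightarrow> parity_positive m A"
  shows "parity_positive m (mprod (states m) As)"
  using assms
proof (induction As rule: list_nonempty_induct)
  case (single A)
  have "parity_positive m (mprod (states m) [A]) = parity_positive m A"
    by (rule parity_positive_cong) (simp add: mprod_single del: mprod.simps)
  then show ?case using single by simp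
next
  case (cons A As)
  have "parity_positive m (mprod (states m) As)" using cons by simp
  then show ?case
    using parity_positive_mult[of m A "mprod (states m) As"] cons by simp
qed

definition parity_class :: "nat \<Rightarrow> bool \<Rightarrow> nat set set" where
  "parity_class m p = {S \<in> states m. even (card S) = p}"

lemma sum_parity_class:
  fixes f :: "nat set \<Rightarrow> real"
  assumes "\<And>S. S \<in> states m \<Longrightarrow> even (card S) \<noteq> p \<Longrightarrow> f S = 0"
  shows "sum f (states m) = sum f (parity_class m p)"
  using assms by (intro sum.mono_neutral_right) (auto simp: parity_class_def)

lemma mprod_parity_class:
  assumes A: "parity_positive m A" and S: "S \<in> parity_class m p" and S': "S' \<in> parity_class m p"
  shows "mprod (states m) (replicate l A) S S' = mprod (parity_class m p) (replicate l A) S S'"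
  using S
proof (induction l arbitrary: S)
  case 0
  then show ?case by simp
next
  case (Suc l)
  have "mprod (states m) (replicate (Suc l) A) S S'
      = (\<Sum>T\<in>states m. A S T * mprod (states m) (replicate l A) T S')" by simp
  also have "\<dots> = (\<Sum>T\<in>parity_class m p. A S T * mprod (states m) (replicate l A) T S')"
    using Suc.prems parity_positiveD(2)[OF A, of S]
    by (intro sum_parity_class) (auto simp: parity_class_def)
  finally show ?case using Suc.IH by simp
qed

lemma mprod_parity_off:
  assumes A: "parity_positive m A" and S: "S \<in> states m" "S' \<in> states m" "even (card S) \<noteq> even (card S')"
  shows "mprod (states m) (replicate l A) S S' = 0"
proof (cases l)
  case 0
  then show ?thesis using S by auto
next
  case (Suc k)
  have "parity_positive m (mprod (states m) (replicate l A))"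
    using A Suc by (intro parity_positive_mprod) auto
  then show ?thesis using parity_positiveD(2) S by blast
qed

text \<open>Both classes have to be normalised by the larger eigenvalue \<Lambda>. A class with
  smaller eigenvalue lam then dies out at rate lam / \<Lambda>, its own rate being irrelevant; the
  zero limit and the rank one limit are stated together.\<close>

lemma power_bound_rescale:
  fixes r q :: "'i \<Rightarrow> real" and M :: "nat \<Rightarrow> 'i \<Rightarrow> 'i \<Rightarrow> real"
  assumes J: "finite J" and \<lambda>: "0 < lam" "lam \<le> \<Lambda>" and \<theta>: "0 \<le> \<theta>" "\<theta> < 1"
    and b: "\<forall>i\<in>J. \<forall>j\<in>J. \<forall>l. \<bar>M l i j / lam ^ l - r i * q j\<bar> \<le> C * \<theta> ^ l"
  shows "\<exists>C' \<theta>'. 0 \<le> \<theta>' \<and> \<theta>' < 1 \<and> 0 \<le> C' \<and>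
    (\<forall>i\<in>J. \<forall>j\<in>J. \<forall>l. \<bar>M l i j / \<Lambda> ^ l - (if lam = \<Lambda> then r i * q j else 0)\<bar> \<le> C' * \<theta>' ^ l)"
proof (cases "lam = \<Lambda>")
  case True
  have "\<bar>M l i j / \<Lambda> ^ l - (if lam = \<Lambda> then r i * q j else 0)\<bar> \<le> \<bar>C\<bar> * \<theta> ^ l"
    if "i \<in> J" "j \<in> J" for i j l
  proof -
    have "C * \<theta> ^ l \<le> \<bar>C\<bar> * \<theta> ^ l" using \<theta> by (intro mult_right_mono) auto
    moreover have "\<bar>M l i j / lam ^ l - r i * q j\<bar> \<le> C * \<theta> ^ l" using b that by blast
    ultimately show ?thesis using True by simp
  qed
  then show ?thesis using \<theta> by (intro exI[of _ "\<bar>C\<bar>"] exI[of _ \<theta>]) simp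
next
  case False
  define B where "B = (\<Sum>i\<in>J. \<Sum>j\<in>J. \<bar>r i * q j\<bar>)"
  have B: "\<bar>r i * q j\<bar> \<le> B" if "i \<in> J" "j \<in> J" for i j
  proof -
    have "\<bar>r i * q j\<bar> \<le> (\<Sum>j\<in>J. \<bar>r i * q j\<bar>)"
      using J that by (intro member_le_sum) auto
    also have "\<dots> \<le> B" unfolding B_def
      using J that by (intro member_le_sum[of i J "\<lambda>i. \<Sum>j\<in>J. \<bar>r i * q j\<bar>"]) (auto intro: sum_nonneg)
    finally show ?thesis .
  qed
  have B0: "B \<ge> 0" unfolding B_def by (intro sum_nonneg) auto
  define \<rho> where "\<rho> = lam / \<Lambda>"
  have \<rho>: "0 \<le> \<rho>" "\<rho> < 1" using \<lambda> False by (auto simp: \<rho>_def)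
  have "\<bar>M l i j / \<Lambda> ^ l - (if lam = \<Lambda> then r i * q j else 0)\<bar> \<le> (B + \<bar>C\<bar>) * \<rho> ^ l"
    if ij: "i \<in> J" "j \<in> J" for i j l
  proof -
    have "C * \<theta> ^ l \<le> \<bar>C\<bar> * 1"
      using \<theta> by (intro mult_mono) (auto simp: power_le_one)
    then have "\<bar>M l i j / lam ^ l\<bar> \<le> B + \<bar>C\<bar>"
      using b[rule_format, OF ij, of l] B[OF ij] by linarith
    then have "\<bar>M l i j / lam ^ l\<bar> * \<rho> ^ l \<le> (B + \<bar>C\<bar>) * \<rho> ^ l"
      using \<rho> by (intro mult_right_mono) auto
    moreover have "\<bar>M l i j / \<Lambda> ^ l\<bar> = \<bar>M l i j / lam ^ l\<bar> * \<rho> ^ l"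
      using \<lambda> by (simp add: \<rho>_def power_divide abs_divide)
    ultimately show ?thesis using False by simp
  qed
  then show ?thesis using \<rho> B0 by (intro exI[of _ "B + \<bar>C\<bar>"] exI[of _ \<rho>]) simp
qed

text \<open>
  The alternatives below: the Perron eigenvalues of the two parity classes differ, or they coincide.
\<close>

lemma parity_positive_powers:
  assumes m: "m \<ge> 1" and A: "parity_positive m A"
  shows "\<exists>\<Lambda> P C \<theta>. convergent_powers (states m) A \<Lambda> P C \<theta> \<and>
    ((\<exists>u v. (\<forall>S\<in>states m. \<forall>S'\<in>states m. P S S' = u S * v S') \<and> (\<Sum>S\<in>states m. u S * v S) = 1)
     \<or> (\<exists>\<mu> q r. \<mu> > 0 \<and> (\<forall>S\<in>states m. q S \<ge> 0) \<and> (\<forall>S\<in>states m. r S \<ge> 0) \<and> q {0} > 0 \<and> r {} > 0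
        \<and> (\<forall>S\<in>states m. (\<Sum>T\<in>states m. A S T * r T) = \<mu> * r S)
        \<and> (\<forall>S\<in>states m. (\<Sum>T\<in>states m. q T * A T S) = \<mu> * q S)))"
proof -
  have fin: "finite (parity_class m p)" for p by (simp add: parity_class_def)
  \<comment> \<open>Here m \<ge> 1 is used: height 0 exists, so the odd class is not empty.\<close>
  have ev: "{} \<in> parity_class m True" and od: "{0} \<in> parity_class m False"
    using m by (auto simp: parity_class_def)
  have pos: "\<forall>S\<in>parity_class m p. \<forall>S'\<in>parity_class m p. A S S' > 0" for p
    using parity_positiveD(1)[OF A] by (auto simp: parity_class_def)
  have ne: "parity_class m True \<noteq> {}" "parity_class m False \<noteq> {}" using ev od by auto
  obtain lam0 \<theta>0 r0 q0 C0 where 0: "lam0 > 0" "0 \<le> \<theta>0" "\<theta>0 < 1"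
    "\<forall>i\<in>parity_class m True. r0 i > 0" "\<forall>i\<in>parity_class m True. q0 i > 0"
    "(\<Sum>i\<in>parity_class m True. q0 i * r0 i) = 1"
    "\<forall>i\<in>parity_class m True. (\<Sum>j\<in>parity_class m True. A i j * r0 j) = lam0 * r0 i"
    "\<forall>j\<in>parity_class m True. (\<Sum>i\<in>parity_class m True. q0 i * A i j) = lam0 * q0 j"
    "\<forall>i\<in>parity_class m True. \<forall>j\<in>parity_class m True. \<forall>l.
       \<bar>mprod (parity_class m True) (replicate l A) i j / lam0 ^ l - r0 i * q0 j\<bar> \<le> C0 * \<theta>0 ^ l"
    using perron_frobenius_positive[OF fin ne(1) pos] by (elim exE conjE)
  obtain lam1 \<theta>1 r1 q1 C1 where 1: "lam1 > 0" "0 \<le> \<theta>1" "\<theta>1 < 1"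
    "\<forall>i\<in>parity_class m False. r1 i > 0" "\<forall>i\<in>parity_class m False. q1 i > 0"
    "(\<Sum>i\<in>parity_class m False. q1 i * r1 i) = 1"
    "\<forall>i\<in>parity_class m False. (\<Sum>j\<in>parity_class m False. A i j * r1 j) = lam1 * r1 i"
    "\<forall>j\<in>parity_class m False. (\<Sum>i\<in>parity_class m False. q1 i * A i j) = lam1 * q1 j"
    "\<forall>i\<in>parity_class m False. \<forall>j\<in>parity_class m False. \<forall>l.
       \<bar>mprod (parity_class m False) (replicate l A) i j / lam1 ^ l - r1 i * q1 j\<bar> \<le> C1 * \<theta>1 ^ l"
    using perron_frobenius_positive[OF fin ne(2) pos] by (elim exE conjE)
  define \<Lambda> where "\<Lambda> = max lam0 lam1"
  have \<Lambda>: "lam0 \<le> \<Lambda>" "lam1 \<le> \<Lambda>" "\<Lambda> > 0" using 0(1) by (auto simp: \<Lambda>_def)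
  obtain C0' \<theta>0' where b0: "0 \<le> \<theta>0'" "\<theta>0' < 1" "0 \<le> C0'"
    "\<forall>i\<in>parity_class m True. \<forall>j\<in>parity_class m True. \<forall>l.
      \<bar>mprod (parity_class m True) (replicate l A) i j / \<Lambda> ^ l - (if lam0 = \<Lambda> then r0 i * q0 j else 0)\<bar> \<le> C0' * \<theta>0' ^ l"
    using power_bound_rescale[OF fin 0(1) \<Lambda>(1) 0(2,3,9)] by (elim exE conjE)
  obtain C1' \<theta>1' where b1: "0 \<le> \<theta>1'" "\<theta>1' < 1" "0 \<le> C1'"
    "\<forall>i\<in>parity_class m False. \<forall>j\<in>parity_class m False. \<forall>l.
      \<bar>mprod (parity_class m False) (replicate l A) i j / \<Lambda> ^ l - (if lam1 = \<Lambda> then r1 i * q1 j else 0)\<bar> \<le> C1' * \<theta>1' ^ l"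
    using power_bound_rescale[OF fin 1(1) \<Lambda>(2) 1(2,3,9)] by (elim exE conjE)
  define R0 where "R0 S = (if even (card S) then r0 S else 0)" for S :: "nat set"
  define Q0 where "Q0 S = (if even (card S) then q0 S else 0)" for S :: "nat set"
  define R1 where "R1 S = (if even (card S) then 0 else r1 S)" for S :: "nat set"
  define Q1 where "Q1 S = (if even (card S) then 0 else q1 S)" for S :: "nat set"
  \<comment> \<open>A sum of the rank one limits of those classes that attain the maximum; its trace
    is 1 or 2.\<close>
  define P where "P S S' = (if lam0 = \<Lambda> then R0 S * Q0 S' else 0) + (if lam1 = \<Lambda> then R1 S * Q1 S' else 0)" for S S'
  define C where "C = max C0' C1'"
  define \<theta> where "\<theta> = max \<theta>0' \<theta>1'"
  have C: "C0' * \<theta>0' ^ l \<le> C * \<theta> ^ l" "C1' * \<theta>1' ^ l \<le> C * \<theta> ^ l" "C * \<theta> ^ l \<ge> 0" for l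
    using b0 b1 by (auto simp: C_def \<theta>_def intro!: mult_mono power_mono)
  have tr0: "(\<Sum>S\<in>states m. R0 S * Q0 S) = 1"
    unfolding 0(6)[symmetric]
    by (subst sum_parity_class[where p = True]) (auto simp: R0_def Q0_def parity_class_def mult.commute intro!: sum.cong)
  have tr1: "(\<Sum>S\<in>states m. R1 S * Q1 S) = 1"
    unfolding 1(6)[symmetric]
    by (subst sum_parity_class[where p = False]) (auto simp: R1_def Q1_def parity_class_def mult.commute intro!: sum.cong)
  have "convergent_powers (states m) A \<Lambda> P C \<theta>"
  proof
    show "finite (states m)" "\<Lambda> > 0" "0 \<le> \<theta>" "\<theta> < 1"
      using \<Lambda> b0 b1 by (auto simp: \<theta>_def)
    show "\<bar>mprod (states m) (replicate l A) S S' / \<Lambda> ^ l - P S S'\<bar> \<le> C * \<theta> ^ l"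
      if S: "S \<in> states m" "S' \<in> states m" for S S' l
    proof (cases "even (card S) = even (card S')")
      case False
      then have "P S S' = 0" by (auto simp: P_def R0_def R1_def Q0_def Q1_def)
      then show ?thesis using mprod_parity_off[OF A S False, of l] C(3) by simp
    next
      case True
      show ?thesis
      proof (cases "even (card S)")
        case e: True
        then have cl: "S \<in> parity_class m True" "S' \<in> parity_class m True"
          using S True by (auto simp: parity_class_def)
        have "P S S' = (if lam0 = \<Lambda> then r0 S * q0 S' else 0)"
          using e True by (simp add: P_def R0_def R1_def Q0_def Q1_def)
        then show ?thesis
          using b0(4)[rule_format, OF cl, of l] C(1)[of l] by (simp add: mprod_parity_class[OF A cl])
      next
        case o: False
        then have cl: "S \<in> parity_class m False" "S' \<in> parity_class m False"
          using S True by (auto simp: parity_class_def)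
        have "P S S' = (if lam1 = \<Lambda> then r1 S * q1 S' else 0)"
          using o True by (simp add: P_def R0_def R1_def Q0_def Q1_def)
        then show ?thesis
          using b1(4)[rule_format, OF cl, of l] C(2)[of l] by (simp add: mprod_parity_class[OF A cl])
      qed
    qed
    have "(\<Sum>S\<in>states m. P S S) = (if lam0 = \<Lambda> then 1 else 0) + (if lam1 = \<Lambda> then 1 else 0)"
      using tr0 tr1 by (simp add: P_def sum.distrib)
    also have "\<dots> > 0" by (auto simp: \<Lambda>_def max_def)
    finally show "0 < (\<Sum>S\<in>states m. P S S)" .
  qed
  moreover have "(\<exists>u v. (\<forall>S\<in>states m. \<forall>S'\<in>states m. P S S' = u S * v S') \<and> (\<Sum>S\<in>states m. u S * v S) = 1)
     \<or> (\<exists>\<mu> q r. \<mu> > 0 \<and> (\<forall>S\<in>states m. q S \<ge> 0) \<and> (\<forall>S\<in>states m. r S \<ge> 0) \<and> q {0} > 0 \<and> r {} > 0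
        \<and> (\<forall>S\<in>states m. (\<Sum>T\<in>states m. A S T * r T) = \<mu> * r S)
        \<and> (\<forall>S\<in>states m. (\<Sum>T\<in>states m. q T * A T S) = \<mu> * q S))"
  proof (cases lam0 lam1 rule: linorder_cases)
    case less
    then have "\<forall>S\<in>states m. \<forall>S'\<in>states m. P S S' = R1 S * Q1 S'"
      by (simp add: P_def \<Lambda>_def)
    then show ?thesis using tr1 by (intro disjI1 exI[of _ R1] exI[of _ Q1] conjI)
  next
    case greater
    then have "\<forall>S\<in>states m. \<forall>S'\<in>states m. P S S' = R0 S * Q0 S'"
      by (simp add: P_def \<Lambda>_def)
    then show ?thesis using tr0 by (intro disjI1 exI[of _ R0] exI[of _ Q0] conjI)
  next
    case equal
    \<comment> \<open>Extended by 0, the even right vector and the odd left vector are eigenvectors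
      of the full matrix, now for one eigenvalue. Opposite parities are taken because a defect
      changes the parity.\<close>
    have "(\<Sum>T\<in>states m. A S T * R0 T) = lam0 * R0 S" if S: "S \<in> states m" for S
    proof -
      have eq: "(\<Sum>T\<in>states m. A S T * R0 T) = (\<Sum>T\<in>parity_class m True. A S T * r0 T)"
        by (subst sum_parity_class[where p = True]) (auto simp: R0_def parity_class_def intro!: sum.cong)
      show ?thesis
      proof (cases "even (card S)")
        case True
        then show ?thesis unfolding eq using 0(7)[rule_format, of S] S by (simp add: R0_def parity_class_def)
      next
        case False
        then have "A S T = 0" if "T \<in> parity_class m True" for T
          using that parity_positiveD(2)[OF A S, of T] by (auto simp: parity_class_def)
        then show ?thesis unfolding eq using False by (simp add: R0_def)
      qed
    qed
    moreover have "(\<Sum>T\<in>states m. Q1 T * A T S) = lam0 * Q1 S" if S: "S \<in> states m" for S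
    proof -
      have eq: "(\<Sum>T\<in>states m. Q1 T * A T S) = (\<Sum>T\<in>parity_class m False. q1 T * A T S)"
        by (subst sum_parity_class[where p = False]) (auto simp: Q1_def parity_class_def intro!: sum.cong)
      show ?thesis
      proof (cases "even (card S)")
        case False
        then show ?thesis unfolding eq using 1(8)[rule_format, of S] S equal by (simp add: Q1_def parity_class_def)
      next
        case True
        then have "A T S = 0" if "T \<in> parity_class m False" for T
          using that parity_positiveD(2)[OF A _ S, of T] by (auto simp: parity_class_def)
        then show ?thesis unfolding eq using True by (simp add: Q1_def)
      qed
    qed
    moreover have "R0 S \<ge> 0" "Q1 S \<ge> 0" if "S \<in> states m" for S
      using that 0(4)[rule_format, of S] 1(5)[rule_format, of S] by (auto simp: R0_def Q1_def parity_class_def less_imp_le)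
    moreover have "R0 {} > 0" "Q1 {0} > 0"
      using 0(4)[rule_format, OF ev] 1(5)[rule_format, OF od] by (auto simp: R0_def Q1_def)
    ultimately show ?thesis
      using 0(1) by (intro disjI2 exI[of _ lam0] exI[of _ Q1] exI[of _ R0] conjI ballI)
  qed
  ultimately show ?thesis by (intro exI conjI)
qed

section \<open>From the eigenvalue alternative to the limit of the correlation\<close>

lemma block_parity_positive:
  assumes n: "n > 0" and W: "\<And>e. e \<in> band_arcs m \<Longrightarrow> W e > 0"
  shows "parity_positive m (block m n W {})"
  unfolding block_def transfer_weight_on_empty
proof (rule parity_positive_mprod)
  show "map (\<lambda>x. transfer_weight m W (int x)) [0..<n] \<noteq> []" using n by simp
  fix A assume "A \<in> set (map (\<lambda>x. transfer_weight m W (int x)) [0..<n])"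
  then obtain x where "A = transfer_weight m W (int x)" unfolding set_map by (elim imageE)
  then show "parity_positive m A" using transfer_weight_parity_positive[of m W "int x"] W by (simp only:)
qed

text \<open>The left vector q is pushed forward through columns 0 to x - 1 and the right vector r is
  pulled back through columns x to n - 1. At the ends of the period the factor \<mu> sits once on
  \<open>L\<close> and once on \<open>R\<close>, so the products agree.\<close>

lemma char_P_1_eq_0_of_eigenvectors:
  assumes m: "m \<ge> 1" and n: "n > 0" "even n"
    and \<mu>: "\<mu> > 0" and nonneg: "\<forall>S\<in>states m. q S \<ge> 0" "\<forall>S\<in>states m. r S \<ge> 0"
    and pos: "q {0} > 0" "r {} > 0"
    and r: "\<forall>S\<in>states m. (\<Sum>T\<in>states m. block m n W {} S T * r T) = \<mu> * r S"
    and q: "\<forall>S\<in>states m. (\<Sum>T\<in>states m. q T * block m n W {} T S) = \<mu> * q S"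
  shows "char_P m n W 1 = 0"
proof -
  define t where "t x = transfer_weight m W (int x)" for x :: nat
  define L where "L x S = (\<Sum>T\<in>states m. q T * mprod (states m) (map t [0..<nat x]) T S)" for x :: int and S
  define R where "R x S = (\<Sum>T\<in>states m. mprod (states m) (map t [nat x..<n]) S T * r T)" for x :: int and S
  have block: "block m n W {} = mprod (states m) (map t [0..<n])"
    unfolding block_def transfer_weight_on_empty t_def ..
  have one: "(\<Sum>T\<in>states m. f T * of_bool (T = S)) = f S" "(\<Sum>T\<in>states m. of_bool (S = T) * f T) = f S"
    if "S \<in> states m" for f :: "nat set \<Rightarrow> real" and S
    using that by (simp_all add: of_bool_def if_distrib[of "\<lambda>x. _ * x"] if_distrib[of "\<lambda>x. x * _"]
        cong: if_cong)
  have L0: "L 0 S = q S" if "S \<in> states m" for S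
    using one(1)[OF that, of q] by (simp only: L_def) simp
  have Rn: "R (int n) S = r S" if "S \<in> states m" for S
    using one(2)[OF that, of r] by (simp only: R_def) simp
  have Ln: "L (int n) S = \<mu> * q S" if "S \<in> states m" for S
    using q that by (simp add: L_def block)
  have R0: "R 0 S = \<mu> * r S" if "S \<in> states m" for S
    using r that by (simp add: R_def block)
  have zero: "{0} \<in> states m" "{} \<in> states m" using m by auto
  show ?thesis
  proof (rule char_P_1_eq_0_of_boundary_vectors[where L = L and R = R, OF m n])
    fix x :: int and S' assume x: "0 \<le> x" "x < int n" and S': "S' \<in> states m"
    have x': "t (nat x) = transfer_weight m W x" using x by (simp add: t_def)
    have "[0..<nat (x + 1)] = [0..<nat x] @ [nat x]" using x by (simp add: nat_add_distrib)
    then have "L (x + 1) S' = (\<Sum>T\<in>states m. q T * mprod (states m) (map t [0..<nat x] @ [t (nat x)]) T S')"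
      by (simp add: L_def)
    also have "\<dots> = (\<Sum>T\<in>states m. q T * (\<Sum>S\<in>states m. mprod (states m) (map t [0..<nat x]) T S * transfer_weight m W x S S'))"
      by (intro sum.cong refl, subst mprod_snoc) (use S' in \<open>simp_all add: x'\<close>)
    also have "\<dots> = (\<Sum>T\<in>states m. \<Sum>S\<in>states m. q T * mprod (states m) (map t [0..<nat x]) T S * transfer_weight m W x S S')"
      by (simp add: sum_distrib_left mult.assoc)
    also have "\<dots> = (\<Sum>S\<in>states m. \<Sum>T\<in>states m. q T * mprod (states m) (map t [0..<nat x]) T S * transfer_weight m W x S S')"
      by (rule sum.swap)
    finally show "(\<Sum>S\<in>states m. L x S * transfer_weight m W x S S') = L (x + 1) S'"
      by (simp add: L_def sum_distrib_right)
  next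
    fix x :: int and S assume x: "0 \<le> x" "x < int n" and S: "S \<in> states m"
    have x': "t (nat x) = transfer_weight m W x" using x by (simp add: t_def)
    have "[nat x..<n] = nat x # [nat (x + 1)..<n]" using x by (simp add: nat_add_distrib upt_conv_Cons)
    then have "R x S = (\<Sum>T\<in>states m. \<Sum>S'\<in>states m. transfer_weight m W x S S' * mprod (states m) (map t [nat (x + 1)..<n]) S' T * r T)"
      by (simp add: R_def x' sum_distrib_right)
    also have "\<dots> = (\<Sum>S'\<in>states m. \<Sum>T\<in>states m. transfer_weight m W x S S' * mprod (states m) (map t [nat (x + 1)..<n]) S' T * r T)"
      by (rule sum.swap)
    finally show "(\<Sum>S'\<in>states m. transfer_weight m W x S S' * R (x + 1) S') = R x S"
      by (simp add: R_def sum_distrib_left mult.assoc)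
  next
    fix S S' assume "S \<in> states m" "S' \<in> states m"
    then show "L (int n) S * R (int n) S' = L 0 S * R 0 S'"
      by (simp only: L0 Ln R0 Rn) simp
  next
    fix S assume S: "S \<in> states m"
    show "L (int n) S \<ge> 0" using Ln[OF S] nonneg S \<mu> by simp
    show "R (int n) S \<ge> 0" using Rn[OF S] nonneg S by simp
  next
    show "L (int n) {0} > 0" "R (int n) {} > 0"
      using Ln[OF zero(1)] Rn[OF zero(2)] pos \<mu> by simp_all
  qed
qed

text \<open>A single estimate for both parts of the theorem: exponential convergence to some
  constant L, together with a criterion for L to vanish. Distance is measured in fundamental
  domains, which is what the transfer matrix sees.\<close>

lemma correlation_limit:
  fixes m n :: nat and W :: "edge \<Rightarrow> real" and e1 e2 :: edge
  assumes m: "m \<ge> 1" and n: "n > 0" "even n"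
    and W': "\<forall>e\<in>band_arcs m. W e > 0"
    and per': "\<forall>e\<in>band_arcs m. W (shift_edge (int n) e) = W e"
    and e: "e1 \<in> band_arcs m" "e2 \<in> band_arcs m"
  shows "\<exists>L K \<theta> :: real. 0 < \<theta> \<and> \<theta> < 1 \<and>
    (\<forall>k. correlation_exists m n W e1 (shift_edge (k * int n) e2) \<and>
      \<bar>correlation m n W e1 (shift_edge (k * int n) e2) - L\<bar>
        \<le> K * \<theta> ^ nat \<bar>xpos (fst e2) div int n + k - xpos (fst e1) div int n\<bar>) \<and>
    (char_P m n W 1 \<noteq> 0 \<longrightarrow> L = 0)"
proof -
  let ?I = "states m"
  let ?A = "block m n W {}"
  have W: "\<And>e. e \<in> band_arcs m \<Longrightarrow> W e > 0"
    and per: "\<And>e. e \<in> band_arcs m \<Longrightarrow> W (shift_edge (int n) e) = W e"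
    using W' per' by auto
  have pp: "parity_positive m ?A"
    by (rule block_parity_positive[OF n(1)]) (rule W)
  obtain \<Lambda> P C \<theta>0 where cp: "convergent_powers ?I ?A \<Lambda> P C \<theta>0"
    and alt: "(\<exists>u v. (\<forall>S\<in>states m. \<forall>S'\<in>states m. P S S' = u S * v S') \<and> (\<Sum>S\<in>states m. u S * v S) = 1)
     \<or> (\<exists>\<mu> q r. \<mu> > 0 \<and> (\<forall>S\<in>states m. q S \<ge> 0) \<and> (\<forall>S\<in>states m. r S \<ge> 0) \<and> q {0} > 0 \<and> r {} > 0
        \<and> (\<forall>S\<in>states m. (\<Sum>T\<in>states m. ?A S T * r T) = \<mu> * r S)
        \<and> (\<forall>S\<in>states m. (\<Sum>T\<in>states m. q T * ?A T S) = \<mu> * q S))"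
    using parity_positive_powers[OF m pp] by (elim exE conjE)
  interpret convergent_powers ?I ?A \<Lambda> P C \<theta>0 by (rule cp)
  define f1 where "f1 = cylinder_edge n e1"
  define f2 where "f2 = cylinder_edge n e2"
  define X where "X = block m n W {f1}"
  define Y where "Y = block m n W {f2}"
  define Z where "Z = block m n W {f1, f2}"
  define c where "c = xpos (fst e1) div int n"
  define d where "d k = xpos (fst e2) div int n + k - c" for k
  define E where "E k = shift_edge (k * int n) e2" for k
  have EB: "E k \<in> band_arcs m" for k using e by (simp add: E_def)
  have cE: "xpos (fst (E k)) div int n = c + d k" for k
    using n by (simp add: E_def d_def)
  have fE: "cylinder_edge n (E k) = f2" for k
    using n by (simp add: E_def f2_def cylinder_edge_def algebra_simps)
  define p1 where "p1 = mtrace ?I [X, P] / (\<Lambda> * \<tau>)"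
  define p2 where "p2 = mtrace ?I [Y, P] / (\<Lambda> * \<tau>)"
  \<comment> \<open>At distance i there are |i| - 1 unmarked domains between the two marked ones,
    hence the exponents; the order of X and Y follows the order of the edges. At distance 0 both
    edges alter the same factor.\<close>
  define p12 where "p12 i = (if i = 0 then mtrace ?I [Z, P] / (\<Lambda> * \<tau>)
    else if i > 0 then mtrace ?I [X, Q (nat i - 1), Y, P] / (\<Lambda>\<^sup>2 * \<tau>)
    else mtrace ?I [Y, Q (nat (- i) - 1), X, P] / (\<Lambda>\<^sup>2 * \<tau>))" for i :: int
  have prob: "cylinder_prob m (l * n) W F
    = mtrace ?I (map (\<lambda>j. block m n W (cylinder_edge n ` {e \<in> F. (xpos (fst e) div int n) mod int l = int j})) [0..<l])
      / mtrace ?I (replicate l ?A)" if "F \<subseteq> band_arcs m" "l > 0" for F l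
    by (rule cylinder_prob_blocks) (use per n W that in auto)
  have single: "(\<lambda>l. cylinder_prob m (l * n) W {e}) \<longlonglongrightarrow> mtrace ?I [block m n W {cylinder_edge n e}, P] / (\<Lambda> * \<tau>)"
    if e: "e \<in> band_arcs m" for e
  proof (rule Lim_transform_eventually[OF one_defect_tendsto])
    show "\<forall>\<^sub>F l in sequentially. mtrace ?I (block m n W {cylinder_edge n e} # replicate (l - 1) ?A) / mtrace ?I (replicate l ?A)
        = cylinder_prob m (l * n) W {e}"
      using eventually_gt_at_top[of 0]
    proof eventually_elim
      case (elim l)
      define j0 where "j0 = nat ((xpos (fst e) div int n) mod int l)"
      have j0: "j0 < l" "(xpos (fst e) div int n) mod int l = int j0" using elim by (auto simp: j0_def nat_less_iff)
      have "block m n W (cylinder_edge n ` {e' \<in> {e}. (xpos (fst e') div int n) mod int l = int j})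
          = (if j = j0 then block m n W {cylinder_edge n e} else ?A)" for j
      proof -
        have "{e' \<in> {e}. (xpos (fst e') div int n) mod int l = int j} = (if j = j0 then {e} else {})"
          using j0(2) by auto
        then show ?thesis by simp
      qed
      then show ?case
        using prob[of "{e}" l] e elim mtrace_one_defect[OF finite_states j0(1)] by simp
    qed
  qed
  have pair: "(\<lambda>l. cylinder_prob m (l * n) W {e1, E k}) \<longlonglongrightarrow> p12 (d k)" for k
  proof -
    have blk: "block m n W (cylinder_edge n ` {e \<in> {e1, E k}. (xpos (fst e) div int n) mod int l = int j})
        = (if c mod int l = int j then (if (c + d k) mod int l = int j then Z else X)
           else if (c + d k) mod int l = int j then Y else ?A)" for l j
    proof -
      have "{e \<in> {e1, E k}. (xpos (fst e) div int n) mod int l = int j}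
        = (if c mod int l = int j then {e1} else {}) \<union> (if (c + d k) mod int l = int j then {E k} else {})"
      proof -
        have "{x \<in> {a, b}. R x} = (if R a then {a} else {}) \<union> (if R b then {b} else {})" for a b :: edge and R
          by auto
        from this[of e1 "E k"] show ?thesis by (simp only: cE c_def)
      qed
      then show ?thesis by (simp add: f1_def[symmetric] fE X_def Y_def Z_def)
    qed
    have pr: "cylinder_prob m (l * n) W {e1, E k} = mtrace ?I (map (\<lambda>j. if c mod int l = int j
           then (if (c + d k) mod int l = int j then Z else X)
           else if (c + d k) mod int l = int j then Y else ?A) [0..<l]) / mtrace ?I (replicate l ?A)"
      if "l > 0" for l
      using prob[of "{e1, E k}" l] e EB that unfolding blk by simp
    define j1 where "j1 l = nat (c mod int l)" for l :: nat
    define j2 where "j2 l = nat ((c + d k) mod int l)" for l :: nat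
    have j: "c mod int l = int (j1 l)" "(c + d k) mod int l = int (j2 l)" "j1 l < l" "j2 l < l" if "l > 0" for l
      using that by (auto simp: j1_def j2_def nat_less_iff)
    have diff: "(int (j2 l) - int (j1 l)) mod int l = d k mod int l" if "l > 0" for l
      unfolding j(1,2)[OF that, symmetric] by (simp add: mod_simps)
    have diff': "(int (j1 l) - int (j2 l)) mod int l = (- d k) mod int l" if "l > 0" for l
      unfolding j(1,2)[OF that, symmetric] by (simp add: mod_simps)
    consider "d k = 0" | "d k > 0" | "d k < 0" by linarith
    then show ?thesis
    proof cases
      case 1
      have "\<forall>\<^sub>F l in sequentially. mtrace ?I (Z # replicate (l - 1) ?A) / mtrace ?I (replicate l ?A)
          = cylinder_prob m (l * n) W {e1, E k}"
        using eventually_gt_at_top[of 0]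
      proof eventually_elim
        case (elim l)
        have "(\<lambda>i. if c mod int l = int i then (if (c + d k) mod int l = int i then Z else X)
           else if (c + d k) mod int l = int i then Y else ?A) = (\<lambda>i. if i = j1 l then Z else ?A)"
          using 1 j(1)[OF elim] by auto
        then show ?case
          using pr[OF elim] mtrace_one_defect[OF finite_states j(3)[OF elim]] by simp
      qed
      then show ?thesis
        using Lim_transform_eventually[OF one_defect_tendsto] 1 by (simp add: p12_def)
    next
      case 2
      have "\<forall>\<^sub>F l in sequentially. mtrace ?I (X # replicate (nat (d k) - 1) ?A @ Y # replicate (l - 1 - nat (d k)) ?A)
          / mtrace ?I (replicate l ?A) = cylinder_prob m (l * n) W {e1, E k}"
        \<comment> \<open>For l beyond the distance, the cyclic distance is the distance itself;
          only the gap on the other side grows with l.\<close>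
        using eventually_gt_at_top[of "nat (d k)"]
      proof eventually_elim
        case (elim l)
        then have l: "l > 0" by simp
        have dk: "(int (j2 l) - int (j1 l)) mod int l = int (nat (d k))"
          using diff[OF l] elim 2 by simp
        then have "j1 l \<noteq> j2 l" using 2 by auto
        then have "(\<lambda>i. if c mod int l = int i then (if (c + d k) mod int l = int i then Z else X)
           else if (c + d k) mod int l = int i then Y else ?A) = (\<lambda>i. if i = j1 l then X else if i = j2 l then Y else ?A)"
          unfolding j(1,2)[OF l] by auto
        then show ?case
          using pr[OF l] mtrace_two_defects[OF finite_states j(3,4)[OF l] _ elim dk] 2 by simp
      qed
      then have "(\<lambda>l. cylinder_prob m (l * n) W {e1, E k}) \<longlonglongrightarrow> mtrace ?I [X, Q (nat (d k) - 1), Y, P] / (\<Lambda>\<^sup>2 * \<tau>)"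
        using 2 by (intro Lim_transform_eventually[OF two_defects_tendsto]) auto
      then show ?thesis using 2 by (simp add: p12_def)
    next
      case 3
      have "\<forall>\<^sub>F l in sequentially. mtrace ?I (Y # replicate (nat (- d k) - 1) ?A @ X # replicate (l - 1 - nat (- d k)) ?A)
          / mtrace ?I (replicate l ?A) = cylinder_prob m (l * n) W {e1, E k}"
        using eventually_gt_at_top[of "nat (- d k)"]
      proof eventually_elim
        case (elim l)
        then have l: "l > 0" by simp
        have dk: "(int (j1 l) - int (j2 l)) mod int l = int (nat (- d k))"
          using diff'[OF l] elim 3 by simp
        then have "j1 l \<noteq> j2 l" using 3 by auto
        then have "(\<lambda>i. if c mod int l = int i then (if (c + d k) mod int l = int i then Z else X)
           else if (c + d k) mod int l = int i then Y else ?A) = (\<lambda>i. if i = j2 l then Y else if i = j1 l then X else ?A)"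
          unfolding j(1,2)[OF l] by auto
        then show ?case
          using pr[OF l] mtrace_two_defects[OF finite_states j(4,3)[OF l] _ elim dk] 3 by simp
      qed
      then have "(\<lambda>l. cylinder_prob m (l * n) W {e1, E k}) \<longlonglongrightarrow> mtrace ?I [Y, Q (nat (- d k) - 1), X, P] / (\<Lambda>\<^sup>2 * \<tau>)"
        using 3 by (intro Lim_transform_eventually[OF two_defects_tendsto]) auto
      then show ?thesis using 3 by (simp add: p12_def)
    qed
  qed
  have s1: "(\<lambda>l. cylinder_prob m (l * n) W {e1}) \<longlonglongrightarrow> p1"
    using single[OF e(1)] by (simp add: p1_def X_def f1_def)
  have s2: "(\<lambda>l. cylinder_prob m (l * n) W {E k}) \<longlonglongrightarrow> p2" for k
    using single[OF EB[of k]] by (simp add: p2_def Y_def fE)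
  have ex: "correlation_exists m n W e1 (E k)" for k
    unfolding correlation_exists_def band_prob_exists_def
    using s1 s2 pair by (auto intro: convergentI)
  have corr: "correlation m n W e1 (E k) = p12 (d k) - p1 * p2" for k
    unfolding correlation_def band_prob_def using limI[OF s1] limI[OF s2[of k]] limI[OF pair[of k]] by simp
  \<comment> \<open>The power between the marked domains is replaced by its limit P. By cyclicity
    the value is the same for both directions, see \<open>swap\<close>.\<close>
  define L where "L = mtrace ?I [X, P, Y, P] / (\<Lambda>\<^sup>2 * \<tau>) - p1 * p2"
  have swap: "mtrace ?I [Y, P, X, P] = mtrace ?I [X, P, Y, P]"
    using mtrace_append_commute[OF finite_states, of m "[Y, P]" "[X, P]"] by simp
  obtain K1 where K1: "K1 \<ge> 0" "\<And>i. \<bar>mtrace ?I [X, Q i, Y, P] - mtrace ?I [X, P, Y, P]\<bar> \<le> K1 * \<theta>0 ^ i"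
    using two_defects_limit_bound[of X Y] by blast
  obtain K2 where K2: "K2 \<ge> 0" "\<And>i. \<bar>mtrace ?I [Y, Q i, X, P] - mtrace ?I [Y, P, X, P]\<bar> \<le> K2 * \<theta>0 ^ i"
    using two_defects_limit_bound[of Y X] by blast
  \<comment> \<open>The rate is kept away from 0 because \<theta> is divided by below and its
    logarithm is taken in the theorem.\<close>
  define \<theta> where "\<theta> = max \<theta>0 (1/2)"
  have \<theta>: "0 < \<theta>" "\<theta> < 1" "\<theta>0 \<le> \<theta>" using th by (auto simp: \<theta>_def)
  define s where "s = \<Lambda>\<^sup>2 * \<tau>"
  have s: "s > 0" using Lam tau_pos by (simp add: s_def)
  \<comment> \<open>Division by \<theta> accounts for the power being one less than the distance;
    the last summand takes care of distance 0.\<close>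
  define K where "K = (K1 + K2) / (s * \<theta>) + \<bar>p12 0 - p1 * p2 - L\<bar>"
  have step: "\<bar>a / s - b / s\<bar> \<le> K * \<theta> ^ Suc i" if h: "\<bar>a - b\<bar> \<le> k * \<theta>0 ^ i" "0 \<le> k" "k \<le> K1 + K2" for a b k i
  proof -
    have "\<bar>a / s - b / s\<bar> = \<bar>a - b\<bar> / s" using s by (simp add: diff_divide_distrib[symmetric] abs_divide)
    also have "\<dots> \<le> (K1 + K2) * \<theta> ^ i / s"
    proof (rule divide_right_mono)
      have "k * \<theta>0 ^ i \<le> (K1 + K2) * \<theta> ^ i"
        using h \<theta> th by (intro mult_mono power_mono) auto
      then show "\<bar>a - b\<bar> \<le> (K1 + K2) * \<theta> ^ i" using h by simp
    qed (use s in simp)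
    also have "\<dots> = (K1 + K2) / (s * \<theta>) * \<theta> ^ Suc i" using \<theta> by simp
    also have "\<dots> \<le> K * \<theta> ^ Suc i"
      unfolding K_def using \<theta> by (intro mult_right_mono) auto
    finally show ?thesis .
  qed
  have bound: "\<bar>p12 i - p1 * p2 - L\<bar> \<le> K * \<theta> ^ nat \<bar>i\<bar>" for i
  proof -
    consider "i = 0" | "i > 0" | "i < 0" by linarith
    then show ?thesis
    proof cases
      case 1
      have "0 \<le> (K1 + K2) / (s * \<theta>)" using K1 K2 s \<theta> by simp
      then show ?thesis using 1 by (simp add: K_def)
    next
      case 2
      then have "nat \<bar>i\<bar> = Suc (nat i - 1)" by simp
      moreover have "p12 i - p1 * p2 - L = mtrace ?I [X, Q (nat i - 1), Y, P] / s - mtrace ?I [X, P, Y, P] / s"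
        using 2 by (simp add: p12_def L_def s_def)
      ultimately show ?thesis
        using step[OF K1(2) K1(1), of "nat i - 1"] K2(1) by simp
    next
      case 3
      then have "nat \<bar>i\<bar> = Suc (nat (- i) - 1)" by simp
      moreover have "p12 i - p1 * p2 - L = mtrace ?I [Y, Q (nat (- i) - 1), X, P] / s - mtrace ?I [Y, P, X, P] / s"
        using 3 by (simp add: p12_def L_def s_def swap)
      ultimately show ?thesis
        using step[OF K2(2) K2(1), of "nat (- i) - 1"] K1(1) by simp
    qed
  qed
  have "L = 0" if nz: "char_P m n W 1 \<noteq> 0"
  proof -
    \<comment> \<open>If the eigenvalues coincided, the eigenvectors of the other alternative would
      give P(1) = 0. So P has rank one.\<close>
    obtain u v where uv: "\<forall>S\<in>?I. \<forall>S'\<in>?I. P S S' = u S * v S'" and tr: "(\<Sum>S\<in>?I. u S * v S) = 1"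
      using alt
    proof (elim disjE exE conjE)
      fix \<mu> q r
      assume "\<mu> > 0" "\<forall>S\<in>?I. q S \<ge> 0" "\<forall>S\<in>?I. r S \<ge> 0" "q {0} > 0" "r {} > 0"
        "\<forall>S\<in>?I. (\<Sum>T\<in>?I. ?A S T * r T) = \<mu> * r S"
        "\<forall>S\<in>?I. (\<Sum>T\<in>?I. q T * ?A T S) = \<mu> * q S"
      then have "char_P m n W 1 = 0"
        by (rule char_P_1_eq_0_of_eigenvectors[OF m n])
      then show thesis using nz by simp
    qed
    have t1: "\<tau> = 1" unfolding \<tau>_def tr[symmetric] using uv by (intro sum.cong) auto
    define g where "g B = (\<Sum>i\<in>?I. \<Sum>k\<in>?I. B i k * u k * v i)" for B :: "nat set \<Rightarrow> nat set \<Rightarrow> real"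
    have g1: "mtrace ?I [B, P] = g B" for B
      unfolding mtrace2[OF finite_states] g_def using uv by (intro sum.cong refl) auto
    \<comment> \<open>Each rank one factor cuts the cyclic trace, leaving a product of two one-edge
      terms. Since \<tau> = 1, this is the product of the limiting probabilities up to
      \<Lambda>^2.\<close>
    have g2: "mtrace ?I [X, P, Y, P] = g X * g Y"
    proof -
      have "mtrace ?I [X, P, Y, P]
          = (\<Sum>i\<in>?I. \<Sum>k\<in>?I. X i k * (\<Sum>h\<in>?I. u k * v h * (\<Sum>g\<in>?I. Y h g * (u g * v i))))"
        unfolding mtrace4[OF finite_states] using uv by (intro sum.cong refl arg_cong2[of _ _ _ _ "(*)"]) auto
      also have "\<dots> = (\<Sum>i\<in>?I. \<Sum>k\<in>?I. (X i k * u k * v i) * g Y)"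
        by (intro sum.cong refl) (simp add: g_def sum_distrib_left sum_distrib_right mult_ac)
      finally show ?thesis by (simp add: g_def sum_distrib_right)
    qed
    show "L = 0" unfolding L_def p1_def p2_def g1 g2 t1 by (simp add: power2_eq_square)
  qed
  moreover have "\<bar>correlation m n W e1 (E k) - L\<bar> \<le> K * \<theta> ^ nat \<bar>d k\<bar>" for k
    using bound[of "d k"] by (simp add: corr)
  ultimately show ?thesis
    using ex \<theta>(1,2) unfolding E_def d_def c_def by blast
qed

theorem proposition3p6:
  fixes m n :: nat and W :: "edge \<Rightarrow> real" and e1 e2 :: edge
  assumes "m \<ge> 1" and "n \<ge> 2" and "even n"
    and W_pos: "\<And>e. e \<in> band_arcs m \<Longrightarrow> W e > 0"
    and W_periodic: "\<And>e. e \<in> band_arcs m \<Longrightarrow> W (shift_edge (int n) e) = W e"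
    and "e1 \<in> band_arcs m" and "e2 \<in> band_arcs m"
  shows
    "((\<forall>z. cmod z = 1 \<longrightarrow> char_P m n W z \<noteq> 0) \<longrightarrow>
       (\<forall>k. correlation_exists m n W e1 (shift_edge (k * int n) e2)) \<and>
       (\<exists>C c. c > 0 \<and>
          (\<forall>k. \<bar>correlation m n W e1 (shift_edge (k * int n) e2)\<bar>
             \<le> C * exp (- c * edge_distance e1 (shift_edge (k * int n) e2)))))
     \<and>
     (isolated_zero (char_P m n W) 1 \<and> zorder (char_P m n W) 1 = 2 \<longrightarrow>
       (\<forall>k. correlation_exists m n W e1 (shift_edge (k * int n) e2)) \<and>
       (\<exists>L. ((\<lambda>k. correlation m n W e1 (shift_edge (k * int n) e2)) \<longlongrightarrow> L)
          (filtercomap (\<lambda>k. edge_distance e1 (shift_edge (k * int n) e2)) at_top)))"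
proof -
  define corr where "corr k = correlation m n W e1 (shift_edge (k * int n) e2)" for k
  define dist where "dist k = edge_distance e1 (shift_edge (k * int n) e2)" for k
  define d where "d k = xpos (fst e2) div int n + k - xpos (fst e1) div int n" for k
  have n: "n > 0" using assms(2) by simp
  have W_pos': "\<forall>e\<in>band_arcs m. W e > 0"
    and W_periodic': "\<forall>e\<in>band_arcs m. W (shift_edge (int n) e) = W e"
    using W_pos W_periodic by blast+
  obtain L K \<theta> :: real where \<theta>: "0 < \<theta>" "\<theta> < 1"
    and ex: "\<forall>k. correlation_exists m n W e1 (shift_edge (k * int n) e2) \<and> \<bar>corr k - L\<bar> \<le> K * \<theta> ^ nat \<bar>d k\<bar>"
    and L: "char_P m n W 1 \<noteq> 0 \<longrightarrow> L = 0"
    using correlation_limit[OF assms(1) n assms(3) W_pos' W_periodic' assms(6,7)]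
    unfolding corr_def d_def by (elim exE conjE)
  \<comment> \<open>Turns the rate per fundamental domain into a rate per column.\<close>
  define c where "c = - ln \<theta> / n"
  have c: "c > 0"
    using \<theta> n ln_less_zero[of \<theta>] by (simp add: c_def divide_neg_pos)
  have K0: "K \<ge> 0"
  proof -
    have "0 \<le> K * \<theta> ^ nat \<bar>d 0\<bar>" using ex by (meson abs_ge_zero order_trans)
    moreover have "\<theta> ^ nat \<bar>d 0\<bar> > 0" using \<theta> by simp
    ultimately show ?thesis by (simp only: zero_le_mult_iff) linarith
  qed
  \<comment> \<open>The positions of the edges inside their domains differ by less than n. The
    additive n is absorbed by the factor exp(c n) in \<open>C\<close>.\<close>
  have dist: "dist k \<le> n * real_of_int \<bar>d k\<bar> + n" for k
  proof -
    let ?x1 = "xpos (fst e1)" and ?x2 = "xpos (fst e2)"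
    have "?x1 - (?x2 + k * int n) = ?x1 mod int n - ?x2 mod int n - int n * d k"
    proof -
      have aux: "x1 - (x2 + k * N) = r1 - r2 - N * (b + k - a)"
        if "x1 = N * a + r1" "x2 = N * b + r2" for x1 x2 r1 r2 a b N :: int
        using that by (simp add: algebra_simps)
      show ?thesis unfolding d_def by (rule aux) simp_all
    qed
    moreover have "0 \<le> ?x1 mod int n" "?x1 mod int n < int n" "0 \<le> ?x2 mod int n" "?x2 mod int n < int n"
      using n by simp_all
    moreover have "\<bar>int n * d k\<bar> = int n * \<bar>d k\<bar>" by (simp add: abs_mult)
    ultimately have "\<bar>?x1 - (?x2 + k * int n)\<bar> \<le> int n * \<bar>d k\<bar> + int n" by linarith
    then have "real_of_int \<bar>?x1 - (?x2 + k * int n)\<bar> \<le> real_of_int (int n * \<bar>d k\<bar> + int n)"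
      by (simp only: of_int_le_iff)
    then show ?thesis by (simp add: dist_def edge_distance_def)
  qed
  define C where "C = K * exp (c * n)"
  have bound: "\<bar>corr k - L\<bar> \<le> C * exp (- c * dist k)" for k
  proof -
    have "\<theta> ^ nat \<bar>d k\<bar> = exp (real (nat \<bar>d k\<bar>) * ln \<theta>)"
      unfolding exp_of_nat_mult using \<theta> by simp
    also have "real (nat \<bar>d k\<bar>) * ln \<theta> = - c * (n * real_of_int \<bar>d k\<bar>)"
      using n by (simp add: c_def)
    also have "exp (- c * (n * real_of_int \<bar>d k\<bar>)) \<le> exp (c * n + - c * dist k)"
      using mult_left_mono[OF dist[of k], of c] c by (simp add: algebra_simps)
    finally have "K * \<theta> ^ nat \<bar>d k\<bar> \<le> K * (exp (c * n) * exp (- c * dist k))"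
      using K0 unfolding exp_add by (rule mult_left_mono)
    then show ?thesis using ex by (simp add: C_def mult.assoc) (meson order_trans)
  qed
  \<comment> \<open>The filter only says that the distance tends to infinity, so k may go to either
    end or jump between them; the bound in terms of the distance covers all of this.\<close>
  have "(corr \<longlongrightarrow> L) (filtercomap dist at_top)"
  proof -
    have "((\<lambda>t. C * exp (- c * t)) \<longlongrightarrow> 0) at_top"
      using c by real_asymp
    then have "((\<lambda>k. C * exp (- c * dist k)) \<longlongrightarrow> 0) (filtercomap dist at_top)"
      by (rule filterlim_compose) (rule filterlim_filtercomap)
    then have "((\<lambda>k. corr k - L) \<longlongrightarrow> 0) (filtercomap dist at_top)"
      by (rule Lim_null_comparison[rotated]) (use bound in simp)
    then show ?thesis by (simp add: LIM_zero_iff)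
  qed
  \<comment> \<open>The hypothesis is applied at z = 1, where it makes L vanish.\<close>
  moreover have "\<bar>corr k\<bar> \<le> C * exp (- c * dist k)" if "\<forall>z. cmod z = 1 \<longrightarrow> char_P m n W z \<noteq> 0" for k
    using bound[of k] L that by simp
  ultimately show ?thesis
    using ex c unfolding corr_def dist_def by blast
qed

end
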